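(* Suppose that, for $\mu$-almost-every $x\in X$, $$0<\liminf_{r\rightarrow0} \frac{V(x,r)}{\tilde{V}_l(r)}<\infty,\qquad 0<\limsup_{r\rightarrow0} \frac{V(x,r)}{\tilde{V}_u(r)},$$ and $$0<\liminf_{r\rightarrow 0} \frac{R(x,B(x,r)^c)}{r}.$$ Then, for $\mu$-almost-every $x\in X$, $$\liminf_{t\rightarrow0}\frac{tp_t(x,x)}{\tilde{h}_u^{-1}(t)}<\infty\qquad\text{and}\qquad 0<\limsup_{t\rightarrow0} \frac{tp_t(x,x)}{\tilde{h}_l^{-1}(t)}<\infty.$$
   Context: **Setting.** $(X,d)$ is a locally compact, separable, connected metric space and $\mu$ is a non-negative Borel measure on $X$, finite on compact sets and strictly positive on non-empty open sets. $(\mathcal{E},\mathcal{F})$ is a local, regular Dirichlet form on $L^2(X,\mu)$, and there is $\mathcal{F}'\supseteq\mathcal{F}$ such that $(\mathcal{E},\mathcal{F}')$ is a resistance form on $X$, i.e.: $\mathcal{F}'$ is a linear space of real functions on $X$ containing constants, $\mathcal{E}$ is a non-negative symmetric quadratic form on it with $\mathcal{E}(u,u)=0$ iff $u$ is constant; $\mathcal{F}'$ modulo constants is a Hilbert space under $\mathcal{E}$; every function on a finite subset of $X$ extends to an element of $\mathcal{F}'$; $\sup\{|u(p)-u(q)|^2/\mathcal{E}(u,u):u\in\mathcal{F}',\mathcal{E}(u,u)>0\}<\infty$ for all $p,q\in X$; and $u\in\mathcal{F}'$ implies $\bar u:=\min(\max(u,0),1)\in\mathcal{F}'$ with $\mathcal{E}(\bar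 u,\bar u)\le\mathcal{E}(u,u)$. For disjoint $A,B\subseteq X$, $R(A,B)^{-1}:=\inf\{\mathcal{E}(f,f):f\in\mathcal{F},f|_A=1,f|_B=0\}$; $R(x,A):=R(\{x\},A)$; $R(x,y):=R(\{x\},\{y\})$ for $x\ne y$ and $R(x,x):=0$. In this setting $R$ is a metric on $X$ (the resistance metric), and it is assumed that it induces the same topology as $d$. $R_X\in(0,\infty]$ is the diameter of $(X,R)$. $B(x,r)$ is the connected component containing $x$ of the open ball $\{y:R(x,y)<r\}$, and $V(x,r):=\mu(B(x,r))$. **Heat kernel.** $-\mathcal{L}$ is the non-negative self-adjoint operator on $L^2(X,\mu)$ associated with $(\mathcal{E},\mathcal{F})$, $P_t=e^{t\mathcal{L}}$, and $(X_t)_{t\ge0}$ is the associated diffusion, so that $P_tf(x)=E^x f(X_t)$. It is assumed that $(P_t)_{t>0}$ has a transition density $(p_t)_{t>0}$ with respect to $\mu$ that is jointly continuous in $(x,y)$ for each $t$, symmetric, and satisfies the Chapman–Kolmogorov equations everywhere. **Volume functions.** $V:[0,\infty)\to[0,\infty)$ is strictly increasing with $V(0)=0$ and $V(2r)\le C_uV(r)$ for all $r$; $\beta_u:=\ln C_u/\ln2$. $\tilde f_l,\tilde f_u:[0,R_X)\to[0,\infty]$ are functions such that (i) $\tilde f_l(r)^{-1},\tilde f_u(r)=O(r^{-\varepsilon})$ as $r\to0$, for some $\varepsilon>0$; (ii) $\tilde f_l$ is increasing and $\tilde f_u$ is decreasing; (iii) $\tilde f_l^{1/b}$ and $\tilde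 f_u^{-1/b}$ are concave on $[0,r_0]$ for some $b,r_0>0$; $\tilde f_l\le1$, $\tilde f_u\ge1$; and $b,\varepsilon<\frac{1}{4(2+\beta_u)}$. No global bound of the form $\tilde f_l(r)V(r)\le V(x,r)\le \tilde f_u(r)V(r)$ is assumed. Set $\tilde V_l:=\tilde f_lV$, $\tilde V_u:=\tilde f_uV$, $\tilde h_l(r):=r\tilde V_l(r)$, $\tilde h_u(r):=r\tilde V_u(r)$ (with $0\cdot\infty=0$). **Convention.** $\varphi^{-1}(s):=\inf\{r:\varphi(r)\ge s\}$ for $\varphi=\tilde h_l,\tilde h_u$ and small $s>0$ (the usual inverse when $\varphi$ is invertible near $0$). *)

theory Defs
  imports "HOL-Analysis.Analysis"
begin

section \<open>Square-integrable functions\<close>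

text \<open>Elements of \<open>L\<^sup>2\<close> are handled through representatives; equality in \<open>L\<^sup>2\<close> is
  equality almost everywhere.\<close>

definition L2 :: "'a measure \<Rightarrow> ('a \<Rightarrow> real) set" where
  "L2 \<mu> = {f \<in> borel_measurable \<mu>. integrable \<mu> (\<lambda>x. (f x)\<^sup>2)}"

definition L2_inner :: "'a measure \<Rightarrow> ('a \<Rightarrow> real) \<Rightarrow> ('a \<Rightarrow> real) \<Rightarrow> real" where
  "L2_inner \<mu> f g = (LINT x|\<mu>. f x * g x)"

definition L2_norm :: "'a measure \<Rightarrow> ('a \<Rightarrow> real) \<Rightarrow> real" where
  "L2_norm \<mu> f = sqrt (L2_inner \<mu> f f)"


section \<open>Quadratic forms on spaces of functions\<close>

text \<open>A quadratic form is given by its polarisation \<open>E u v\<close>.\<close>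

definition function_subspace :: "('a \<Rightarrow> real) set \<Rightarrow> bool" where
  "function_subspace F \<longleftrightarrow>
     (\<lambda>_. 0) \<in> F \<and>
     (\<forall>u\<in>F. \<forall>v\<in>F. (\<lambda>x. u x + v x) \<in> F) \<and>
     (\<forall>c. \<forall>u\<in>F. (\<lambda>x. c * u x) \<in> F)"

definition nonneg_symmetric_form ::
    "(('a \<Rightarrow> real) \<Rightarrow> ('a \<Rightarrow> real) \<Rightarrow> real) \<Rightarrow> ('a \<Rightarrow> real) set \<Rightarrow> bool" where
  "nonneg_symmetric_form E F \<longleftrightarrow>
     function_subspace F \<and>
     (\<forall>u\<in>F. \<forall>v\<in>F. \<forall>w\<in>F. E (\<lambda>x. u x + v x) w = E u w + E v w) \<and>
     (\<forall>c. \<forall>u\<in>F. \<forall>v\<in>F. E (\<lambda>x. c * u x) v = c * E u v) \<and>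
     (\<forall>u\<in>F. \<forall>v\<in>F. E u v = E v u) \<and>
     (\<forall>u\<in>F. 0 \<le> E u u)"

text \<open>Completeness of \<open>F\<close> for a squared seminorm \<open>N\<close>.\<close>

definition complete_for :: "(('a \<Rightarrow> real) \<Rightarrow> real) \<Rightarrow> ('a \<Rightarrow> real) set \<Rightarrow> bool" where
  "complete_for N F \<longleftrightarrow>
     (\<forall>u :: nat \<Rightarrow> 'a \<Rightarrow> real.
        (\<forall>n. u n \<in> F) \<longrightarrow>
        (\<forall>e>0. \<exists>M. \<forall>m\<ge>M. \<forall>n\<ge>M. N (\<lambda>x. u m x - u n x) < e) \<longrightarrow>
        (\<exists>v\<in>F. (\<lambda>n. N (\<lambda>x. u n x - v x)) \<longlonglongrightarrow> 0))"

definition unit_contraction :: "('a \<Rightarrow> real) \<Rightarrow> 'a \<Rightarrow> real" where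
  "unit_contraction u = (\<lambda>x. min (max (u x) 0) 1)"

definition markovian ::
    "(('a \<Rightarrow> real) \<Rightarrow> ('a \<Rightarrow> real) \<Rightarrow> real) \<Rightarrow> ('a \<Rightarrow> real) set \<Rightarrow> bool" where
  "markovian E F \<longleftrightarrow>
     (\<forall>u\<in>F. unit_contraction u \<in> F \<and>
        E (unit_contraction u) (unit_contraction u) \<le> E u u)"


section \<open>Resistance forms\<close>

definition resistance_form ::
    "(('a \<Rightarrow> real) \<Rightarrow> ('a \<Rightarrow> real) \<Rightarrow> real) \<Rightarrow> ('a \<Rightarrow> real) set \<Rightarrow> bool" where
  "resistance_form E F \<longleftrightarrow>
     nonneg_symmetric_form E F \<and>
     (\<forall>c. (\<lambda>_. c) \<in> F) \<and>
     (\<forall>u\<in>F. E u u = 0 \<longleftrightarrow> (\<exists>c. u = (\<lambda>_. c))) \<and>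
     complete_for (\<lambda>u. E u u) F \<and>
     (\<forall>A. \<forall>g :: 'a \<Rightarrow> real. finite A \<longrightarrow> (\<exists>u\<in>F. \<forall>x\<in>A. u x = g x)) \<and>
     (\<forall>p q. bdd_above {(u p - u q)\<^sup>2 / E u u | u. u \<in> F \<and> E u u > 0}) \<and>
     markovian E F"

text \<open>An infimum over the empty set is \<open>\<infinity>\<close>, giving resistance \<open>0\<close>.\<close>

definition resistance ::
    "(('a \<Rightarrow> real) \<Rightarrow> ('a \<Rightarrow> real) \<Rightarrow> real) \<Rightarrow> ('a \<Rightarrow> real) set \<Rightarrow> 'a set \<Rightarrow> 'a set \<Rightarrow> ennreal" where
  "resistance E F A B =
     inverse (INF f\<in>{f \<in> F. (\<forall>x\<in>A. f x = 1) \<and> (\<forall>x\<in>B. f x = 0)}. ennreal (E f f))"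

text \<open>The conversion to \<open>real\<close> sends \<open>\<infinity>\<close> to \<open>0\<close>; whenever the function below is a metric, all
  resistances between distinct points are therefore finite and positive.\<close>

definition res_dist ::
    "(('a \<Rightarrow> real) \<Rightarrow> ('a \<Rightarrow> real) \<Rightarrow> real) \<Rightarrow> ('a \<Rightarrow> real) set \<Rightarrow> 'a \<Rightarrow> 'a \<Rightarrow> real" where
  "res_dist E F x y = (if x = y then 0 else enn2real (resistance E F {x} {y}))"

definition res_diameter ::
    "(('a \<Rightarrow> real) \<Rightarrow> ('a \<Rightarrow> real) \<Rightarrow> real) \<Rightarrow> ('a \<Rightarrow> real) set \<Rightarrow> ennreal" where
  "res_diameter E F = (SUP (x, y)\<in>UNIV. ennreal (res_dist E F x y))"

definition res_ball ::
    "(('a::topological_space \<Rightarrow> real) \<Rightarrow> ('a \<Rightarrow> real) \<Rightarrow> real) \<Rightarrow> ('a \<Rightarrow> real) set \<Rightarrow> 'a \<Rightarrow> real \<Rightarrow> 'a set" where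
  "res_ball E F x r = connected_component_set {y. res_dist E F x y < r} x"


section \<open>Local regular Dirichlet forms\<close>

definition E1 ::
    "'a measure \<Rightarrow> (('a \<Rightarrow> real) \<Rightarrow> ('a \<Rightarrow> real) \<Rightarrow> real) \<Rightarrow> ('a \<Rightarrow> real) \<Rightarrow> real" where
  "E1 \<mu> E u = E u u + L2_inner \<mu> u u"

definition dirichlet_form ::
    "'a measure \<Rightarrow> (('a \<Rightarrow> real) \<Rightarrow> ('a \<Rightarrow> real) \<Rightarrow> real) \<Rightarrow> ('a \<Rightarrow> real) set \<Rightarrow> bool" where
  "dirichlet_form \<mu> E F \<longleftrightarrow>
     F \<subseteq> L2 \<mu> \<and>
     (\<forall>f\<in>L2 \<mu>. \<forall>e>0. \<exists>g\<in>F. L2_norm \<mu> (\<lambda>x. f x - g x) < e) \<and>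
     nonneg_symmetric_form E F \<and>
     complete_for (E1 \<mu> E) F \<and>
     markovian E F"

definition Cc :: "('a::topological_space \<Rightarrow> real) set" where
  "Cc = {f. continuous_on UNIV f \<and> compact (closure {x. f x \<noteq> 0})}"

definition regular_form ::
    "'a::topological_space measure \<Rightarrow> (('a \<Rightarrow> real) \<Rightarrow> ('a \<Rightarrow> real) \<Rightarrow> real) \<Rightarrow> ('a \<Rightarrow> real) set \<Rightarrow> bool" where
  "regular_form \<mu> E F \<longleftrightarrow>
     (\<forall>u\<in>F. \<forall>e>0. \<exists>g\<in>F \<inter> Cc. E1 \<mu> E (\<lambda>x. u x - g x) < e) \<and>
     (\<forall>f\<in>Cc. \<forall>e>0. \<exists>g\<in>F \<inter> Cc. \<forall>x. \<bar>f x - g x\<bar> < e)"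

text \<open>The support of the measure \<open>\<bar>u\<bar> \<cdot> \<mu>\<close>.\<close>

definition ae_support :: "'a::topological_space measure \<Rightarrow> ('a \<Rightarrow> real) \<Rightarrow> 'a set" where
  "ae_support \<mu> u = {x. \<forall>U. open U \<and> x \<in> U \<longrightarrow> \<not> (AE y in \<mu>. y \<in> U \<longrightarrow> u y = 0)}"

definition local_form ::
    "'a::topological_space measure \<Rightarrow> (('a \<Rightarrow> real) \<Rightarrow> ('a \<Rightarrow> real) \<Rightarrow> real) \<Rightarrow> ('a \<Rightarrow> real) set \<Rightarrow> bool" where
  "local_form \<mu> E F \<longleftrightarrow>
     (\<forall>u\<in>F. \<forall>v\<in>F. compact (ae_support \<mu> u) \<and> compact (ae_support \<mu> v) \<and>
        ae_support \<mu> u \<inter> ae_support \<mu> v = {} \<longrightarrow> E u v = 0)"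


section \<open>Generator, semigroup and heat kernel\<close>

text \<open>\<open>form_operator \<mu> E F u w\<close> means that \<open>u\<close> lies in the domain of \<open>\<L>\<close> and \<open>\<L> u = w\<close>, where
  \<open>-\<L>\<close> is the self-adjoint operator with \<open>E(u, v) = \<langle>-\<L> u, v\<rangle>\<close> for all \<open>v\<close> in \<open>F\<close>, on the
  maximal domain contained in \<open>F\<close>.\<close>

definition form_operator ::
    "'a measure \<Rightarrow> (('a \<Rightarrow> real) \<Rightarrow> ('a \<Rightarrow> real) \<Rightarrow> real) \<Rightarrow> ('a \<Rightarrow> real) set
      \<Rightarrow> ('a \<Rightarrow> real) \<Rightarrow> ('a \<Rightarrow> real) \<Rightarrow> bool" where
  "form_operator \<mu> E F u w \<longleftrightarrow>
     w \<in> L2 \<mu> \<and>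
     (\<exists>u'\<in>F. (AE x in \<mu>. u' x = u x) \<and> (\<forall>v\<in>F. E u' v = - L2_inner \<mu> w v))"

definition C0_semigroup :: "'a measure \<Rightarrow> (real \<Rightarrow> ('a \<Rightarrow> real) \<Rightarrow> 'a \<Rightarrow> real) \<Rightarrow> bool" where
  "C0_semigroup \<mu> P \<longleftrightarrow>
     (\<forall>t>0. \<forall>f\<in>L2 \<mu>. P t f \<in> L2 \<mu>) \<and>
     (\<forall>t>0. \<forall>f\<in>L2 \<mu>. \<forall>g\<in>L2 \<mu>. \<forall>a b.
        AE x in \<mu>. P t (\<lambda>y. a * f y + b * g y) x = a * P t f x + b * P t g x) \<and>
     (\<forall>t>0. \<exists>C. \<forall>f\<in>L2 \<mu>. L2_norm \<mu> (P t f) \<le> C * L2_norm \<mu> f) \<and>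
     (\<forall>s>0. \<forall>t>0. \<forall>f\<in>L2 \<mu>. AE x in \<mu>. P (s + t) f x = P s (P t f) x) \<and>
     (\<forall>f\<in>L2 \<mu>. ((\<lambda>t. L2_norm \<mu> (\<lambda>x. P t f x - f x)) \<longlongrightarrow> 0) (at_right 0))"

definition semigroup_generator ::
    "'a measure \<Rightarrow> (real \<Rightarrow> ('a \<Rightarrow> real) \<Rightarrow> 'a \<Rightarrow> real) \<Rightarrow> ('a \<Rightarrow> real) \<Rightarrow> ('a \<Rightarrow> real) \<Rightarrow> bool" where
  "semigroup_generator \<mu> P u w \<longleftrightarrow>
     u \<in> L2 \<mu> \<and> w \<in> L2 \<mu> \<and>
     ((\<lambda>t. L2_norm \<mu> (\<lambda>x. (P t u x - u x) / t - w x)) \<longlongrightarrow> 0) (at_right 0)"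

text \<open>\<open>P\<^sub>t = exp (t\<L>)\<close>, read as: \<open>P\<close> is the strongly continuous semigroup generated by \<open>\<L>\<close>.\<close>

definition form_semigroup ::
    "'a measure \<Rightarrow> (('a \<Rightarrow> real) \<Rightarrow> ('a \<Rightarrow> real) \<Rightarrow> real) \<Rightarrow> ('a \<Rightarrow> real) set
      \<Rightarrow> (real \<Rightarrow> ('a \<Rightarrow> real) \<Rightarrow> 'a \<Rightarrow> real) \<Rightarrow> bool" where
  "form_semigroup \<mu> E F P \<longleftrightarrow>
     C0_semigroup \<mu> P \<and>
     (\<forall>u\<in>L2 \<mu>. \<forall>w\<in>L2 \<mu>. semigroup_generator \<mu> P u w \<longleftrightarrow> form_operator \<mu> E F u w)"

definition transition_density ::
    "'a::topological_space measure \<Rightarrow> (real \<Rightarrow> ('a \<Rightarrow> real) \<Rightarrow> 'a \<Rightarrow> real) \<Rightarrow> (real \<Rightarrow> 'a \<Rightarrow> 'a \<Rightarrow> real) \<Rightarrow> bool" where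
  "transition_density \<mu> P p \<longleftrightarrow>
     (\<forall>t>0. \<forall>x y. 0 \<le> p t x y) \<and>
     (\<forall>t>0. \<forall>f\<in>L2 \<mu>. AE x in \<mu>.
        integrable \<mu> (\<lambda>y. p t x y * f y) \<and> P t f x = (LINT y|\<mu>. p t x y * f y)) \<and>
     (\<forall>t>0. continuous_on UNIV (\<lambda>(x, y). p t x y)) \<and>
     (\<forall>t>0. \<forall>x y. p t x y = p t y x) \<and>
     (\<forall>s>0. \<forall>t>0. \<forall>x y.
        (\<integral>\<^sup>+ z. ennreal (p s x z * p t z y) \<partial>\<mu>) = ennreal (p (s + t) x y))"


section \<open>Volume functions\<close>

text \<open>The rate functions live on \<open>[0, R)\<close>, where \<open>R\<close> may be infinite.\<close>

definition radii :: "ennreal \<Rightarrow> real set" where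
  "radii R = {r. 0 \<le> r \<and> ennreal r < R}"

definition Vtilde :: "(real \<Rightarrow> ennreal) \<Rightarrow> (real \<Rightarrow> real) \<Rightarrow> real \<Rightarrow> ennreal" where
  "Vtilde f V r = f r * ennreal (V r)"

definition htilde :: "(real \<Rightarrow> ennreal) \<Rightarrow> (real \<Rightarrow> real) \<Rightarrow> real \<Rightarrow> ennreal" where
  "htilde f V r = ennreal r * Vtilde f V r"

definition radial_inverse :: "ennreal \<Rightarrow> (real \<Rightarrow> ennreal) \<Rightarrow> real \<Rightarrow> real" where
  "radial_inverse R \<phi> s = Inf {r \<in> radii R. ennreal s \<le> \<phi> r}"

text \<open>Conditions on the fluctuation functions. In \<open>ennreal\<close> we have \<open>inverse 0 = \<infinity>\<close> and
  \<open>inverse \<infinity> = 0\<close>, so the conversions to \<open>real\<close> below are only applied to finite values.\<close>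

definition fluctuation_functions ::
    "ennreal \<Rightarrow> real \<Rightarrow> (real \<Rightarrow> ennreal) \<Rightarrow> (real \<Rightarrow> ennreal) \<Rightarrow> bool" where
  "fluctuation_functions R \<beta> fl fu \<longleftrightarrow>
     mono_on (radii R) fl \<and> antimono_on (radii R) fu \<and>
     (\<forall>r\<in>radii R. fl r \<le> 1) \<and> (\<forall>r\<in>radii R. 1 \<le> fu r) \<and>
     (\<exists>\<epsilon> b r0. 0 < \<epsilon> \<and> 0 < b \<and> 0 < r0 \<and> r0 \<in> radii R \<and>
        \<epsilon> < 1 / (4 * (2 + \<beta>)) \<and> b < 1 / (4 * (2 + \<beta>)) \<and>
        (\<exists>C. \<forall>\<^sub>F r in at_right 0. inverse (fl r) \<le> ennreal (C * r powr (- \<epsilon>))) \<and>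
        (\<exists>C. \<forall>\<^sub>F r in at_right 0. fu r \<le> ennreal (C * r powr (- \<epsilon>))) \<and>
        concave_on {0..r0} (\<lambda>r. enn2real (fl r) powr (1 / b)) \<and>
        concave_on {0..r0} (\<lambda>r. enn2real (inverse (fu r)) powr (1 / b)))"

end

theory Submission
  imports Defs
begin

text \<open>
  Write \<open>\<psi> t = p t x x\<close> and \<open>S t f x\<close> for the integral of \<open>p t x y * f y\<close> over \<open>y\<close>. The argument is analytic:
  in place of exit times of the diffusion it compares energies with values of \<open>S t f\<close> at the single
  point \<open>x\<close>. Two facts carry it.

  \<^item> Resistance controls oscillation: \<open>(u x - u y)\<^sup>2 \<le> 4 * R x y * E u u\<close> for \<open>u\<close> in \<open>F\<close>
    (\<open>res_dist_estimate\<close>).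
  \<^item> Along an arithmetic progression of times the numbers \<open>\<langle>S t f, f\<rangle>\<close> form a convex sequence, because
    \<open>S\<close> is a symmetric semigroup. Comparing its first, average and last decrements gives
    \<open>\<langle>f - S t f, f\<rangle> \<le> t * E f f\<close> and \<open>E (p t x) (p t x) \<le> \<psi> t / t\<close> (\<open>generator_estimates\<close>, extended to
    all of \<open>F\<close> and of \<open>L2\<close> by approximation with resolvents).

  Upper bound. Since the integral of \<open>(p t x y)\<^sup>2\<close> is \<open>\<psi> (2 * t) \<le> \<psi> t\<close>, a ball of radius \<open>r\<close> and measure at
  least \<open>m\<close> contains some \<open>y\<close> with \<open>(p t x y)\<^sup>2 \<le> 2 * \<psi> t / m\<close>. The oscillation bound carries this back to
  \<open>x\<close> and yields \<open>\<psi> t \<le> 4 / m + 8 * r / t\<close> (\<open>heat_kernel_upper\<close>). With the volume lower bound in terms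
  of \<open>fl\<close>, which holds for all small \<open>r\<close>, and \<open>r\<close> twice the inverse of \<open>htilde fl V\<close> at \<open>t\<close>, this
  is the finite upper limit. With radii \<open>r\<close> at which the volume exceeds a multiple of \<open>Vtilde fu V r\<close>, and
  \<open>t = htilde fu V r\<close>, it is the finite lower limit.

  Lower bound. A lower bound \<open>c * r\<close> on the resistance from \<open>x\<close> to the complement of the ball \<open>B\<close> of radius
  \<open>r\<close> yields a function \<open>f\<close> with \<open>f x = 1\<close>, values in \<open>[0, 1]\<close>, support in \<open>B\<close> and \<open>E f f \<le> 2 / (c * r)\<close>.
  The Cauchy-Schwarz inequality for the form \<open>\<langle>f - S h f, g\<rangle>\<close> gives
  \<open>(S s f x - S t f x)\<^sup>2 \<le> \<psi> (2 * s) * (t - s) * E f f\<close> (\<open>S_increment\<close>). By the upper bound for \<open>\<psi>\<close> and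
  the scaling of \<open>htilde fl V\<close>, these increments decay geometrically along the times
  \<open>htilde fl V r / D ^ m\<close>. As \<open>S t f x\<close> tends to \<open>f x = 1\<close> for \<open>t \<longrightarrow> 0\<close>, it is at least \<open>1 / 2\<close> at some
  \<open>t\<close> that is a fixed multiple of \<open>htilde fl V r\<close>. Hence \<open>1 / 4 \<le> (S t f x)\<^sup>2 \<le> \<psi> (2 * t) * \<mu> B\<close>, and
  radii at which \<open>\<mu> B\<close> is at most a multiple of \<open>Vtilde fl V r\<close> give the positive upper limit.
\<close>

section \<open>Symmetric forms\<close>

locale sym_form =
  fixes E :: "('a \<Rightarrow> real) \<Rightarrow> ('a \<Rightarrow> real) \<Rightarrow> real" and F :: "('a \<Rightarrow> real) set"
  assumes form: "nonneg_symmetric_form E F"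
begin

lemma add_mem: "u \<in> F \<Longrightarrow> v \<in> F \<Longrightarrow> (\<lambda>x. u x + v x) \<in> F"
  and scale_mem: "u \<in> F \<Longrightarrow> (\<lambda>x. c * u x) \<in> F"
  using form by (auto simp: nonneg_symmetric_form_def function_subspace_def)

lemma diff_mem: "u \<in> F \<Longrightarrow> v \<in> F \<Longrightarrow> (\<lambda>x. u x - v x) \<in> F"
  using add_mem[of u "\<lambda>x. (-1) * v x"] scale_mem[of v "-1"] by simp

lemma add_left: "u \<in> F \<Longrightarrow> v \<in> F \<Longrightarrow> w \<in> F \<Longrightarrow> E (\<lambda>x. u x + v x) w = E u w + E v w"
  and scale_left: "u \<in> F \<Longrightarrow> w \<in> F \<Longrightarrow> E (\<lambda>x. c * u x) w = c * E u w"
  and sym: "u \<in> F \<Longrightarrow> w \<in> F \<Longrightarrow> E u w = E w u"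
  and nonneg: "u \<in> F \<Longrightarrow> 0 \<le> E u u"
  using form unfolding nonneg_symmetric_form_def by blast+

lemma diff_left: "u \<in> F \<Longrightarrow> v \<in> F \<Longrightarrow> w \<in> F \<Longrightarrow> E (\<lambda>x. u x - v x) w = E u w - E v w"
  using add_left[of u "\<lambda>x. (-1) * v x" w] scale_mem[of v "-1"] scale_left[of v w "-1"] by simp

lemma add_right: "u \<in> F \<Longrightarrow> v \<in> F \<Longrightarrow> w \<in> F \<Longrightarrow> E w (\<lambda>x. u x + v x) = E w u + E w v"
  using add_left[of u v w] sym add_mem by metis

lemma diff_right: "u \<in> F \<Longrightarrow> v \<in> F \<Longrightarrow> w \<in> F \<Longrightarrow> E w (\<lambda>x. u x - v x) = E w u - E w v"
  using diff_left[of u v w] sym diff_mem by metis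

lemma scale_right: "u \<in> F \<Longrightarrow> w \<in> F \<Longrightarrow> E w (\<lambda>x. c * u x) = c * E w u"
  using scale_left[of u w c] sym scale_mem by metis

lemma add_square:
  assumes "u \<in> F" "v \<in> F"
  shows "E (\<lambda>x. u x + c * v x) (\<lambda>x. u x + c * v x) = E u u + 2 * c * E u v + c\<^sup>2 * E v v"
  using assms scale_mem[OF assms(2), of c] sym[OF assms]
  by (simp add: add_left add_right add_mem scale_left scale_right algebra_simps power2_eq_square)

lemma diff_square:
  assumes "u \<in> F" "v \<in> F"
  shows "E (\<lambda>x. u x - v x) (\<lambda>x. u x - v x) = E u u - 2 * E u v + E v v"
  using add_square[OF assms, of "-1"] by simp

lemma add_le:
  assumes "u \<in> F" "v \<in> F"
  shows "E (\<lambda>x. u x + v x) (\<lambda>x. u x + v x) \<le> 2 * E u u + 2 * E v v"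
  using nonneg[OF diff_mem[OF assms]] diff_square[OF assms] add_square[OF assms, of 1] by simp

text \<open>Divide by \<open>e\<close> and let it tend to \<open>0\<close>. This is the first-order condition in both variational arguments
  below, the minimisation defining the resolvent and the effect of a clipping on the energy.\<close>

lemma first_order_nonneg:
  assumes "u \<in> F" "v \<in> F"
    and "\<And>e. 0 < e \<Longrightarrow> 0 \<le> 2 * e * c + e\<^sup>2 * E v v"
  shows "0 \<le> c"
proof (rule ccontr)
  assume "\<not> 0 \<le> c"
  hence c: "c < 0" by simp
  define e where "e = - c / (E v v + 1)"
  have d: "0 < E v v + 1" using nonneg[OF assms(2)] by simp
  have "0 < e" unfolding e_def using c d by (intro divide_pos_pos) simp_all
  from assms(3)[OF this] have "0 \<le> e * (2 * c + e * E v v)"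
    by (simp add: power2_eq_square algebra_simps)
  hence "0 \<le> 2 * c + e * E v v" using \<open>0 < e\<close> by (simp add: zero_le_mult_iff)
  moreover have "e * E v v \<le> e * (E v v + 1)" using \<open>0 < e\<close> by simp
  moreover have "e * (E v v + 1) = - c" using d by (simp add: e_def)
  ultimately show False using c by simp
qed

lemma Cauchy_Schwarz:
  assumes "u \<in> F" "v \<in> F"
  shows "(E u v)\<^sup>2 \<le> E u u * E v v"
proof (cases "E v v = 0")
  case True
  have "0 \<le> E u u + 2 * c * E u v" for c
    using nonneg[OF add_mem[OF assms(1) scale_mem[OF assms(2), of c]]] add_square[OF assms, of c] True by simp
  from this[of "- (E u u + 1) / (2 * E u v)"] have "E u v = 0"
    by (cases "E u v = 0") (auto simp: field_simps)
  then show ?thesis using True by simp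
next
  case False
  hence pos: "0 < E v v" using nonneg[OF assms(2)] by simp
  define c where "c = - E u v / E v v"
  have "0 \<le> E u u + 2 * c * E u v + c\<^sup>2 * E v v"
    using nonneg[OF add_mem[OF assms(1) scale_mem[OF assms(2), of c]]] add_square[OF assms, of c] by simp
  also have "\<dots> = E u u - (E u v)\<^sup>2 / E v v"
    using pos by (simp add: c_def field_simps power2_eq_square)
  finally show ?thesis using pos by (simp add: field_simps)
qed

lemma abs_le_sqrt:
  assumes "u \<in> F" "v \<in> F"
  shows "\<bar>E u v\<bar> \<le> sqrt (E u u) * sqrt (E v v)"
  using Cauchy_Schwarz[OF assms] real_le_rsqrt[of "\<bar>E u v\<bar>" "E u u * E v v"]
  by (simp add: real_sqrt_mult)

text \<open>A form that may be degenerate is still continuous for its own seminorm. Stated for filters, so that it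
  serves sequences as well as limits of small times, both for \<open>E\<close> and for the \<open>L2\<close> inner product.\<close>

lemma tendsto_form:
  assumes "\<And>n. u n \<in> F" "\<And>n. v n \<in> F" "u' \<in> F" "v' \<in> F"
    and "((\<lambda>n. E (\<lambda>x. u n x - u' x) (\<lambda>x. u n x - u' x)) \<longlongrightarrow> 0) G"
    and "((\<lambda>n. E (\<lambda>x. v n x - v' x) (\<lambda>x. v n x - v' x)) \<longlongrightarrow> 0) G"
  shows "((\<lambda>n. E (u n) (v n)) \<longlongrightarrow> E u' v') G"
proof -
  define a where "a n = (\<lambda>x. u n x - u' x)" for n
  define b where "b n = (\<lambda>x. v n x - v' x)" for n
  have aF: "a n \<in> F" and bF: "b n \<in> F" for n
    using assms diff_mem by (auto simp: a_def b_def)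
  have eq: "E (u n) (v n) - E u' v' = E (a n) (b n) + E (a n) v' + E u' (b n)" for n
    using assms(1-4) bF[of n] diff_left[OF assms(1) assms(3) bF, of n n] diff_left[OF assms(1) assms(3) assms(4), of n]
      diff_right[OF assms(2) assms(4) assms(1), of n n] diff_right[OF assms(2) assms(4) assms(3), of n]
    by (simp add: a_def b_def)
  have sa: "((\<lambda>n. sqrt (E (a n) (a n))) \<longlongrightarrow> 0) G"
    using tendsto_real_sqrt[OF assms(5)] by (simp add: a_def)
  have sb: "((\<lambda>n. sqrt (E (b n) (b n))) \<longlongrightarrow> 0) G"
    using tendsto_real_sqrt[OF assms(6)] by (simp add: b_def)
  let ?B = "\<lambda>n. sqrt (E (a n) (a n)) * sqrt (E (b n) (b n)) + sqrt (E (a n) (a n)) * sqrt (E v' v')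
      + sqrt (E u' u') * sqrt (E (b n) (b n))"
  have "((\<lambda>n. E (u n) (v n) - E u' v') \<longlongrightarrow> 0) G"
  proof (rule Lim_null_comparison)
    show "\<forall>\<^sub>F n in G. norm (E (u n) (v n) - E u' v') \<le> ?B n"
    proof (rule always_eventually, rule allI)
      fix n
      show "norm (E (u n) (v n) - E u' v') \<le> ?B n"
        using abs_le_sqrt[OF aF bF, of n n] abs_le_sqrt[OF aF assms(4), of n] abs_le_sqrt[OF assms(3) bF, of n]
        unfolding eq by (simp add: abs_le_iff)
    qed
    have "(?B \<longlongrightarrow> 0 * 0 + 0 * sqrt (E v' v') + sqrt (E u' u') * 0) G"
      by (intro tendsto_intros sa sb)
    then show "(?B \<longlongrightarrow> 0) G" by simp
  qed
  then show ?thesis using LIM_zero_iff by blast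
qed

end

section \<open>Square-integrable functions\<close>

lemma L2_form: "nonneg_symmetric_form (L2_inner \<mu>) (L2 \<mu>)"
  and L2_integrable_mult: "f \<in> L2 \<mu> \<Longrightarrow> g \<in> L2 \<mu> \<Longrightarrow> integrable \<mu> (\<lambda>x. f x * g x)"
proof -
  have int: "integrable \<mu> (\<lambda>x. f x * g x)" if "f \<in> L2 \<mu>" "g \<in> L2 \<mu>" for f g
  proof (rule Bochner_Integration.integrable_bound)
    show "integrable \<mu> (\<lambda>x. (f x)\<^sup>2 + (g x)\<^sup>2)" using that by (simp add: L2_def)
    show "(\<lambda>x. f x * g x) \<in> borel_measurable \<mu>" using that by (auto simp: L2_def)
    show "AE x in \<mu>. norm (f x * g x) \<le> norm ((f x)\<^sup>2 + (g x)\<^sup>2)"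
    proof (rule AE_I2)
      fix x
      have "0 \<le> (\<bar>f x\<bar> - \<bar>g x\<bar>)\<^sup>2" by simp
      hence "2 * (\<bar>f x\<bar> * \<bar>g x\<bar>) \<le> (f x)\<^sup>2 + (g x)\<^sup>2"
        by (simp add: power2_diff)
      moreover have "0 \<le> \<bar>f x\<bar> * \<bar>g x\<bar>" by simp
      ultimately show "norm (f x * g x) \<le> norm ((f x)\<^sup>2 + (g x)\<^sup>2)"
        by (simp only: real_norm_def abs_mult)
    qed
  qed
  then show "f \<in> L2 \<mu> \<Longrightarrow> g \<in> L2 \<mu> \<Longrightarrow> integrable \<mu> (\<lambda>x. f x * g x)" for f g .
  have sub: "function_subspace (L2 \<mu>)"
    unfolding function_subspace_def
  proof (intro conjI ballI allI)
    show "(\<lambda>_. 0) \<in> L2 \<mu>" by (simp add: L2_def)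
    show "(\<lambda>x. u x + v x) \<in> L2 \<mu>" if "u \<in> L2 \<mu>" "v \<in> L2 \<mu>" for u v
      using that int[of u v] by (auto simp: L2_def power2_sum mult.assoc)
    show "(\<lambda>x. c * u x) \<in> L2 \<mu>" if "u \<in> L2 \<mu>" for c u
      using that by (auto simp: L2_def power_mult_distrib)
  qed
  show "nonneg_symmetric_form (L2_inner \<mu>) (L2 \<mu>)"
    unfolding nonneg_symmetric_form_def
    using sub int by (auto simp: L2_inner_def distrib_right mult.assoc intro!: integral_nonneg_AE
        intro: Bochner_Integration.integral_cong)
qed

interpretation L2: sym_form "L2_inner \<mu>" "L2 \<mu>" for \<mu> :: "'a measure"
  by (rule sym_form.intro[OF L2_form])

lemma L2_inner_cong_AE:
  assumes "AE x in \<mu>. f x = f' x" "AE x in \<mu>. g x = g' x"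
    and "f \<in> L2 \<mu>" "f' \<in> L2 \<mu>" "g \<in> L2 \<mu>" "g' \<in> L2 \<mu>"
  shows "L2_inner \<mu> f g = L2_inner \<mu> f' g'"
  unfolding L2_inner_def
proof (rule integral_cong_AE)
  show "AE x in \<mu>. f x * g x = f' x * g' x" using assms(1,2) by eventually_elim simp
qed (use assms(3-) in \<open>auto simp: L2_def\<close>)

lemma L2_inner_square_eq_0D:
  assumes "f \<in> L2 \<mu>" "L2_inner \<mu> f f = 0"
  shows "AE x in \<mu>. f x = 0"
proof -
  have "(LINT x|\<mu>. (f x)\<^sup>2) = 0" using assms(2) by (simp add: L2_inner_def power2_eq_square)
  then show ?thesis using assms(1) by (subst (asm) integral_nonneg_eq_0_iff_AE) (auto simp: L2_def)
qed

section \<open>Resolvent approximation\<close>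

text \<open>The function \<open>u\<close> is the resolvent \<open>\<alpha> (\<alpha> - \<L>)\<^sup>-\<^sup>1 f\<close>, obtained as the minimiser over \<open>F\<close> of
  \<open>J u = E u u + \<alpha> \<parallel>u - f\<parallel>\<^sup>2\<close>. By the parallelogram identity a minimising sequence is Cauchy, so that
  completeness of \<open>F\<close> provides the minimiser; comparing \<open>J u\<close> with \<open>J f = E f f\<close> gives both bounds, and the
  first-order condition is the equation. For \<open>\<alpha> \<longrightarrow> \<infinity>\<close> this approximates \<open>f\<close> by elements of the domain of
  the generator with no increase of energy.\<close>

lemma resolvent_approximation:
  assumes dir: "dirichlet_form \<mu> E F" and f: "f \<in> F" and \<alpha>: "0 < \<alpha>"
  shows "\<exists>u\<in>F. E u u \<le> E f f \<and> \<alpha> * L2_inner \<mu> (\<lambda>x. u x - f x) (\<lambda>x. u x - f x) \<le> E f f \<and>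
     (\<forall>v\<in>F. E u v = - L2_inner \<mu> (\<lambda>x. \<alpha> * (u x - f x)) v)"
proof -
  have FL2: "u \<in> F \<Longrightarrow> u \<in> L2 \<mu>" for u using dir by (auto simp: dirichlet_form_def)
  interpret E: sym_form E F by unfold_locales (use dir in \<open>simp add: dirichlet_form_def\<close>)
  have compl: "complete_for (E1 \<mu> E) F" using dir by (simp add: dirichlet_form_def)
  define J where "J u = E u u + \<alpha> * L2_inner \<mu> (\<lambda>x. u x - f x) (\<lambda>x. u x - f x)" for u
  have J0: "0 \<le> J u" if "u \<in> F" for u
    using E.nonneg[OF that] L2.nonneg[OF FL2[OF E.diff_mem[OF that f]]] \<alpha> by (simp add: J_def)
  define m where "m = Inf (J ` F)"
  have bdd: "bdd_below (J ` F)" using J0 by (auto intro!: bdd_belowI[of _ 0])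
  have mle: "m \<le> J u" if "u \<in> F" for u unfolding m_def using bdd that by (simp add: cINF_lower)
  have "\<exists>u\<in>F. J u < m + 1 / real (Suc n)" for n
  proof -
    have "\<exists>z\<in>J ` F. z < m + 1 / real (Suc n)"
      by (rule cInf_lessD) (use f in \<open>auto simp: m_def\<close>)
    then show ?thesis by auto
  qed
  then obtain u where uF: "\<And>n. u n \<in> F" and uJ: "\<And>n. J (u n) < m + 1 / real (Suc n)" by metis
  have par: "E (\<lambda>x. a x - b x) (\<lambda>x. a x - b x) + \<alpha> * L2_inner \<mu> (\<lambda>x. a x - b x) (\<lambda>x. a x - b x)
      \<le> 2 * J a + 2 * J b - 4 * m" if a: "a \<in> F" and b: "b \<in> F" for a b
  proof -
    define c where "c = (\<lambda>x. (1/2) * (a x + b x))"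
    have c: "c \<in> F" unfolding c_def by (intro E.scale_mem E.add_mem a b)
    define a' where "a' = (\<lambda>x. a x - f x)"
    define b' where "b' = (\<lambda>x. b x - f x)"
    have a': "a' \<in> L2 \<mu>" and b': "b' \<in> L2 \<mu>" using FL2[OF E.diff_mem] a b f by (auto simp: a'_def b'_def)
    have e1: "(\<lambda>x. c x - f x) = (\<lambda>x. (1/2) * (a' x + b' x))" by (auto simp: c_def a'_def b'_def field_simps)
    have e2: "(\<lambda>x. a x - b x) = (\<lambda>x. a' x - b' x)" by (auto simp: a'_def b'_def)
    have Ec: "4 * E c c = E a a + 2 * E a b + E b b"
      using E.add_square[OF a b, of 1] unfolding c_def
      by (simp add: E.scale_left E.scale_right E.add_mem E.scale_mem a b del: times_divide_eq_left)
    have Lc: "4 * L2_inner \<mu> (\<lambda>x. c x - f x) (\<lambda>x. c x - f x)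
        = L2_inner \<mu> a' a' + 2 * L2_inner \<mu> a' b' + L2_inner \<mu> b' b'"
      using L2.add_square[OF a' b', of 1] unfolding e1
      by (simp add: L2.scale_left L2.scale_right L2.add_mem L2.scale_mem a' b' del: times_divide_eq_left)
    have "4 * m \<le> 4 * J c" using mle[OF c] by simp
    also have "4 * J c = 4 * E c c + \<alpha> * (4 * L2_inner \<mu> (\<lambda>x. c x - f x) (\<lambda>x. c x - f x))"
      by (simp add: J_def)
    finally have "4 * m \<le> E a a + 2 * E a b + E b b + \<alpha> * (L2_inner \<mu> a' a' + 2 * L2_inner \<mu> a' b' + L2_inner \<mu> b' b')"
      unfolding Ec Lc .
    moreover have "J a = E a a + \<alpha> * L2_inner \<mu> a' a'" "J b = E b b + \<alpha> * L2_inner \<mu> b' b'"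
      by (simp_all add: J_def a'_def b'_def)
    moreover have "E (\<lambda>x. a x - b x) (\<lambda>x. a x - b x) = E a a - 2 * E a b + E b b"
      by (rule E.diff_square[OF a b])
    moreover have "L2_inner \<mu> (\<lambda>x. a x - b x) (\<lambda>x. a x - b x) = L2_inner \<mu> a' a' - 2 * L2_inner \<mu> a' b' + L2_inner \<mu> b' b'"
      unfolding e2 by (rule L2.diff_square[OF a' b'])
    ultimately show ?thesis by (simp only: distrib_left right_diff_distrib)
  qed
  \<comment> \<open>The seminorm controlled by \<open>J\<close> weighs the \<open>L2\<close> part with \<open>\<alpha>\<close>; the factor \<open>\<kappa>\<close> passes to \<open>E1\<close>.\<close>
  define \<kappa> where "\<kappa> = 1 + 1 / \<alpha>"
  have E1le: "E1 \<mu> E d \<le> \<kappa> * (E d d + \<alpha> * L2_inner \<mu> d d)" if d: "d \<in> F" for d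
  proof -
    have "\<kappa> * (E d d + \<alpha> * L2_inner \<mu> d d) = E d d + L2_inner \<mu> d d + (E d d / \<alpha> + \<alpha> * L2_inner \<mu> d d)"
      using \<alpha> by (simp add: \<kappa>_def field_simps)
    moreover have "0 \<le> E d d / \<alpha> + \<alpha> * L2_inner \<mu> d d"
      using E.nonneg[OF d] L2.nonneg[OF FL2[OF d]] \<alpha> by simp
    ultimately show ?thesis by (simp add: E1_def)
  qed
  have k0: "0 < \<kappa>" using \<alpha> by (simp add: \<kappa>_def add_pos_pos)
  have "\<exists>v\<in>F. (\<lambda>n. E1 \<mu> E (\<lambda>x. u n x - v x)) \<longlonglongrightarrow> 0"
  proof -
    have "\<exists>M. \<forall>i\<ge>M. \<forall>j\<ge>M. E1 \<mu> E (\<lambda>x. u i x - u j x) < e" if e: "0 < e" for e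
    proof -
      obtain M where M: "1 / real (Suc M) < e / (4 * \<kappa>)"
        using reals_Archimedean[of "e / (4 * \<kappa>)"] e k0 by (auto simp: inverse_eq_divide)
      show ?thesis
      proof (intro exI[of _ M] allI impI)
        fix i j assume ij: "M \<le> i" "M \<le> j"
        have *: "1 / real (Suc i) \<le> 1 / real (Suc M)" "1 / real (Suc j) \<le> 1 / real (Suc M)"
          using ij by (auto intro!: divide_left_mono)
        have "E1 \<mu> E (\<lambda>x. u i x - u j x) \<le> \<kappa> * (2 * J (u i) + 2 * J (u j) - 4 * m)"
          using E1le[OF E.diff_mem[OF uF uF], of i j] par[OF uF uF, of i j] k0
          by (meson mult_left_mono less_imp_le order_trans)
        also have "\<dots> < \<kappa> * (4 * (e / (4 * \<kappa>)))"
          by (rule mult_strict_left_mono[OF _ k0]) (use * M uJ[of i] uJ[of j] in linarith)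
        also have "\<dots> = e" using k0 by simp
        finally show "E1 \<mu> E (\<lambda>x. u i x - u j x) < e" .
      qed
    qed
    then show ?thesis using compl uF unfolding complete_for_def by blast
  qed
  then obtain v where v: "v \<in> F" and lim: "(\<lambda>n. E1 \<mu> E (\<lambda>x. u n x - v x)) \<longlonglongrightarrow> 0" by blast
  have dF: "(\<lambda>x. u n x - v x) \<in> F" for n by (rule E.diff_mem[OF uF v])
  have limE: "(\<lambda>n. E (\<lambda>x. u n x - v x) (\<lambda>x. u n x - v x)) \<longlonglongrightarrow> 0"
    by (rule tendsto_sandwich[OF _ _ tendsto_const lim])
      (auto simp: E1_def E.nonneg[OF dF] L2.nonneg[OF FL2[OF dF]])
  have limL: "(\<lambda>n. L2_inner \<mu> (\<lambda>x. u n x - v x) (\<lambda>x. u n x - v x)) \<longlonglongrightarrow> 0"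
    by (rule tendsto_sandwich[OF _ _ tendsto_const lim])
      (auto simp: E1_def E.nonneg[OF dF] L2.nonneg[OF FL2[OF dF]])
  have limJ: "(\<lambda>n. J (u n)) \<longlonglongrightarrow> J v"
    unfolding J_def
  proof (intro tendsto_add tendsto_mult tendsto_const)
    show "(\<lambda>n. E (u n) (u n)) \<longlonglongrightarrow> E v v" by (rule E.tendsto_form[OF uF uF v v limE limE])
    have "(\<lambda>n. L2_inner \<mu> (\<lambda>x. (u n x - f x) - (v x - f x)) (\<lambda>x. (u n x - f x) - (v x - f x))) \<longlonglongrightarrow> 0"
      using limL by simp
    then show "(\<lambda>n. L2_inner \<mu> (\<lambda>x. u n x - f x) (\<lambda>x. u n x - f x)) \<longlonglongrightarrow> L2_inner \<mu> (\<lambda>x. v x - f x) (\<lambda>x. v x - f x)"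
      by (intro L2.tendsto_form FL2 E.diff_mem uF v f)
  qed
  have "J v \<le> m"
  proof (rule LIMSEQ_le[OF limJ])
    show "(\<lambda>n. m + 1 / real (Suc n)) \<longlonglongrightarrow> m"
      using tendsto_add[OF tendsto_const[of m sequentially] LIMSEQ_inverse_real_of_nat] by (simp add: inverse_eq_divide)
    show "\<exists>N. \<forall>n\<ge>N. J (u n) \<le> m + 1 / real (Suc n)" using uJ less_imp_le by blast
  qed
  hence min: "J v \<le> J w" if "w \<in> F" for w using mle[OF that] by simp
  have vf: "(\<lambda>x. v x - f x) \<in> L2 \<mu>" by (rule FL2[OF E.diff_mem[OF v f]])
  have Jf: "J f = E f f" by (simp add: J_def L2_inner_def)
  have E0: "0 \<le> E v v" by (rule E.nonneg[OF v])
  have L0: "0 \<le> L2_inner \<mu> (\<lambda>x. v x - f x) (\<lambda>x. v x - f x)" by (rule L2.nonneg[OF vf])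
  have var: "0 \<le> E v w + \<alpha> * L2_inner \<mu> (\<lambda>x. v x - f x) w" if w: "w \<in> F" for w
  proof -
    have pos: "nonneg_symmetric_form (\<lambda>a b. E a b + \<alpha> * L2_inner \<mu> a b) F"
      unfolding nonneg_symmetric_form_def
    proof (intro conjI ballI allI)
      show "function_subspace F" using E.form by (simp add: nonneg_symmetric_form_def)
      fix a b assume a: "a \<in> F" and b: "b \<in> F"
      show "E (\<lambda>x. a x + b x) c + \<alpha> * L2_inner \<mu> (\<lambda>x. a x + b x) c
          = E a c + \<alpha> * L2_inner \<mu> a c + (E b c + \<alpha> * L2_inner \<mu> b c)" if "c \<in> F" for c
        using a b that by (simp add: E.add_left L2.add_left FL2 distrib_left)
      show "E (\<lambda>x. k * a x) b + \<alpha> * L2_inner \<mu> (\<lambda>x. k * a x) b = k * (E a b + \<alpha> * L2_inner \<mu> a b)" for k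
        using a b by (simp add: E.scale_left L2.scale_left FL2 distrib_left)
      show "E a b + \<alpha> * L2_inner \<mu> a b = E b a + \<alpha> * L2_inner \<mu> b a"
        using E.sym[OF a b] L2.sym[OF FL2[OF a] FL2[OF b]] by simp
    next
      fix a assume a: "a \<in> F"
      show "0 \<le> E a a + \<alpha> * L2_inner \<mu> a a"
        using E.nonneg[OF a] L2.nonneg[OF FL2[OF a]] \<alpha> by simp
    qed
    interpret Q: sym_form "\<lambda>a b. E a b + \<alpha> * L2_inner \<mu> a b" F by unfold_locales (rule pos)
    show ?thesis
    proof (rule Q.first_order_nonneg[OF v w])
      fix e :: real assume "0 < e"
      have "J v \<le> J (\<lambda>x. v x + e * w x)" by (rule min) (intro E.add_mem E.scale_mem v w)
      also have "(\<lambda>x. v x + e * w x - f x) = (\<lambda>x. (v x - f x) + e * w x)" by auto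
      then have "J (\<lambda>x. v x + e * w x) = E v v + 2 * e * E v w + e\<^sup>2 * E w w
          + \<alpha> * (L2_inner \<mu> (\<lambda>x. v x - f x) (\<lambda>x. v x - f x)
            + 2 * e * L2_inner \<mu> (\<lambda>x. v x - f x) w + e\<^sup>2 * L2_inner \<mu> w w)"
        unfolding J_def by (simp only: E.add_square[OF v w] L2.add_square[OF vf FL2[OF w]])
      finally have "0 \<le> 2 * e * E v w + e\<^sup>2 * E w w + \<alpha> * (2 * e * L2_inner \<mu> (\<lambda>x. v x - f x) w + e\<^sup>2 * L2_inner \<mu> w w)"
        unfolding J_def by (simp only: distrib_left)
      then show "0 \<le> 2 * e * (E v w + \<alpha> * L2_inner \<mu> (\<lambda>x. v x - f x) w) + e\<^sup>2 * (E w w + \<alpha> * L2_inner \<mu> w w)"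
        by (simp add: algebra_simps)
    qed
  qed
  have eul: "E v w = - L2_inner \<mu> (\<lambda>x. \<alpha> * (v x - f x)) w" if w: "w \<in> F" for w
  proof -
    have "0 \<le> E v (\<lambda>x. (-1) * w x) + \<alpha> * L2_inner \<mu> (\<lambda>x. v x - f x) (\<lambda>x. (-1) * w x)"
      by (rule var[OF E.scale_mem[OF w]])
    hence "E v w + \<alpha> * L2_inner \<mu> (\<lambda>x. v x - f x) w \<le> 0"
      unfolding E.scale_right[OF w v] L2.scale_right[OF FL2[OF w] vf] by simp
    with var[OF w] show ?thesis unfolding L2.scale_left[OF vf FL2[OF w]] by simp
  qed
  show ?thesis
  proof (rule bexI[OF _ v], intro conjI ballI)
    show "E v v \<le> E f f" using min[OF f] L0 \<alpha> Jf mult_nonneg_nonneg[of \<alpha>] unfolding J_def by (smt (verit) less_imp_le)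
    show "\<alpha> * L2_inner \<mu> (\<lambda>x. v x - f x) (\<lambda>x. v x - f x) \<le> E f f"
      using min[OF f] E0 unfolding Jf by (simp add: J_def)
  qed (rule eul)
qed


section \<open>Resistance controls oscillation\<close>

locale resistance_metric_form = sym_form E F
  for E :: "('a::metric_space \<Rightarrow> real) \<Rightarrow> ('a \<Rightarrow> real) \<Rightarrow> real" and F +
  assumes markov: "markovian E F"
    and metric: "Metric_space UNIV (res_dist E F)"
    and topology: "Metric_space.mtopology UNIV (res_dist E F) = euclidean"
begin

sublocale R: Metric_space UNIV "res_dist E F" by (rule metric)

abbreviation R where "R \<equiv> res_dist E F"

lemma open_R_ball: "open {y. R x y < r}"
proof -
  have "openin R.mtopology (R.mball x r)" by (rule R.openin_mball)
  moreover have "R.mball x r = {y. R x y < r}" by (auto simp: R.in_mball)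
  ultimately show ?thesis by (simp add: topology)
qed

lemma clip_mem: "u \<in> F \<Longrightarrow> 0 < b \<Longrightarrow> (\<lambda>z. min (max (u z) 0) b) \<in> F"
  and clip_le: "u \<in> F \<Longrightarrow> 0 < b \<Longrightarrow> E (\<lambda>z. min (max (u z) 0) b) (\<lambda>z. min (max (u z) 0) b) \<le> E u u"
proof -
  assume u: "u \<in> F" and b: "0 < b"
  define v where "v = (\<lambda>z. (1/b) * u z)"
  have v: "v \<in> F" unfolding v_def by (rule scale_mem[OF u])
  have eq: "(\<lambda>z. min (max (u z) 0) b) = (\<lambda>z. b * unit_contraction v z)"
    using b by (auto simp: unit_contraction_def v_def fun_eq_iff min_def max_def field_simps)
  have cF: "unit_contraction v \<in> F" and cE: "E (unit_contraction v) (unit_contraction v) \<le> E v v"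
    using markov v by (auto simp: markovian_def)
  show "(\<lambda>z. min (max (u z) 0) b) \<in> F" unfolding eq by (rule scale_mem[OF cF])
  have "E v v = (1/b)\<^sup>2 * E u u"
    unfolding v_def using u by (simp only: scale_left scale_right scale_mem power2_eq_square mult.assoc)
  then show "E (\<lambda>z. min (max (u z) 0) b) (\<lambda>z. min (max (u z) 0) b) \<le> E u u"
    unfolding eq using mult_left_mono[OF cE, of "b * b"] b cF
    by (simp add: scale_left scale_right scale_mem field_simps power2_eq_square)
qed

text \<open>Clipping \<open>w + e * v\<close> at \<open>0\<close> and \<open>b\<close> gives back \<open>w\<close>, where \<open>w\<close> is the clipping of \<open>u\<close> and \<open>v = u - w\<close>. So
  \<open>w\<close> minimises the energy in the direction \<open>v\<close>, whence \<open>E w v \<ge> 0\<close> and \<open>E u u \<ge> E v v\<close>. The lemma replaces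
  the subtraction of a constant, which may leave \<open>F\<close>.\<close>

lemma clip_remainder_le:
  assumes u: "u \<in> F" and b: "0 < b"
  defines "v \<equiv> (\<lambda>z. u z - min (max (u z) 0) b)"
  shows "v \<in> F" "E v v \<le> E u u"
proof -
  define w where "w = (\<lambda>z. min (max (u z) 0) b)"
  have w: "w \<in> F" unfolding w_def by (rule clip_mem[OF u b])
  show v: "v \<in> F" unfolding v_def by (intro diff_mem u clip_mem b)
  have "0 \<le> E w v"
  proof (rule first_order_nonneg[OF w v])
    fix e :: real assume e: "0 < e"
    have "min (max (w z + e * v z) 0) b = w z" for z
    proof -
      consider "u z \<le> 0" | "0 < u z" "u z \<le> b" | "b < u z" by linarith
      then show ?thesis
      proof cases
        case 1
        then show ?thesis using b e by (simp add: w_def v_def mult_nonneg_nonpos)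
      next
        case 2
        then show ?thesis by (simp add: w_def v_def)
      next
        case 3
        then show ?thesis using b e by (simp add: w_def v_def)
      qed
    qed
    then have "E w w \<le> E (\<lambda>z. w z + e * v z) (\<lambda>z. w z + e * v z)"
      using clip_le[OF add_mem[OF w scale_mem[OF v, of e]] b] by simp
    then show "0 \<le> 2 * e * E w v + e\<^sup>2 * E v v" using add_square[OF w v, of e] by simp
  qed
  moreover have "u = (\<lambda>z. w z + 1 * v z)" by (auto simp: w_def v_def)
  then have "E u u = E w w + 2 * E w v + E v v" using add_square[OF w v, of 1] by simp
  ultimately show "E v v \<le> E u u" using nonneg[OF w] by simp
qed

text \<open>The definition of resistance after dividing by \<open>v x\<close>. Positivity of the metric rules out that the
  conversion to a real number hid an infinite resistance.\<close>

lemma res_dist_vanishing: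
  assumes v: "v \<in> F" and xy: "x \<noteq> y" and 0: "v y = 0"
  shows "(v x)\<^sup>2 \<le> R x y * E v v"
proof (cases "v x = 0")
  case True
  then show ?thesis using nonneg[OF v] by simp
next
  case False
  define I where "I = (INF f\<in>{f \<in> F. (\<forall>x\<in>{x}. f x = 1) \<and> (\<forall>x\<in>{y}. f x = 0)}. ennreal (E f f))"
  have Rpos: "0 < R x y" using xy R.mdist_pos_eq[of x y] by simp
  have Req: "R x y = enn2real (inverse I)" using xy by (simp add: res_dist_def resistance_def I_def)
  have fin: "inverse I = ennreal (R x y)"
  proof -
    have "inverse I \<noteq> top" using Rpos Req by auto
    then show ?thesis unfolding Req by (simp only: ennreal_enn2real less_top)
  qed
  have eqI: "I = ennreal (1 / R x y)"
  proof (cases I)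
    case (real r)
    with fin Rpos have "inverse r = R x y" by (cases "r = 0") (auto simp: inverse_ennreal)
    then have "r = 1 / R x y" by (metis inverse_eq_divide inverse_inverse_eq)
    with real show ?thesis by simp
  next
    case top
    with fin Rpos show ?thesis by simp
  qed
  define g where "g = (\<lambda>z. (1 / v x) * v z)"
  have g: "g \<in> F" unfolding g_def by (rule scale_mem[OF v])
  have "I \<le> ennreal (E g g)"
    unfolding I_def by (rule INF_lower) (use g 0 False in \<open>auto simp: g_def\<close>)
  hence "1 / R x y \<le> E g g" unfolding eqI using nonneg[OF g] by simp
  also have "E g g = E v v / (v x)\<^sup>2"
    unfolding g_def using v by (simp only: scale_left scale_right scale_mem) (simp add: power2_eq_square)
  finally show ?thesis using Rpos False by (simp add: field_simps)
qed

lemma res_dist_estimate_nonneg: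
  assumes u: "u \<in> F" and y: "0 \<le> u y" "u y \<le> u x"
  shows "(u x - u y)\<^sup>2 \<le> R x y * E u u"
proof (cases "x = y \<or> u y = 0")
  case True
  then show ?thesis using res_dist_vanishing[OF u, of x y] nonneg[OF u] by (cases "x = y") auto
next
  case False
  hence b: "0 < u y" using y by simp
  define v where "v = (\<lambda>z. u z - min (max (u z) 0) (u y))"
  have "(v x)\<^sup>2 \<le> R x y * E v v"
    by (rule res_dist_vanishing) (use False clip_remainder_le[OF u b] b in \<open>auto simp: v_def\<close>)
  also have "\<dots> \<le> R x y * E u u"
    using clip_remainder_le[OF u b] by (intro mult_left_mono) (simp_all add: v_def)
  finally show ?thesis using y by (simp add: v_def)
qed

lemma res_dist_estimate_sign_change:
  assumes u: "u \<in> F" and y: "u y \<le> 0" and x: "0 \<le> u x"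
  shows "(u x)\<^sup>2 \<le> R x y * E u u"
proof (cases "u x = 0")
  case True
  then show ?thesis using nonneg[OF u] by simp
next
  case False
  hence b: "0 < u x" using x by simp
  define w where "w = (\<lambda>z. min (max (u z) 0) (u x))"
  have "(w x)\<^sup>2 \<le> R x y * E w w"
    by (rule res_dist_vanishing) (use clip_mem[OF u b] b y in \<open>auto simp: w_def\<close>)
  also have "\<dots> \<le> R x y * E u u"
    using clip_le[OF u b] by (intro mult_left_mono) (simp_all add: w_def)
  finally show ?thesis using b by (simp add: w_def)
qed

text \<open>The metric is defined with functions in \<open>F\<close> that vanish at one of the two points, so the general case must
  be reduced to that one. If the values at both points have the same sign, clip at the value of smaller
  modulus and keep the remainder; symmetry of the metric decides which point carries the zero. If the signs
  differ, clip to bound each value separately; adding the two bounds costs the factor \<open>4\<close>.\<close>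

lemma res_dist_estimate:
  assumes u: "u \<in> F"
  shows "(u x - u y)\<^sup>2 \<le> 4 * R x y * E u u"
proof -
  define n where "n = (\<lambda>z. (-1) * u z)"
  have n: "n \<in> F" unfolding n_def by (rule scale_mem[OF u])
  have En: "E n n = E u u" unfolding n_def using scale_left[OF u scale_mem[OF u, of "-1"], of "-1"]
    scale_right[OF u u, of "-1"] by simp
  have K: "0 \<le> R x y * E u u" using nonneg[OF u] by simp
  have sq: "(u x - u y)\<^sup>2 \<le> 2 * (u x)\<^sup>2 + 2 * (u y)\<^sup>2"
    using zero_le_power2[of "u x + u y"] by (simp add: power2_sum power2_diff)
  have c: "(u y - u x)\<^sup>2 = (u x - u y)\<^sup>2" by (rule power2_commute)
  have c': "(n x - n y)\<^sup>2 = (u x - u y)\<^sup>2" "(n y - n x)\<^sup>2 = (u x - u y)\<^sup>2" "(n x)\<^sup>2 = (u x)\<^sup>2" "(n y)\<^sup>2 = (u y)\<^sup>2"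
    by (simp_all add: n_def power2_commute)
  consider "0 \<le> u y" "u y \<le> u x" | "0 \<le> u x" "u x \<le> u y" | "0 \<le> n y" "n y \<le> n x"
    | "0 \<le> n x" "n x \<le> n y" | "u y \<le> 0" "0 \<le> u x" | "u x \<le> 0" "0 \<le> u y"
    by (simp add: n_def) linarith
  then have "(u x - u y)\<^sup>2 \<le> 4 * (R x y * E u u)"
  proof cases
    case 1 then show ?thesis using res_dist_estimate_nonneg[OF u] K by fastforce
  next
    case 2 then show ?thesis using res_dist_estimate_nonneg[OF u, of x y] K c R.commute[of x y] by simp
  next
    case 3 then show ?thesis using res_dist_estimate_nonneg[OF n, of y x] K c' En by simp
  next
    case 4 then show ?thesis using res_dist_estimate_nonneg[OF n, of x y] K c' En R.commute[of x y] by simp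
  next
    case 5
    then show ?thesis using res_dist_estimate_sign_change[OF u, of y x] res_dist_estimate_sign_change[OF n, of x y] sq
      c' En R.commute[of x y] by (simp add: n_def)
  next
    case 6
    then show ?thesis using res_dist_estimate_sign_change[OF u, of x y] res_dist_estimate_sign_change[OF n, of y x] sq
      c' En R.commute[of x y] by (simp add: n_def)
  qed
  then show ?thesis by (simp add: mult.assoc)
qed

lemma form_continuous:
  assumes u: "u \<in> F"
  shows "continuous_on UNIV u"
proof -
  have "(u \<longlongrightarrow> u x) (at x)" for x
  proof (rule tendstoI)
    fix e :: real assume e: "0 < e"
    define d where "d = e\<^sup>2 / (4 * (E u u + 1))"
    have E0: "0 \<le> E u u" by (rule nonneg[OF u])
    have d: "0 < d" using e E0 by (simp add: d_def)
    have "dist (u y) (u x) < e" if "R x y < d" for y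
    proof -
      have "(u x - u y)\<^sup>2 \<le> 4 * R x y * E u u" by (rule res_dist_estimate[OF u])
      also have "\<dots> \<le> 4 * d * E u u" using that E0 by (intro mult_right_mono) auto
      also have "\<dots> < 4 * d * (E u u + 1)" using d by (simp add: mult_strict_left_mono)
      also have "\<dots> = e\<^sup>2" using E0 by (simp add: d_def field_simps)
      finally have "\<bar>u x - u y\<bar> < e" using e by (metis abs_le_square_iff abs_of_pos not_le)
      then show ?thesis by (simp add: dist_real_def abs_minus_commute)
    qed
    then show "\<forall>\<^sub>F y in at x. dist (u y) (u x) < e"
      unfolding eventually_at_topological
      using open_R_ball[of x d] d by (intro exI[of _ "{y. R x y < d}"]) auto
  qed
  then show ?thesis by (simp add: continuous_on_def)
qed

end

section \<open>Measures on separable locally compact spaces\<close>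

text \<open>Elements of \<open>L2\<close> are functions here, and the given semigroup acts on them only up to null sets. This
  lemma turns identities between continuous versions into identities at every point.\<close>

lemma AE_eq_continuous_eq:
  fixes f g :: "'a::topological_space \<Rightarrow> real"
  assumes "sets \<mu> = sets borel" "\<And>U. open U \<Longrightarrow> U \<noteq> {} \<Longrightarrow> 0 < emeasure \<mu> U"
    and "continuous_on UNIV f" "continuous_on UNIV g" "AE x in \<mu>. f x = g x"
  shows "f = g"
proof (rule ccontr)
  assume "f \<noteq> g"
  define U where "U = {x. f x \<noteq> g x}"
  have "open U" unfolding U_def by (rule open_Collect_neq[OF assms(3,4)])
  moreover have "U \<noteq> {}" using \<open>f \<noteq> g\<close> by (auto simp: U_def)
  ultimately have "0 < emeasure \<mu> U" by (rule assms(2))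
  moreover have "emeasure \<mu> U = 0"
    using assms(5) \<open>open U\<close> assms(1) by (subst (asm) AE_iff_measurable[of U]) (auto simp: U_def sets_eq_imp_space_eq[OF assms(1)])
  ultimately show False by simp
qed

lemma borel_measurable_continuous:
  fixes f :: "'a::topological_space \<Rightarrow> real"
  assumes "sets \<mu> = sets borel" "continuous_on UNIV f"
  shows "f \<in> borel_measurable \<mu>"
  using borel_measurable_continuous_onI[OF assms(2)] measurable_cong_sets[OF assms(1) refl] by blast

lemma L2_cong_AE:
  assumes "f \<in> L2 \<mu>" "g \<in> borel_measurable \<mu>" "AE x in \<mu>. f x = g x"
  shows "g \<in> L2 \<mu>"
proof -
  have "integrable \<mu> (\<lambda>x. (g x)\<^sup>2) \<longleftrightarrow> integrable \<mu> (\<lambda>x. (f x)\<^sup>2)"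
    by (rule integrable_cong_AE) (use assms in \<open>auto simp: L2_def\<close>)
  then show ?thesis using assms by (simp add: L2_def)
qed

text \<open>A countable base of the topology, made explicit because the type carries no second-countability.\<close>

lemma countable_ball_base:
  assumes "separable_space (euclidean :: 'a::metric_space topology)"
  obtains D :: "'a::metric_space set" where "countable D"
    "\<And>x e. 0 < e \<Longrightarrow> \<exists>d\<in>D. \<exists>n. x \<in> ball d (1 / real (Suc n)) \<and> ball d (1 / real (Suc n)) \<subseteq> ball x e"
proof -
  obtain D :: "'a set" where D: "countable D" "closure D = UNIV"
    using assms by (auto simp: separable_space_def)
  have "\<exists>d\<in>D. \<exists>n. x \<in> ball d (1 / real (Suc n)) \<and> ball d (1 / real (Suc n)) \<subseteq> ball x e" if e: "0 < e" for x e
  proof -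
    obtain n where n: "1 / real (Suc n) < e / 2" using reals_Archimedean[of "e/2"] e by (auto simp: inverse_eq_divide)
    have "x \<in> closure D" using D by simp
    then obtain d where d: "d \<in> D" "dist d x < 1 / real (Suc n)"
      unfolding closure_approachable by (metis of_nat_0_less_iff zero_less_Suc zero_less_divide_1_iff)
    have "ball d (1 / real (Suc n)) \<subseteq> ball x e"
    proof
      fix y assume "y \<in> ball d (1 / real (Suc n))"
      then show "y \<in> ball x e" using d n dist_triangle[of x y d] by (simp add: dist_commute)
    qed
    then show ?thesis using d by (intro bexI[of _ d] exI[of _ n]) auto
  qed
  then show ?thesis using that D(1) by blast
qed

lemma sigma_finite_locally_compact:
  fixes \<mu> :: "'a::metric_space measure"
  assumes "locally_compact_space (euclidean :: 'a topology)" "separable_space (euclidean :: 'a topology)"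
    and sets: "sets \<mu> = sets borel" and fin: "\<And>K. compact K \<Longrightarrow> emeasure \<mu> K < \<infinity>"
  shows "sigma_finite_measure \<mu>"
proof -
  obtain D :: "'a set" where D: "countable D"
    "\<And>x e. 0 < e \<Longrightarrow> \<exists>d\<in>D. \<exists>n. x \<in> ball d (1 / real (Suc n)) \<and> ball d (1 / real (Suc n)) \<subseteq> ball x e"
    by (rule countable_ball_base[OF assms(2)]) blast
  define B where "B = {U \<in> (\<lambda>(d, n). ball d (1 / real (Suc n))) ` (D \<times> UNIV). emeasure \<mu> U \<noteq> \<infinity>}"
  have "countable B" unfolding B_def using D(1) by (intro countable_Collect) auto
  moreover have "B \<subseteq> sets \<mu>" by (auto simp: B_def sets)
  moreover have "\<Union>B = space \<mu>"
  proof -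
    have "x \<in> \<Union>B" for x
    proof -
      obtain U K where UK: "open U" "compact K" "x \<in> U" "U \<subseteq> K"
        using assms(1) unfolding locally_compact_space_def by (metis UNIV_I compactin_euclidean_iff open_openin topspace_euclidean)
      then obtain e where e: "0 < e" "ball x e \<subseteq> U" by (meson open_contains_ball)
      obtain d n where dn: "d \<in> D" "x \<in> ball d (1 / real (Suc n))" "ball d (1 / real (Suc n)) \<subseteq> ball x e"
        using D(2)[OF e(1)] by blast
      have "emeasure \<mu> (ball d (1 / real (Suc n))) \<le> emeasure \<mu> K"
        by (rule emeasure_mono) (use dn e UK in \<open>auto simp: sets compact_imp_closed\<close>)
      also have "\<dots> < \<infinity>" by (rule fin[OF UK(2)])
      finally have "ball d (1 / real (Suc n)) \<in> B" using dn(1) unfolding B_def by force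
      then show ?thesis using dn(2) by blast
    qed
    then show ?thesis using sets_eq_imp_space_eq[OF sets] by auto
  qed
  moreover have "\<forall>a\<in>B. emeasure \<mu> a \<noteq> \<infinity>" by (simp add: B_def)
  ultimately show ?thesis by (intro sigma_finite_measure.intro) blast
qed

lemma borel_measurable_pair_continuous:
  fixes h :: "'a::metric_space \<times> 'a \<Rightarrow> real"
  assumes "separable_space (euclidean :: 'a topology)"
    and sets: "sets \<mu> = sets borel" and h: "continuous_on UNIV h"
  shows "h \<in> borel_measurable (\<mu> \<Otimes>\<^sub>M \<mu>)"
proof (rule borel_measurableI)
  obtain D :: "'a set" where D: "countable D"
    "\<And>x e. 0 < e \<Longrightarrow> \<exists>d\<in>D. \<exists>n. x \<in> ball d (1 / real (Suc n)) \<and> ball d (1 / real (Suc n)) \<subseteq> ball x e"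
    by (rule countable_ball_base[OF assms(1)]) blast
  define \<B> where "\<B> = (\<lambda>(d, n). ball d (1 / real (Suc n))) ` (D \<times> UNIV)"
  have cB: "countable \<B>" using D(1) by (auto simp: \<B>_def)
  have oB: "A \<in> sets \<mu>" if "A \<in> \<B>" for A using that by (auto simp: \<B>_def sets)
  fix S :: "real set" assume "open S"
  define U where "U = h -` S"
  have oU: "open U" unfolding U_def using h \<open>open S\<close> by (simp add: open_vimage)
  have "U = (\<Union>(A, B)\<in>{(A, B). A \<in> \<B> \<and> B \<in> \<B> \<and> A \<times> B \<subseteq> U}. A \<times> B)"
  proof (intro equalityI subsetI)
    fix z assume "z \<in> U"
    obtain x y where z: "z = (x, y)" by force
    from \<open>z \<in> U\<close> oU obtain V W where VW: "open V" "open W" "x \<in> V" "y \<in> W" "V \<times> W \<subseteq> U"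
      unfolding z open_prod_def by (metis mem_Sigma_iff)
    obtain e where e: "0 < e" "ball x e \<subseteq> V" using VW by (meson open_contains_ball)
    obtain e' where e': "0 < e'" "ball y e' \<subseteq> W" using VW by (meson open_contains_ball)
    obtain d n where dn: "d \<in> D" "x \<in> ball d (1 / real (Suc n))" "ball d (1 / real (Suc n)) \<subseteq> ball x e"
      using D(2)[OF e(1)] by blast
    obtain d' n' where dn': "d' \<in> D" "y \<in> ball d' (1 / real (Suc n'))" "ball d' (1 / real (Suc n')) \<subseteq> ball y e'"
      using D(2)[OF e'(1)] by blast
    have "ball d (1 / real (Suc n)) \<times> ball d' (1 / real (Suc n')) \<subseteq> U" using dn(3) dn'(3) e(2) e'(2) VW(5) by blast
    moreover have "ball d (1 / real (Suc n)) \<in> \<B>" "ball d' (1 / real (Suc n')) \<in> \<B>"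
      using dn(1) dn'(1) by (auto simp: \<B>_def)
    ultimately show "z \<in> (\<Union>(A, B)\<in>{(A, B). A \<in> \<B> \<and> B \<in> \<B> \<and> A \<times> B \<subseteq> U}. A \<times> B)"
      using z dn(2) dn'(2) by blast
  qed auto
  moreover have "(\<Union>(A, B)\<in>{(A, B). A \<in> \<B> \<and> B \<in> \<B> \<and> A \<times> B \<subseteq> U}. A \<times> B) \<in> sets (\<mu> \<Otimes>\<^sub>M \<mu>)"
  proof (rule sets.countable_UN')
    show "countable {(A, B). A \<in> \<B> \<and> B \<in> \<B> \<and> A \<times> B \<subseteq> U}"
      by (rule countable_subset[of _ "\<B> \<times> \<B>"]) (auto simp: cB)
  qed (auto intro!: oB)
  ultimately have "U \<in> sets (\<mu> \<Otimes>\<^sub>M \<mu>)" by simp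
  moreover have "space (\<mu> \<Otimes>\<^sub>M \<mu>) = UNIV" using sets_eq_imp_space_eq[OF sets] by (simp add: space_pair_measure)
  ultimately show "h -` S \<inter> space (\<mu> \<Otimes>\<^sub>M \<mu>) \<in> sets (\<mu> \<Otimes>\<^sub>M \<mu>)" by (simp add: U_def)
qed


section \<open>The heat semigroup through its kernel\<close>

locale heat_kernel_form = resistance_metric_form E F
  for E :: "('a::metric_space \<Rightarrow> real) \<Rightarrow> ('a \<Rightarrow> real) \<Rightarrow> real" and F +
  fixes \<mu> :: "'a measure" and P :: "real \<Rightarrow> ('a \<Rightarrow> real) \<Rightarrow> 'a \<Rightarrow> real"
    and p :: "real \<Rightarrow> 'a \<Rightarrow> 'a \<Rightarrow> real"
  assumes loc_compact: "locally_compact_space (euclidean :: 'a topology)"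
    and separable: "separable_space (euclidean :: 'a topology)"
    and sets_\<mu>: "sets \<mu> = sets borel"
    and compact_finite: "\<And>K. compact K \<Longrightarrow> emeasure \<mu> K < \<infinity>"
    and open_pos: "\<And>U. open U \<Longrightarrow> U \<noteq> {} \<Longrightarrow> 0 < emeasure \<mu> U"
    and dirichlet: "dirichlet_form \<mu> E F"
    and semigroup: "form_semigroup \<mu> E F P"
    and density: "transition_density \<mu> P p"
begin

abbreviation inn where "inn \<equiv> L2_inner \<mu>"

lemma F_L2: "u \<in> F \<Longrightarrow> u \<in> L2 \<mu>"
  using dirichlet by (auto simp: dirichlet_form_def)

lemma p_nonneg: "0 < t \<Longrightarrow> 0 \<le> p t x y"
  using density by (simp add: transition_density_def)

lemma p_sym: "0 < t \<Longrightarrow> p t x y = p t y x"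
  using density unfolding transition_density_def by metis

lemma p_joint_continuous: "0 < t \<Longrightarrow> continuous_on UNIV (\<lambda>(x, y). p t x y)"
  using density by (simp add: transition_density_def)

lemma Chapman_Kolmogorov: "0 < s \<Longrightarrow> 0 < t \<Longrightarrow>
    (\<integral>\<^sup>+ z. ennreal (p s x z * p t z y) \<partial>\<mu>) = ennreal (p (s + t) x y)"
  using density[unfolded transition_density_def, THEN conjunct2, THEN conjunct2, THEN conjunct2, THEN conjunct2]
  by simp

lemma P_density: "0 < t \<Longrightarrow> f \<in> L2 \<mu> \<Longrightarrow> AE x in \<mu>.
        integrable \<mu> (\<lambda>y. p t x y * f y) \<and> P t f x = (LINT y|\<mu>. p t x y * f y)"
  using density[unfolded transition_density_def, THEN conjunct2, THEN conjunct1] by blast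

lemma p_continuous: "0 < t \<Longrightarrow> continuous_on UNIV (p t x)"
  using continuous_on_compose2[OF p_joint_continuous, of t UNIV "\<lambda>y. (x, y)"]
  by (simp add: continuous_on_Pair)

lemma p_diagonal_continuous: "0 < t \<Longrightarrow> continuous_on UNIV (\<lambda>x. p t x x)"
  using continuous_on_compose2[OF p_joint_continuous, of t UNIV "\<lambda>y. (y, y)"]
  by (simp add: continuous_on_Pair)

lemma p_measurable: "0 < t \<Longrightarrow> p t x \<in> borel_measurable \<mu>"
  by (rule borel_measurable_continuous[OF sets_\<mu> p_continuous])

lemma p_L2: assumes t: "0 < t" shows "p t x \<in> L2 \<mu>"
proof -
  have "integrable \<mu> (\<lambda>y. (p t x y)\<^sup>2)"
  proof (rule integrableI_nonneg)
    show "(\<lambda>y. (p t x y)\<^sup>2) \<in> borel_measurable \<mu>" using p_measurable[OF t, of x] by simp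
    have "(\<integral>\<^sup>+ y. ennreal ((p t x y)\<^sup>2) \<partial>\<mu>) = (\<integral>\<^sup>+ z. ennreal (p t x z * p t z x) \<partial>\<mu>)"
      by (rule nn_integral_cong) (metis p_sym[OF t] power2_eq_square)
    then show "(\<integral>\<^sup>+ y. ennreal ((p t x y)\<^sup>2) \<partial>\<mu>) < \<infinity>"
      using Chapman_Kolmogorov[OF t t, of x x] by simp
  qed simp
  then show ?thesis using p_measurable[OF t] by (simp add: L2_def)
qed

lemma inner_p: assumes s: "0 < s" and t: "0 < t" shows "inn (p s x) (p t y) = p (s + t) x y"
proof -
  have "inn (p s x) (p t y) = enn2real (\<integral>\<^sup>+ z. ennreal (p s x z * p t y z) \<partial>\<mu>)"
    unfolding L2_inner_def
    by (rule integral_eq_nn_integral) (use p_measurable s t p_nonneg in auto)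
  also have "(\<integral>\<^sup>+ z. ennreal (p s x z * p t y z) \<partial>\<mu>) = ennreal (p (s + t) x y)"
    using Chapman_Kolmogorov[OF s t, of x y] p_sym[OF t, of y] by simp
  finally show ?thesis using p_nonneg[of "s + t" x y] s t by simp
qed

text \<open>Integration against the kernel fixes one version of \<open>P t f\<close>, continuous and defined at every point. The
  value at \<open>t = 0\<close> is the identity, so that the semigroup law covers closed intervals of times.\<close>

definition S :: "real \<Rightarrow> ('a \<Rightarrow> real) \<Rightarrow> 'a \<Rightarrow> real" where
  "S t f = (if t = 0 then f else (\<lambda>x. inn (p t x) f))"

lemma S_0 [simp]: "S 0 f = f" by (simp add: S_def)

lemma S_p: "0 \<le> t \<Longrightarrow> 0 < s \<Longrightarrow> S t (p s x) = p (t + s) x"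
  using inner_p[of t s _ x] p_sym[of "t + s" x] by (auto simp: S_def)

lemma S_diff: "0 \<le> t \<Longrightarrow> f \<in> L2 \<mu> \<Longrightarrow> g \<in> L2 \<mu> \<Longrightarrow> S t (\<lambda>x. f x - g x) = (\<lambda>x. S t f x - S t g x)"
  by (simp add: S_def L2.diff_right p_L2 fun_eq_iff)

lemma S_add: "0 \<le> t \<Longrightarrow> f \<in> L2 \<mu> \<Longrightarrow> g \<in> L2 \<mu> \<Longrightarrow> S t (\<lambda>x. f x + g x) = (\<lambda>x. S t f x + S t g x)"
  by (simp add: S_def L2.add_right p_L2 fun_eq_iff)

lemma S_scale: "0 \<le> t \<Longrightarrow> f \<in> L2 \<mu> \<Longrightarrow> S t (\<lambda>x. c * f x) = (\<lambda>x. c * S t f x)"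
  by (simp add: S_def L2.scale_right p_L2 fun_eq_iff)

lemma S_bound: "0 < t \<Longrightarrow> f \<in> L2 \<mu> \<Longrightarrow> (S t f x)\<^sup>2 \<le> p (2 * t) x x * inn f f"
  using L2.Cauchy_Schwarz[OF p_L2, of t f x] inner_p[of t t x x] by (simp add: S_def)

lemma S_continuous:
  assumes t: "0 < t" and f: "f \<in> L2 \<mu>"
  shows "continuous_on UNIV (S t f)"
proof -
  have "(S t f \<longlongrightarrow> S t f y) (at y)" for y
  proof (rule LIM_zero_cancel, rule Lim_null_comparison)
    define d where "d x = p (2*t) x x - 2 * p (2*t) x y + p (2*t) y y" for x
    have "norm (S t f x - S t f y) \<le> sqrt (d x) * sqrt (inn f f)" for x
    proof -
      have "S t f x - S t f y = inn (\<lambda>z. p t x z - p t y z) f"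
        using t by (simp add: S_def L2.diff_left[OF p_L2[OF t] p_L2[OF t] f])
      moreover have "inn (\<lambda>z. p t x z - p t y z) (\<lambda>z. p t x z - p t y z) = d x"
        using L2.diff_square[OF p_L2[OF t] p_L2[OF t], of x y] by (simp add: inner_p t d_def)
      ultimately show ?thesis
        using L2.abs_le_sqrt[OF L2.diff_mem[OF p_L2[OF t] p_L2[OF t]] f, of x y] by simp
    qed
    then show "\<forall>\<^sub>F x in at y. norm (S t f x - S t f y) \<le> sqrt (d x) * sqrt (inn f f)"
      by (intro always_eventually allI)
    have "continuous_on UNIV d" unfolding d_def using t
      by (intro continuous_intros p_diagonal_continuous)
        (simp_all add: p_sym[of "2*t" _ y] p_continuous)
    hence "(d \<longlongrightarrow> d y) (at y)" by (simp add: continuous_on_def)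
    hence "((\<lambda>x. sqrt (d x) * sqrt (inn f f)) \<longlongrightarrow> sqrt (d y) * sqrt (inn f f)) (at y)"
      by (intro tendsto_intros)
    then show "((\<lambda>x. sqrt (d x) * sqrt (inn f f)) \<longlongrightarrow> 0) (at y)" by (simp add: d_def)
  qed
  then show ?thesis by (simp add: continuous_on_def)
qed

lemma AE_S_P: "0 < t \<Longrightarrow> f \<in> L2 \<mu> \<Longrightarrow> AE x in \<mu>. S t f x = P t f x"
  using P_density[of t f] by (auto simp: S_def L2_inner_def)

lemma P_L2: "0 < t \<Longrightarrow> f \<in> L2 \<mu> \<Longrightarrow> P t f \<in> L2 \<mu>"
  using semigroup by (simp add: form_semigroup_def C0_semigroup_def)

lemma S_L2: assumes "0 \<le> t" "f \<in> L2 \<mu>" shows "S t f \<in> L2 \<mu>"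
proof (cases "t = 0")
  case False
  hence t: "0 < t" using assms by simp
  have "AE x in \<mu>. P t f x = S t f x" using AE_S_P[OF t assms(2)] by eventually_elim simp
  then show ?thesis
    by (rule L2_cong_AE[OF P_L2[OF t assms(2)] borel_measurable_continuous[OF sets_\<mu> S_continuous[OF t assms(2)]]])
qed (use assms in simp)

lemma S_cong_AE: "0 < t \<Longrightarrow> f \<in> L2 \<mu> \<Longrightarrow> g \<in> L2 \<mu> \<Longrightarrow> AE x in \<mu>. f x = g x \<Longrightarrow> S t f = S t g"
  using p_L2 by (auto simp: S_def intro!: ext L2_inner_cong_AE)

lemma S_semigroup:
  assumes "0 \<le> s" "0 \<le> t" "f \<in> L2 \<mu>"
  shows "S s (S t f) = S (s + t) f"
proof (cases "s = 0 \<or> t = 0")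
  case False
  hence s: "0 < s" and t: "0 < t" and st: "0 < s + t" using assms by auto
  note Pf = P_L2[OF t assms(3)]
  have e1: "S s (S t f) = S s (P t f)"
    by (rule S_cong_AE[OF s S_L2[OF assms(2,3)] Pf AE_S_P[OF t assms(3)]])
  have "AE x in \<mu>. P (s + t) f x = P s (P t f) x"
    using semigroup s t assms(3) by (auto simp: form_semigroup_def C0_semigroup_def)
  hence ae: "AE x in \<mu>. S s (S t f) x = S (s + t) f x"
    unfolding e1 using AE_S_P[OF s Pf] AE_S_P[OF st assms(3)] by eventually_elim simp
  show ?thesis
    by (rule AE_eq_continuous_eq[OF sets_\<mu> open_pos S_continuous[OF s S_L2[OF assms(2,3)]] S_continuous[OF st assms(3)] ae])
qed auto

text \<open>Fubini for \<open>p t x y * f y * g x\<close>; integrability holds because the kernel applied to \<open>\<bar>f\<bar>\<close> is again in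
  \<open>L2\<close>.\<close>

lemma S_symmetric:
  assumes t: "0 \<le> t" and f: "f \<in> L2 \<mu>" and g: "g \<in> L2 \<mu>"
  shows "inn (S t f) g = inn f (S t g)"
proof (cases "t = 0")
  case False
  hence t: "0 < t" using assms by simp
  interpret \<mu>: sigma_finite_measure \<mu>
    by (rule sigma_finite_locally_compact[OF loc_compact separable sets_\<mu> compact_finite])
  interpret pair_sigma_finite \<mu> \<mu> ..
  have meas: "(\<lambda>(x, y). p t x y * f y * g x) \<in> borel_measurable (\<mu> \<Otimes>\<^sub>M \<mu>)"
    using borel_measurable_pair_continuous[OF separable sets_\<mu> p_joint_continuous[OF t]] f g
    by (auto simp: L2_def case_prod_beta')
  have af: "(\<lambda>y. \<bar>f y\<bar>) \<in> L2 \<mu>" and ag: "(\<lambda>y. \<bar>g y\<bar>) \<in> L2 \<mu>" using f g by (auto simp: L2_def)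
  have int: "integrable (\<mu> \<Otimes>\<^sub>M \<mu>) (\<lambda>(x, y). p t x y * f y * g x)"
  proof (rule Fubini_integrable[OF meas])
    show "AE x in \<mu>. integrable \<mu> (\<lambda>y. case (x, y) of (x, y) \<Rightarrow> p t x y * f y * g x)"
      using L2_integrable_mult[OF p_L2[OF t] f] by simp
    have "(\<lambda>x. LINT y|\<mu>. norm (case (x, y) of (x, y) \<Rightarrow> p t x y * f y * g x)) = (\<lambda>x. S t (\<lambda>y. \<bar>f y\<bar>) x * \<bar>g x\<bar>)"
      using t p_nonneg by (simp add: S_def L2_inner_def abs_mult)
    then show "integrable \<mu> (\<lambda>x. LINT y|\<mu>. norm (case (x, y) of (x, y) \<Rightarrow> p t x y * f y * g x))"
      using L2_integrable_mult[OF S_L2[OF less_imp_le[OF t] af] ag] by simp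
  qed
  have "inn (S t f) g = (LINT x|\<mu>. (LINT y|\<mu>. p t x y * f y * g x))"
    using t by (simp add: S_def L2_inner_def)
  also have "\<dots> = (LINT y|\<mu>. (LINT x|\<mu>. p t x y * f y * g x))"
    using Fubini_integral[OF int] by simp
  also have "\<dots> = inn f (S t g)"
  proof -
    have "(LINT x|\<mu>. p t x y * f y * g x) = f y * (LINT x|\<mu>. p t y x * g x)" for y
      using p_sym[OF t, of _ y] by (simp add: mult.assoc mult.left_commute)
    then show ?thesis using t by (simp add: S_def L2_inner_def)
  qed
  finally show ?thesis .
qed simp

lemma inner_S: "0 \<le> s \<Longrightarrow> 0 \<le> t \<Longrightarrow> f \<in> L2 \<mu> \<Longrightarrow> g \<in> L2 \<mu> \<Longrightarrow> inn (S s f) (S t g) = inn (S (s + t) f) g"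
  using S_symmetric[of t "S s f" g] S_semigroup[of t s f] S_L2[of s f] by (simp add: add.commute)

text \<open>The graph of the generator, with its first component represented by an element of \<open>F\<close>.\<close>

definition in_generator :: "('a \<Rightarrow> real) \<Rightarrow> ('a \<Rightarrow> real) \<Rightarrow> bool" where
  "in_generator u w \<longleftrightarrow> u \<in> F \<and> w \<in> L2 \<mu> \<and> (\<forall>v\<in>F. E u v = - inn w v)"

lemma generator_diff: "in_generator u w \<Longrightarrow> in_generator u' w' \<Longrightarrow> in_generator (\<lambda>x. u x - u' x) (\<lambda>x. w x - w' x)"
  unfolding in_generator_def by (auto simp: diff_mem L2.diff_mem diff_left L2.diff_left F_L2)

lemma generator_derivative:
  assumes "in_generator u w"
  shows "((\<lambda>t. inn (\<lambda>x. (S t u x - u x) / t - w x) (\<lambda>x. (S t u x - u x) / t - w x)) \<longlongrightarrow> 0) (at_right 0)"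
proof -
  have u: "u \<in> F" "u \<in> L2 \<mu>" and w: "w \<in> L2 \<mu>" using assms F_L2 by (auto simp: in_generator_def)
  have "form_operator \<mu> E F u w" using assms unfolding form_operator_def in_generator_def by blast
  hence "semigroup_generator \<mu> P u w" using semigroup u w by (simp add: form_semigroup_def)
  hence *: "((\<lambda>t. L2_norm \<mu> (\<lambda>x. (P t u x - u x) / t - w x)) \<longlongrightarrow> 0) (at_right 0)"
    by (simp add: semigroup_generator_def)
  let ?q = "\<lambda>Q t x. (Q t u x - u x) / t - w x"
  have mem: "?q Q t \<in> L2 \<mu>" if "Q t u \<in> L2 \<mu>" for Q t
    using L2.diff_mem[OF L2.scale_mem[OF L2.diff_mem[OF that u(2)], of "1/t"] w] by simp
  have eq: "inn (?q P t) (?q P t) = inn (?q S t) (?q S t)" if t: "0 < t" for t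
  proof -
    have ae: "AE x in \<mu>. ?q P t x = ?q S t x" using AE_S_P[OF t u(2)] by eventually_elim simp
    show ?thesis
      by (rule L2_inner_cong_AE[OF ae ae]) (use mem P_L2[OF t u(2)] S_L2[OF less_imp_le[OF t] u(2)] in auto)
  qed
  have "((\<lambda>t. (L2_norm \<mu> (?q P t))\<^sup>2) \<longlongrightarrow> 0\<^sup>2) (at_right 0)" by (intro tendsto_power *)
  then have "((\<lambda>t. (L2_norm \<mu> (?q P t))\<^sup>2) \<longlongrightarrow> 0) (at_right 0)" by simp
  then show ?thesis
  proof (rule Lim_transform_eventually)
    show "\<forall>\<^sub>F t in at_right 0. (L2_norm \<mu> (?q P t))\<^sup>2 = inn (?q S t) (?q S t)"
      using eventually_at_right_less[of "0::real"]
    proof eventually_elim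
      case (elim t)
      then show ?case using eq L2.nonneg[OF mem[of P t]] P_L2[OF elim u(2)] by (simp add: L2_norm_def)
    qed
  qed
qed

text \<open>Continuity of \<open>u\<close> upgrades the version of \<open>u\<close> lying in \<open>F\<close> to \<open>u\<close> itself.\<close>

lemma generator_intro:
  assumes u: "u \<in> L2 \<mu>" and w: "w \<in> L2 \<mu>"
    and gen: "((\<lambda>t. inn (\<lambda>x. (S t u x - u x) / t - w x) (\<lambda>x. (S t u x - u x) / t - w x)) \<longlongrightarrow> 0) (at_right 0)"
    and cont: "continuous_on UNIV u"
  shows "in_generator u w"
proof -
  let ?q = "\<lambda>Q t x. (Q t u x - u x) / t - w x"
  have mem: "?q Q t \<in> L2 \<mu>" if "Q t u \<in> L2 \<mu>" for Q t
    using L2.diff_mem[OF L2.scale_mem[OF L2.diff_mem[OF that u], of "1/t"] w] by simp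
  have eq: "inn (?q P t) (?q P t) = inn (?q S t) (?q S t)" if t: "0 < t" for t
  proof -
    have ae: "AE x in \<mu>. ?q P t x = ?q S t x" using AE_S_P[OF t u] by eventually_elim simp
    show ?thesis
      by (rule L2_inner_cong_AE[OF ae ae]) (use mem P_L2[OF t u] S_L2[OF less_imp_le[OF t] u] in auto)
  qed
  have "((\<lambda>t. sqrt (inn (?q S t) (?q S t))) \<longlongrightarrow> 0) (at_right 0)"
    using tendsto_real_sqrt[OF gen] by simp
  then have "((\<lambda>t. L2_norm \<mu> (?q P t)) \<longlongrightarrow> 0) (at_right 0)"
  proof (rule Lim_transform_eventually)
    show "\<forall>\<^sub>F t in at_right 0. sqrt (inn (?q S t) (?q S t)) = L2_norm \<mu> (?q P t)"
      using eventually_at_right_less[of "0::real"]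
      by eventually_elim (simp add: L2_norm_def eq)
  qed
  hence "semigroup_generator \<mu> P u w" using u w by (simp add: semigroup_generator_def)
  hence "form_operator \<mu> E F u w" using semigroup u w by (simp add: form_semigroup_def)
  then obtain u' where u': "u' \<in> F" "AE x in \<mu>. u' x = u x" "\<forall>v\<in>F. E u' v = - inn w v"
    by (auto simp: form_operator_def)
  have "u' = u" by (rule AE_eq_continuous_eq[OF sets_\<mu> open_pos form_continuous[OF u'(1)] cont u'(2)])
  with u' w show ?thesis by (simp add: in_generator_def)
qed

lemma S_bounded:
  assumes t: "0 \<le> t"
  shows "\<exists>C. \<forall>f\<in>L2 \<mu>. inn (S t f) (S t f) \<le> C * inn f f"
proof (cases "t = 0")
  case True
  then show ?thesis by (intro exI[of _ 1]) simp
next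
  case False
  hence t: "0 < t" using t by simp
  obtain C where C: "\<And>f. f \<in> L2 \<mu> \<Longrightarrow> L2_norm \<mu> (P t f) \<le> C * L2_norm \<mu> f"
    using semigroup[unfolded form_semigroup_def C0_semigroup_def, THEN conjunct1, THEN conjunct2, THEN conjunct2, THEN conjunct1] t
    by blast
  have "inn (S t f) (S t f) \<le> C\<^sup>2 * inn f f" if f: "f \<in> L2 \<mu>" for f
  proof -
    have "inn (S t f) (S t f) = inn (P t f) (P t f)"
      using AE_S_P[OF t f] S_L2[OF less_imp_le[OF t] f] P_L2[OF t f] by (intro L2_inner_cong_AE)
    also have "\<dots> = (L2_norm \<mu> (P t f))\<^sup>2" using L2.nonneg[OF P_L2[OF t f]] by (simp add: L2_norm_def)
    also have "\<dots> \<le> (C * L2_norm \<mu> f)\<^sup>2"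
      using C[OF f] L2.nonneg[OF P_L2[OF t f]] by (intro power_mono) (simp_all add: L2_norm_def)
    also have "\<dots> = C\<^sup>2 * inn f f" using L2.nonneg[OF f] by (simp add: L2_norm_def power_mult_distrib)
    finally show ?thesis .
  qed
  then show ?thesis by blast
qed

lemma S_tendsto:
  assumes t: "0 \<le> t" and "\<And>n. u n \<in> L2 \<mu>" "v \<in> L2 \<mu>"
    and "((\<lambda>n. inn (\<lambda>x. u n x - v x) (\<lambda>x. u n x - v x)) \<longlongrightarrow> 0) G"
  shows "((\<lambda>n. inn (\<lambda>x. S t (u n) x - S t v x) (\<lambda>x. S t (u n) x - S t v x)) \<longlongrightarrow> 0) G"
proof -
  obtain C where C: "\<And>f. f \<in> L2 \<mu> \<Longrightarrow> inn (S t f) (S t f) \<le> C * inn f f" using S_bounded[OF t] by blast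
  have "((\<lambda>n. C * inn (\<lambda>x. u n x - v x) (\<lambda>x. u n x - v x)) \<longlongrightarrow> C * 0) G"
    by (intro tendsto_intros assms)
  then have lim: "((\<lambda>n. C * inn (\<lambda>x. u n x - v x) (\<lambda>x. u n x - v x)) \<longlongrightarrow> 0) G" by simp
  show ?thesis
  proof (rule tendsto_sandwich[OF _ _ tendsto_const lim]; intro always_eventually allI)
    fix n
    note m = L2.diff_mem[OF assms(2,3), of n]
    have eq: "(\<lambda>x. S t (u n) x - S t v x) = S t (\<lambda>x. u n x - v x)" by (rule S_diff[OF t assms(2,3), symmetric])
    show "0 \<le> inn (\<lambda>x. S t (u n) x - S t v x) (\<lambda>x. S t (u n) x - S t v x)"
      unfolding eq by (rule L2.nonneg[OF S_L2[OF t m]])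
    show "inn (\<lambda>x. S t (u n) x - S t v x) (\<lambda>x. S t (u n) x - S t v x) \<le> C * inn (\<lambda>x. u n x - v x) (\<lambda>x. u n x - v x)"
      unfolding eq by (rule C[OF m])
  qed
qed

lemma S_strongly_continuous:
  assumes f: "f \<in> L2 \<mu>"
  shows "((\<lambda>t. inn (\<lambda>x. S t f x - f x) (\<lambda>x. S t f x - f x)) \<longlongrightarrow> 0) (at_right 0)"
proof -
  have *: "((\<lambda>t. L2_norm \<mu> (\<lambda>x. P t f x - f x)) \<longlongrightarrow> 0) (at_right 0)"
    using semigroup f by (simp add: form_semigroup_def C0_semigroup_def)
  have "((\<lambda>t. (L2_norm \<mu> (\<lambda>x. P t f x - f x))\<^sup>2) \<longlongrightarrow> 0\<^sup>2) (at_right 0)" by (intro tendsto_power *)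
  then have "((\<lambda>t. (L2_norm \<mu> (\<lambda>x. P t f x - f x))\<^sup>2) \<longlongrightarrow> 0) (at_right 0)" by simp
  then show ?thesis
  proof (rule Lim_transform_eventually)
    show "\<forall>\<^sub>F t in at_right 0. (L2_norm \<mu> (\<lambda>x. P t f x - f x))\<^sup>2 = inn (\<lambda>x. S t f x - f x) (\<lambda>x. S t f x - f x)"
      using eventually_at_right_less[of "0::real"]
    proof eventually_elim
      case (elim t)
      have ae: "AE x in \<mu>. P t f x - f x = S t f x - f x" using AE_S_P[OF elim f] by eventually_elim simp
      have m: "(\<lambda>x. P t f x - f x) \<in> L2 \<mu>" "(\<lambda>x. S t f x - f x) \<in> L2 \<mu>"
        using L2.diff_mem P_L2[OF elim f] S_L2[of t f] elim f by auto
      have "inn (\<lambda>x. P t f x - f x) (\<lambda>x. P t f x - f x) = inn (\<lambda>x. S t f x - f x) (\<lambda>x. S t f x - f x)"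
        by (rule L2_inner_cong_AE[OF ae ae m m])
      then show ?case using L2.nonneg[OF m(1)] by (simp add: L2_norm_def)
    qed
  qed
qed

text \<open>\<open>S t\<close> is bounded and commutes with the difference quotients.\<close>

lemma generator_S:
  assumes d: "in_generator u w" and t: "0 \<le> t"
  shows "in_generator (S t u) (S t w)"
proof -
  have u: "u \<in> L2 \<mu>" and w: "w \<in> L2 \<mu>" using d F_L2 by (auto simp: in_generator_def)
  show ?thesis
  proof (rule generator_intro)
    show "S t u \<in> L2 \<mu>" "S t w \<in> L2 \<mu>" using S_L2 t u w by auto
    show "continuous_on UNIV (S t u)"
      using S_continuous[OF _ u, of t] form_continuous[of u] d t by (cases "t = 0") (auto simp: in_generator_def)
    let ?q = "\<lambda>h x. (S h u x - u x) / h - w x"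
    have mem: "?q h \<in> L2 \<mu>" if h: "0 \<le> h" for h
      using L2.diff_mem[OF L2.scale_mem[OF L2.diff_mem[OF S_L2[OF h u] u], of "1/h"] w] by simp
    have Sq: "(\<lambda>x. (S h (S t u) x - S t u x) / h - S t w x) = S t (?q h)" if h: "0 < h" for h
    proof -
      have "S t (?q h) = (\<lambda>x. (1/h) * (S t (S h u) x - S t u x) - S t w x)"
        using S_diff[OF t L2.scale_mem[OF L2.diff_mem[OF S_L2[OF less_imp_le[OF h] u] u], of "1/h"] w]
          S_scale[OF t L2.diff_mem[OF S_L2[OF less_imp_le[OF h] u] u], of "1/h"]
          S_diff[OF t S_L2[OF less_imp_le[OF h] u] u]
        by simp
      moreover have "S t (S h u) = S h (S t u)" using S_semigroup[of t h u] S_semigroup[of h t u] h t u by (simp add: add.commute)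
      ultimately show ?thesis by simp
    qed
    obtain C where C: "\<And>f. f \<in> L2 \<mu> \<Longrightarrow> inn (S t f) (S t f) \<le> C * inn f f" using S_bounded[OF t] by blast
    have "((\<lambda>h. C * inn (?q h) (?q h)) \<longlongrightarrow> C * 0) (at_right 0)"
      by (intro tendsto_intros generator_derivative d)
    then have lim: "((\<lambda>h. C * inn (?q h) (?q h)) \<longlongrightarrow> 0) (at_right 0)" by simp
    show "((\<lambda>h. inn (\<lambda>x. (S h (S t u) x - S t u x) / h - S t w x) (\<lambda>x. (S h (S t u) x - S t u x) / h - S t w x)) \<longlongrightarrow> 0) (at_right 0)"
    proof (rule tendsto_sandwich[OF _ _ tendsto_const lim])
      show "\<forall>\<^sub>F h in at_right 0. 0 \<le> inn (\<lambda>x. (S h (S t u) x - S t u x) / h - S t w x) (\<lambda>x. (S h (S t u) x - S t u x) / h - S t w x)"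
        using eventually_at_right_less[of "0::real"]
        by eventually_elim (simp only: Sq L2.nonneg[OF S_L2[OF t mem]] less_imp_le)
      show "\<forall>\<^sub>F h in at_right 0. inn (\<lambda>x. (S h (S t u) x - S t u x) / h - S t w x) (\<lambda>x. (S h (S t u) x - S t u x) / h - S t w x) \<le> C * inn (?q h) (?q h)"
        using eventually_at_right_less[of "0::real"]
        by eventually_elim (simp only: Sq C[OF mem] less_imp_le)
    qed
  qed
qed

end


section \<open>Energy estimates for the semigroup\<close>

context heat_kernel_form
begin

lemma generator_slope:
  assumes d: "in_generator u w" and t: "0 < t"
  shows "(\<lambda>n. (inn u u - inn (S (t / real (Suc n)) u) u) * real (Suc n) / t) \<longlonglongrightarrow> E u u"
proof -
  have u: "u \<in> F" "u \<in> L2 \<mu>" and w: "w \<in> L2 \<mu>" and Eu: "E u u = - inn w u" using d F_L2 by (auto simp: in_generator_def)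
  define h where "h n = t / real (Suc n)" for n
  have h: "0 < h n" for n using t by (simp add: h_def)
  have "h \<longlonglongrightarrow> 0" unfolding h_def using tendsto_mult[OF tendsto_const[of t sequentially] LIMSEQ_inverse_real_of_nat]
    by (simp add: divide_inverse)
  hence lim: "filterlim h (at_right 0) sequentially" using h less_imp_neq[OF h, symmetric] by (simp add: filterlim_at)
  define q where "q n = (\<lambda>x. (1 / h n) * (S (h n) u x - u x))" for n
  have q: "q n \<in> L2 \<mu>" for n unfolding q_def using S_L2[of "h n" u] h[of n] u by (intro L2.scale_mem L2.diff_mem) auto
  have "(\<lambda>n. inn (\<lambda>x. q n x - w x) (\<lambda>x. q n x - w x)) \<longlonglongrightarrow> 0"
    using filterlim_compose[OF generator_derivative[OF d] lim] by (simp add: q_def)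
  then have "(\<lambda>n. inn (q n) u) \<longlonglongrightarrow> inn w u"
    by (intro L2.tendsto_form q w u) (simp_all add: L2_inner_def)
  then have "(\<lambda>n. - inn (q n) u) \<longlonglongrightarrow> E u u" unfolding Eu by (rule tendsto_minus)
  moreover have "- inn (q n) u = (inn u u - inn (S (t / real (Suc n)) u) u) * real (Suc n) / t" for n
  proof -
    have "inn (q n) u = (1 / h n) * (inn (S (h n) u) u - inn u u)"
      unfolding q_def using S_L2[of "h n" u] h[of n] u
      by (simp only: L2.scale_left L2.diff_left L2.diff_mem less_imp_le)
    then show ?thesis using t by (simp add: h_def field_simps)
  qed
  ultimately show ?thesis by simp
qed

text \<open>With \<open>g\<close> the value of the semigroup at time \<open>n * \<delta> / 2\<close>, the second difference of the sequence is
  \<open>\<parallel>g - S \<delta> g\<parallel>\<^sup>2\<close>.\<close>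

lemma slope_decreasing:
  assumes f: "f \<in> L2 \<mu>" and \<delta>: "0 \<le> \<delta>"
  shows "decseq (\<lambda>n. inn (S (real n * \<delta>) f) f - inn (S (real (Suc n) * \<delta>) f) f)"
proof (rule decseq_SucI)
  fix n
  define s where "s = real n * \<delta> / 2"
  have s: "0 \<le> s" using \<delta> by (simp add: s_def)
  define g where "g = S s f"
  have g: "g \<in> L2 \<mu>" unfolding g_def by (rule S_L2[OF s f])
  have Sg: "S \<delta> g = S (\<delta> + s) f" unfolding g_def by (rule S_semigroup[OF \<delta> s f])
  have "inn g g = inn (S (real n * \<delta>) f) f" unfolding g_def using inner_S[OF s s f f] by (simp add: s_def mult.commute)
  moreover have "inn g (S \<delta> g) = inn (S (real (Suc n) * \<delta>) f) f"
    unfolding Sg unfolding g_def using inner_S[OF s _ f f, of "\<delta> + s"] s \<delta> by (simp add: s_def algebra_simps)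
  moreover have "inn (S \<delta> g) (S \<delta> g) = inn (S (real (Suc (Suc n)) * \<delta>) f) f"
    unfolding Sg using inner_S[OF _ _ f f, of "\<delta> + s" "\<delta> + s"] s \<delta> by (simp add: s_def algebra_simps)
  moreover have "0 \<le> inn g g - 2 * inn g (S \<delta> g) + inn (S \<delta> g) (S \<delta> g)"
    using L2.diff_square[OF g S_L2[OF \<delta> g]] L2.nonneg[OF L2.diff_mem[OF g S_L2[OF \<delta> g]]] by simp
  ultimately show "inn (S (real (Suc n) * \<delta>) f) f - inn (S (real (Suc (Suc n)) * \<delta>) f) f
      \<le> inn (S (real n * \<delta>) f) f - inn (S (real (Suc n) * \<delta>) f) f" by simp
qed

text \<open>Cut \<open>[0, t]\<close> into \<open>N\<close> equal steps. The decrements of \<open>\<langle>S s u, u\<rangle>\<close> over these steps are decreasing, their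
  sum is \<open>\<langle>u, u\<rangle> - \<langle>S t u, u\<rangle>\<close>, and for large \<open>N\<close> the first one and the one just after \<open>t\<close> are close to
  \<open>t / N\<close> times the energies of \<open>u\<close> and of \<open>S (t / 2) u\<close>. Comparing first, average and last decrement gives
  the three inequalities; they stand in for the spectral theorem.\<close>

lemma generator_estimates:
  assumes d: "in_generator u w" and t: "0 < t"
  shows "E (S (t/2) u) (S (t/2) u) \<le> E u u"
    and "inn u u - inn (S t u) u \<le> t * E u u"
    and "t * E (S (t/2) u) (S (t/2) u) \<le> inn u u - inn (S t u) u"
proof -
  have u: "u \<in> F" "u \<in> L2 \<mu>" using d F_L2 by (auto simp: in_generator_def)
  define u' where "u' = S (t/2) u"
  have d': "in_generator u' (S (t/2) w)" unfolding u'_def by (rule generator_S[OF d]) (use t in simp)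
  note lim = generator_slope[OF d t] and lim' = generator_slope[OF d' t]
  define D where "D m i = inn (S (real i * (t / real (Suc m))) u) u - inn (S (real (Suc i) * (t / real (Suc m))) u) u" for m i
  have dec: "decseq (D m)" for m unfolding D_def by (rule slope_decreasing[OF u(2)]) (use t in simp)
  have D0: "D m 0 = inn u u - inn (S (t / real (Suc m)) u) u" for m by (simp add: D_def)
  have DN: "D m (Suc m) = inn u' u' - inn (S (t / real (Suc m)) u') u'" for m
  proof -
    define h where "h = t / real (Suc m)"
    have h: "0 < h" using t by (simp add: h_def)
    have "inn u' u' = inn (S t u) u" unfolding u'_def using inner_S[of "t/2" "t/2" u u] t u by simp
    moreover have "inn (S h u') u' = inn (S (t + h) u) u"
      unfolding u'_def using S_semigroup[of h "t/2" u] inner_S[of "h + t/2" "t/2" u u] t u h by (simp add: add.commute)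
    moreover have "real (Suc m) * h = t" "real (Suc (Suc m)) * h = t + h" by (simp_all add: h_def field_simps)
    ultimately show ?thesis by (simp only: D_def flip: h_def)
  qed
  have sum: "(\<Sum>i<Suc m. D m i) = inn u u - inn (S t u) u" for m
  proof -
    have "(\<Sum>i<Suc m. D m i) = inn (S (real 0 * (t / real (Suc m))) u) u - inn (S (real (Suc m) * (t / real (Suc m))) u) u"
      unfolding D_def by (rule sum_lessThan_telescope')
    then show ?thesis by simp
  qed
  have up: "inn u u - inn (S t u) u \<le> D m 0 * real (Suc m)" for m
    unfolding sum[of m, symmetric] using sum_bounded_above[of "{..<Suc m}" "D m" "D m 0"] decseqD[OF dec, of 0]
    by (simp add: mult.commute)
  have low: "D m (Suc m) * real (Suc m) \<le> inn u u - inn (S t u) u" for m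
    unfolding sum[of m, symmetric] using sum_bounded_below[of "{..<Suc m}" "D m (Suc m)" "D m"] decseqD[OF dec, of _ "Suc m"]
    by (simp add: mult.commute)
  have "(inn u u - inn (S t u) u) / t \<le> E u u"
    by (rule LIMSEQ_le_const[OF lim]) (use up t in \<open>auto simp: D0 intro!: divide_right_mono\<close>)
  then show "inn u u - inn (S t u) u \<le> t * E u u" using t by (simp add: field_simps)
  have "E u' u' \<le> (inn u u - inn (S t u) u) / t"
    by (rule LIMSEQ_le_const2[OF lim']) (use low t in \<open>auto simp: DN intro!: divide_right_mono\<close>)
  then show "t * E (S (t/2) u) (S (t/2) u) \<le> inn u u - inn (S t u) u" using t by (simp add: field_simps u'_def)
  have "E u' u' \<le> E u u"
  proof (rule LIMSEQ_le[OF lim' lim], intro exI allI impI)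
    fix m
    have "D m (Suc m) \<le> D m 0" by (rule decseqD[OF dec]) simp
    then show "(inn u' u' - inn (S (t / real (Suc m)) u') u') * real (Suc m) / t
        \<le> (inn u u - inn (S (t / real (Suc m)) u) u) * real (Suc m) / t"
      unfolding D0 DN using t by (intro divide_right_mono mult_right_mono) simp_all
  qed
  then show "E (S (t/2) u) (S (t/2) u) \<le> E u u" by (simp add: u'_def)
qed

lemma generator_approx_F:
  assumes f: "f \<in> F"
  shows "\<exists>u w. (\<forall>n. in_generator (u n) (w n) \<and> E (u n) (u n) \<le> E f f) \<and>
    (\<lambda>n. inn (\<lambda>x. u n x - f x) (\<lambda>x. u n x - f x)) \<longlonglongrightarrow> 0"
proof -
  have "\<exists>u w. in_generator u w \<and> E u u \<le> E f f \<and> inn (\<lambda>x. u x - f x) (\<lambda>x. u x - f x) \<le> E f f * inverse (real (Suc n))" for n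
  proof -
    obtain u where u: "u \<in> F" "E u u \<le> E f f" "real (Suc n) * inn (\<lambda>x. u x - f x) (\<lambda>x. u x - f x) \<le> E f f"
       "\<forall>v\<in>F. E u v = - inn (\<lambda>x. real (Suc n) * (u x - f x)) v"
      using resolvent_approximation[OF dirichlet f, of "real (Suc n)"] by auto
    have "in_generator u (\<lambda>x. real (Suc n) * (u x - f x))"
      unfolding in_generator_def using u F_L2[OF diff_mem[OF u(1) f]] by (auto intro: L2.scale_mem)
    moreover have "inn (\<lambda>x. u x - f x) (\<lambda>x. u x - f x) \<le> E f f * inverse (real (Suc n))"
      using u(3) by (simp add: field_simps)
    ultimately show ?thesis using u(2) by blast
  qed
  then obtain u w where uw: "\<And>n. in_generator (u n) (w n)" "\<And>n. E (u n) (u n) \<le> E f f"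
     "\<And>n. inn (\<lambda>x. u n x - f x) (\<lambda>x. u n x - f x) \<le> E f f * inverse (real (Suc n))" by metis
  have lim: "(\<lambda>n. E f f * inverse (real (Suc n))) \<longlonglongrightarrow> 0"
    using tendsto_mult[OF tendsto_const LIMSEQ_inverse_real_of_nat] by simp
  have "(\<lambda>n. inn (\<lambda>x. u n x - f x) (\<lambda>x. u n x - f x)) \<longlonglongrightarrow> 0"
  proof (rule tendsto_sandwich[OF _ _ tendsto_const lim]; intro always_eventually allI)
    fix n
    have "u n \<in> F" using uw(1)[of n] by (simp add: in_generator_def)
    then show "0 \<le> inn (\<lambda>x. u n x - f x) (\<lambda>x. u n x - f x)" by (rule L2.nonneg[OF F_L2[OF diff_mem[OF _ f]]])
  qed (rule uw(3))
  with uw show ?thesis by blast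
qed

lemma generator_approx_L2:
  assumes f: "f \<in> L2 \<mu>"
  shows "\<exists>u w. (\<forall>n. in_generator (u n) (w n)) \<and> (\<lambda>n. inn (\<lambda>x. u n x - f x) (\<lambda>x. u n x - f x)) \<longlonglongrightarrow> 0"
proof -
  have "\<exists>u w. in_generator u w \<and> inn (\<lambda>x. u x - f x) (\<lambda>x. u x - f x) \<le> inverse (real (Suc n))" for n
  proof -
    define e where "e = inverse (real (Suc n)) / 4"
    have e: "0 < e" by (simp add: e_def)
    obtain g where g: "g \<in> F" "L2_norm \<mu> (\<lambda>x. f x - g x) < sqrt e"
      using dirichlet f e unfolding dirichlet_form_def by (metis real_sqrt_gt_zero)
    have gL: "g \<in> L2 \<mu>" by (rule F_L2[OF g(1)])
    have g': "inn (\<lambda>x. g x - f x) (\<lambda>x. g x - f x) < e"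
    proof -
      have "inn (\<lambda>x. f x - g x) (\<lambda>x. f x - g x) = inn (\<lambda>x. g x - f x) (\<lambda>x. g x - f x)"
        using L2.diff_square[OF f gL] L2.diff_square[OF gL f] L2.sym[OF f gL] by simp
      then show ?thesis using g(2) by (simp add: L2_norm_def)
    qed
    obtain u w where uw: "\<And>n. in_generator (u n) (w n)" "(\<lambda>n. inn (\<lambda>x. u n x - g x) (\<lambda>x. u n x - g x)) \<longlonglongrightarrow> 0"
      using generator_approx_F[OF g(1)] by blast
    obtain k where k: "inn (\<lambda>x. u k x - g x) (\<lambda>x. u k x - g x) < e"
      using order_tendstoD(2)[OF uw(2) e] by (auto simp: eventually_sequentially)
    have ukL: "u k \<in> L2 \<mu>" using uw(1)[of k] F_L2 by (simp add: in_generator_def)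
    have "inn (\<lambda>x. u k x - f x) (\<lambda>x. u k x - f x) = inn (\<lambda>x. (u k x - g x) + (g x - f x)) (\<lambda>x. (u k x - g x) + (g x - f x))" by simp
    also have "\<dots> \<le> 2 * inn (\<lambda>x. u k x - g x) (\<lambda>x. u k x - g x) + 2 * inn (\<lambda>x. g x - f x) (\<lambda>x. g x - f x)"
      by (intro L2.add_le L2.diff_mem ukL gL f)
    also have "\<dots> \<le> 4 * e" using k g' by simp
    finally show ?thesis using uw(1)[of k] unfolding e_def by (intro exI[of _ "u k"] exI[of _ "w k"]) simp
  qed
  then obtain u w where uw: "\<And>n. in_generator (u n) (w n)"
     "\<And>n. inn (\<lambda>x. u n x - f x) (\<lambda>x. u n x - f x) \<le> inverse (real (Suc n))" by metis
  have "(\<lambda>n. inn (\<lambda>x. u n x - f x) (\<lambda>x. u n x - f x)) \<longlonglongrightarrow> 0"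
  proof (rule tendsto_sandwich[OF _ _ tendsto_const LIMSEQ_inverse_real_of_nat]; intro always_eventually allI)
    fix n
    have "u n \<in> L2 \<mu>" using uw(1)[of n] F_L2 by (simp add: in_generator_def)
    then show "0 \<le> inn (\<lambda>x. u n x - f x) (\<lambda>x. u n x - f x)" by (rule L2.nonneg[OF L2.diff_mem[OF _ f]])
  qed (rule uw(2))
  with uw show ?thesis by blast
qed

text \<open>The third estimate bounds the energy of \<open>S t v\<close> by the \<open>L2\<close> norm of \<open>v\<close>. Hence the images \<open>S t (u n)\<close>
  of an \<open>L2\<close>-convergent sequence are Cauchy for \<open>E1\<close>, and completeness puts the limit into \<open>F\<close>.\<close>

lemma S_limit_in_form:
  assumes d: "\<And>n. in_generator (u n) (w n)" and f: "f \<in> L2 \<mu>" and t: "0 < t"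
    and lim: "(\<lambda>n. inn (\<lambda>x. u n x - f x) (\<lambda>x. u n x - f x)) \<longlonglongrightarrow> 0"
  shows "S t f \<in> F" "(\<lambda>n. E (S t (u n)) (S t (u n))) \<longlonglongrightarrow> E (S t f) (S t f)"
proof -
  have u: "u n \<in> F" "u n \<in> L2 \<mu>" for n using d F_L2 by (auto simp: in_generator_def)
  have t0: "0 \<le> t" using t by simp
  have Su: "S t (u n) \<in> F" for n using generator_S[OF d t0] by (auto simp: in_generator_def)
  have bound: "E1 \<mu> E (\<lambda>x. S t (u m) x - S t (u n) x) \<le> (1 / (2*t) + 1) * inn (\<lambda>x. u m x - u n x) (\<lambda>x. u m x - u n x)" for m n
  proof -
    define v where "v = (\<lambda>x. u m x - u n x)"
    have dv: "in_generator v (\<lambda>x. w m x - w n x)" unfolding v_def by (rule generator_diff[OF d d])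
    have vL: "v \<in> L2 \<mu>" using dv F_L2 by (auto simp: in_generator_def)
    have sq: "inn (S t v) (S t v) = inn (S (2*t) v) v" using inner_S[OF t0 t0 vL vL] by simp
    have 3: "2 * t * E (S t v) (S t v) \<le> inn v v - inn (S t v) (S t v)"
      unfolding sq using generator_estimates(3)[OF dv, of "2*t"] t by simp
    have E0: "0 \<le> E (S t v) (S t v)" by (rule nonneg) (use generator_S[OF dv t0] in \<open>simp add: in_generator_def\<close>)
    have L0: "0 \<le> inn (S t v) (S t v)" by (rule L2.nonneg[OF S_L2[OF t0 vL]])
    have "inn (S t v) (S t v) \<le> inn v v" using 3 mult_nonneg_nonneg[OF _ E0, of "2*t"] t by simp
    moreover have "E (S t v) (S t v) \<le> 1 / (2*t) * inn v v" using 3 L0 t by (simp add: field_simps)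
    ultimately have "E1 \<mu> E (S t v) \<le> (1 / (2*t) + 1) * inn v v" by (simp add: E1_def algebra_simps)
    then show ?thesis unfolding v_def S_diff[OF t0 u(2) u(2)] .
  qed
  define \<kappa> where "\<kappa> = 1 / (2*t) + 1"
  have k: "0 < \<kappa>" using t by (simp add: \<kappa>_def add_pos_pos)
  have "\<exists>v\<in>F. (\<lambda>n. E1 \<mu> E (\<lambda>x. S t (u n) x - v x)) \<longlonglongrightarrow> 0"
  proof -
    have "\<exists>M. \<forall>m\<ge>M. \<forall>n\<ge>M. E1 \<mu> E (\<lambda>x. S t (u m) x - S t (u n) x) < e" if e: "0 < e" for e
    proof -
      have "0 < e / (4 * \<kappa>)" using e k by simp
      from order_tendstoD(2)[OF lim this] obtain M where
        M: "\<And>n. M \<le> n \<Longrightarrow> inn (\<lambda>x. u n x - f x) (\<lambda>x. u n x - f x) < e / (4 * \<kappa>)"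
        by (auto simp: eventually_sequentially)
      have "E1 \<mu> E (\<lambda>x. S t (u m) x - S t (u n) x) < e" if mn: "M \<le> m" "M \<le> n" for m n
      proof -
        have eq: "inn (\<lambda>x. f x - u n x) (\<lambda>x. f x - u n x) = inn (\<lambda>x. u n x - f x) (\<lambda>x. u n x - f x)"
          using L2.diff_square[OF f u(2)] L2.diff_square[OF u(2) f] L2.sym[OF f u(2)] by simp
        have "inn (\<lambda>x. u m x - u n x) (\<lambda>x. u m x - u n x) = inn (\<lambda>x. (u m x - f x) + (f x - u n x)) (\<lambda>x. (u m x - f x) + (f x - u n x))" by simp
        also have "\<dots> \<le> 2 * inn (\<lambda>x. u m x - f x) (\<lambda>x. u m x - f x) + 2 * inn (\<lambda>x. f x - u n x) (\<lambda>x. f x - u n x)"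
          by (intro L2.add_le L2.diff_mem u f)
        also have "\<dots> < e / \<kappa>" unfolding eq using M[OF mn(1)] M[OF mn(2)] by simp
        finally have "\<kappa> * inn (\<lambda>x. u m x - u n x) (\<lambda>x. u m x - u n x) < e"
          using k by (simp add: field_simps)
        then show ?thesis using bound[of m n] by (simp add: \<kappa>_def)
      qed
      then show ?thesis by blast
    qed
    moreover have "complete_for (E1 \<mu> E) F" using dirichlet by (simp add: dirichlet_form_def)
    ultimately show ?thesis
      using Su unfolding complete_for_def by (auto dest!: spec[of _ "\<lambda>n. S t (u n)"])
  qed
  then obtain v where v: "v \<in> F" and vlim: "(\<lambda>n. E1 \<mu> E (\<lambda>x. S t (u n) x - v x)) \<longlonglongrightarrow> 0" by blast
  have dF: "(\<lambda>x. S t (u n) x - v x) \<in> F" for n by (rule diff_mem[OF Su v])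
  have limE: "(\<lambda>n. E (\<lambda>x. S t (u n) x - v x) (\<lambda>x. S t (u n) x - v x)) \<longlonglongrightarrow> 0"
    by (rule tendsto_sandwich[OF _ _ tendsto_const vlim])
      (auto simp: E1_def nonneg[OF dF] L2.nonneg[OF F_L2[OF dF]])
  have limL: "(\<lambda>n. inn (\<lambda>x. S t (u n) x - v x) (\<lambda>x. S t (u n) x - v x)) \<longlonglongrightarrow> 0"
    by (rule tendsto_sandwich[OF _ _ tendsto_const vlim])
      (auto simp: E1_def nonneg[OF dF] L2.nonneg[OF F_L2[OF dF]])
  have SfL: "S t f \<in> L2 \<mu>" and vL: "v \<in> L2 \<mu>" and SuL: "S t (u n) \<in> L2 \<mu>" for n
    using S_L2[OF t0] f u F_L2[OF v] by auto
  have limL': "(\<lambda>n. inn (\<lambda>x. S t (u n) x - S t f x) (\<lambda>x. S t (u n) x - S t f x)) \<longlonglongrightarrow> 0"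
    by (rule S_tendsto[OF t0 u(2) f lim])
  have "inn (\<lambda>x. v x - S t f x) (\<lambda>x. v x - S t f x) \<le> 0"
  proof (rule LIMSEQ_le_const)
    have "(\<lambda>n. 2 * inn (\<lambda>x. S t (u n) x - v x) (\<lambda>x. S t (u n) x - v x) + 2 * inn (\<lambda>x. S t (u n) x - S t f x) (\<lambda>x. S t (u n) x - S t f x)) \<longlonglongrightarrow> 2 * 0 + 2 * 0"
      by (intro tendsto_intros limL limL')
    then show "(\<lambda>n. 2 * inn (\<lambda>x. S t (u n) x - v x) (\<lambda>x. S t (u n) x - v x) + 2 * inn (\<lambda>x. S t (u n) x - S t f x) (\<lambda>x. S t (u n) x - S t f x)) \<longlonglongrightarrow> 0" by simp
    show "\<exists>N. \<forall>n\<ge>N. inn (\<lambda>x. v x - S t f x) (\<lambda>x. v x - S t f x) \<le> 2 * inn (\<lambda>x. S t (u n) x - v x) (\<lambda>x. S t (u n) x - v x) + 2 * inn (\<lambda>x. S t (u n) x - S t f x) (\<lambda>x. S t (u n) x - S t f x)"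
    proof (intro exI allI impI)
      fix n
      have "inn (\<lambda>x. v x - S t f x) (\<lambda>x. v x - S t f x) = inn (\<lambda>x. (v x - S t (u n) x) + (S t (u n) x - S t f x)) (\<lambda>x. (v x - S t (u n) x) + (S t (u n) x - S t f x))" by simp
      also have "\<dots> \<le> 2 * inn (\<lambda>x. v x - S t (u n) x) (\<lambda>x. v x - S t (u n) x) + 2 * inn (\<lambda>x. S t (u n) x - S t f x) (\<lambda>x. S t (u n) x - S t f x)"
        by (intro L2.add_le L2.diff_mem vL SuL SfL)
      also have "inn (\<lambda>x. v x - S t (u n) x) (\<lambda>x. v x - S t (u n) x) = inn (\<lambda>x. S t (u n) x - v x) (\<lambda>x. S t (u n) x - v x)"
        using L2.diff_square[OF vL SuL] L2.diff_square[OF SuL vL] L2.sym[OF vL SuL] by simp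
      finally show "inn (\<lambda>x. v x - S t f x) (\<lambda>x. v x - S t f x) \<le> 2 * inn (\<lambda>x. S t (u n) x - v x) (\<lambda>x. S t (u n) x - v x) + 2 * inn (\<lambda>x. S t (u n) x - S t f x) (\<lambda>x. S t (u n) x - S t f x)" .
    qed
  qed
  then have "inn (\<lambda>x. v x - S t f x) (\<lambda>x. v x - S t f x) = 0"
    using L2.nonneg[OF L2.diff_mem[OF vL SfL]] by simp
  then have ae: "AE x in \<mu>. v x = S t f x"
    using L2_inner_square_eq_0D[OF L2.diff_mem[OF vL SfL]] by simp
  have eq: "v = S t f"
    by (rule AE_eq_continuous_eq[OF sets_\<mu> open_pos form_continuous[OF v] S_continuous[OF t f] ae])
  show "S t f \<in> F" using v eq by simp
  show "(\<lambda>n. E (S t (u n)) (S t (u n))) \<longlonglongrightarrow> E (S t f) (S t f)"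
    unfolding eq[symmetric] by (rule tendsto_form[OF Su Su v v limE limE])
qed

lemma
  assumes f: "f \<in> F" and t: "0 < t"
  shows energy_S_le: "E (S t f) (S t f) \<le> E f f"
    and defect_le: "inn f f - inn (S t f) f \<le> t * E f f"
proof -
  obtain u w where uw: "\<And>n. in_generator (u n) (w n)" "\<And>n. E (u n) (u n) \<le> E f f"
    "(\<lambda>n. inn (\<lambda>x. u n x - f x) (\<lambda>x. u n x - f x)) \<longlonglongrightarrow> 0"
    using generator_approx_F[OF f] by blast
  have fL: "f \<in> L2 \<mu>" and uL: "u n \<in> L2 \<mu>" for n using f uw(1) F_L2 by (auto simp: in_generator_def)
  have t0: "0 \<le> t" using t by simp
  show "E (S t f) (S t f) \<le> E f f"
  proof (rule LIMSEQ_le_const2[OF S_limit_in_form(2)[OF uw(1) fL t uw(3)]], intro exI allI impI)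
    fix n
    show "E (S t (u n)) (S t (u n)) \<le> E f f"
      using generator_estimates(1)[OF uw(1)[of n], of "2*t"] t uw(2)[of n] by simp
  qed
  show "inn f f - inn (S t f) f \<le> t * E f f"
  proof (rule LIMSEQ_le_const2)
    show "(\<lambda>n. inn (u n) (u n) - inn (S t (u n)) (u n)) \<longlonglongrightarrow> inn f f - inn (S t f) f"
      by (intro tendsto_diff L2.tendsto_form uL fL uw(3) S_L2[OF t0] S_tendsto[OF t0 uL fL uw(3)])
    show "\<exists>N. \<forall>n\<ge>N. inn (u n) (u n) - inn (S t (u n)) (u n) \<le> t * E f f"
      using generator_estimates(2)[OF uw(1) t] uw(2) t by (meson mult_left_mono order_trans t0)
  qed
qed

lemma
  assumes f: "f \<in> L2 \<mu>" and t: "0 < t"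
  shows S_in_F: "S t f \<in> F"
    and energy_S_defect: "2 * t * E (S t f) (S t f) \<le> inn f f - inn (S (2 * t) f) f"
proof -
  obtain u w where uw: "\<And>n. in_generator (u n) (w n)"
    "(\<lambda>n. inn (\<lambda>x. u n x - f x) (\<lambda>x. u n x - f x)) \<longlonglongrightarrow> 0"
    using generator_approx_L2[OF f] by blast
  have uL: "u n \<in> L2 \<mu>" for n using uw(1) F_L2 by (auto simp: in_generator_def)
  have t0: "0 \<le> 2 * t" using t by simp
  show "S t f \<in> F" by (rule S_limit_in_form(1)[OF uw(1) f t uw(2)])
  show "2 * t * E (S t f) (S t f) \<le> inn f f - inn (S (2 * t) f) f"
  proof (rule LIMSEQ_le)
    show "(\<lambda>n. inn (u n) (u n) - inn (S (2*t) (u n)) (u n)) \<longlonglongrightarrow> inn f f - inn (S (2*t) f) f"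
      by (intro tendsto_diff L2.tendsto_form uL f uw(2) S_L2[OF t0] S_tendsto[OF t0 uL f uw(2)])
    show "(\<lambda>n. 2 * t * E (S t (u n)) (S t (u n))) \<longlonglongrightarrow> 2 * t * E (S t f) (S t f)"
      by (intro tendsto_intros S_limit_in_form(2)[OF uw(1) f t uw(2)])
    show "\<exists>N. \<forall>n\<ge>N. 2 * t * E (S t (u n)) (S t (u n)) \<le> inn (u n) (u n) - inn (S (2*t) (u n)) (u n)"
      using generator_estimates(3)[OF uw(1), of "2*t"] t by simp
  qed
qed

lemma defect_nonneg:
  assumes f: "f \<in> L2 \<mu>" and t: "0 < t"
  shows "0 \<le> inn f f - inn (S t f) f"
  using energy_S_defect[OF f, of "t/2"] mult_nonneg_nonneg[OF _ nonneg[OF S_in_F[OF f, of "t/2"]], of t] t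
  by simp

text \<open>Positive semidefinite by \<open>defect_nonneg\<close>; it is introduced for its Cauchy-Schwarz inequality.\<close>

lemma defect_form:
  assumes t: "0 < t"
  shows "nonneg_symmetric_form (\<lambda>f g. inn (\<lambda>x. f x - S t f x) g) (L2 \<mu>)"
proof -
  have t0: "0 \<le> t" using t by simp
  have eq: "inn (\<lambda>x. f x - S t f x) g = inn f g - inn (S t f) g" if "f \<in> L2 \<mu>" "g \<in> L2 \<mu>" for f g
    using L2.diff_left[OF that(1) S_L2[OF t0 that(1)] that(2)] .
  show ?thesis
    unfolding nonneg_symmetric_form_def
  proof (intro conjI ballI allI)
    show "function_subspace (L2 \<mu>)" using L2_form[of \<mu>] by (simp add: nonneg_symmetric_form_def)
    fix f g assume f: "f \<in> L2 \<mu>" and g: "g \<in> L2 \<mu>"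
    show "inn (\<lambda>x. (f x + g x) - S t (\<lambda>x. f x + g x) x) h = inn (\<lambda>x. f x - S t f x) h + inn (\<lambda>x. g x - S t g x) h"
      if h: "h \<in> L2 \<mu>" for h
    proof -
      have "inn (\<lambda>x. (f x + g x) - S t (\<lambda>x. f x + g x) x) h = inn (\<lambda>x. f x + g x) h - inn (S t (\<lambda>x. f x + g x)) h"
        by (rule eq[OF L2.add_mem[OF f g] h])
      then show ?thesis
        using eq[OF f h] eq[OF g h] S_L2[OF t0 f] S_L2[OF t0 g] f g h
        by (simp only: S_add[OF t0 f g] L2.add_left)
    qed
    show "inn (\<lambda>x. c * f x - S t (\<lambda>x. c * f x) x) g = c * inn (\<lambda>x. f x - S t f x) g" for c
    proof -
      have "inn (\<lambda>x. c * f x - S t (\<lambda>x. c * f x) x) g = inn (\<lambda>x. c * f x) g - inn (S t (\<lambda>x. c * f x)) g"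
        by (rule eq[OF L2.scale_mem[OF f] g])
      then show ?thesis
        using eq[OF f g] S_L2[OF t0 f] f g by (simp only: S_scale[OF t0 f] L2.scale_left right_diff_distrib)
    qed
    show "inn (\<lambda>x. f x - S t f x) g = inn (\<lambda>x. g x - S t g x) f"
      using f g L2.sym[OF f g] S_symmetric[OF t0 f g] L2.sym[OF f S_L2[OF t0 g]] by (simp only: eq)
  next
    fix f assume f: "f \<in> L2 \<mu>"
    show "0 \<le> inn (\<lambda>x. f x - S t f x) f" using defect_nonneg[OF f t] by (simp only: eq f)
  qed
qed

lemma p_decreasing:
  assumes s: "0 < s" and st: "s \<le> t"
  shows "p t x x \<le> p s x x"
proof (cases "s = t")
  case False
  have "0 \<le> inn (p (s/2) x) (p (s/2) x) - inn (S (t - s) (p (s/2) x)) (p (s/2) x)"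
    by (rule defect_nonneg[OF p_L2]) (use s st False in auto)
  then show ?thesis using s st by (simp add: inner_p S_p)
qed simp

lemma
  assumes t: "0 < t"
  shows p_in_F: "p t x \<in> F" and energy_p: "E (p t x) (p t x) \<le> p t x x / t"
proof -
  have t2: "0 < t/2" using t by simp
  have eq: "S (t/2) (p (t/2) x) = p t x" using S_p[of "t/2" "t/2" x] t by simp
  show "p t x \<in> F" using S_in_F[OF p_L2[OF t2] t2, of x] unfolding eq .
  have "2 * (t/2) * E (p t x) (p t x) \<le> p t x x - p (2 * t) x x"
    using energy_S_defect[OF p_L2[OF t2] t2, of x] S_p[of t "t/2" x] inner_p[of "t + t/2" "t/2" x x] t inner_p[OF t2 t2, of x x] unfolding eq by simp
  then show "E (p t x) (p t x) \<le> p t x x / t" using p_nonneg[of "2*t" x x] t by (simp add: field_simps)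
qed

text \<open>The increment is the defect form \<open>\<langle>k - S (t - s) k, f\<rangle>\<close> at \<open>k = p s x\<close>. Its Cauchy-Schwarz inequality separates
  the kernel, whose defect is at most \<open>p (2 * s) x x\<close>, from \<open>f\<close>, whose defect is at most \<open>(t - s) * E f f\<close>.\<close>

lemma S_increment:
  assumes f: "f \<in> F" and s: "0 < s" and st: "s < t"
  shows "(S s f x - S t f x)\<^sup>2 \<le> p (2 * s) x x * ((t - s) * E f f)"
proof -
  have fL: "f \<in> L2 \<mu>" and r: "0 < t - s" and t: "0 < t" using F_L2[OF f] s st by auto
  interpret Q: sym_form "\<lambda>f g. inn (\<lambda>x. f x - S (t - s) f x) g" "L2 \<mu>"
    by (rule sym_form.intro[OF defect_form[OF r]])
  let ?k = "p s x"
  have k: "?k \<in> L2 \<mu>" by (rule p_L2[OF s])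
  have Sk: "S (t - s) ?k = p t x" using S_p[of "t - s" s x] r s by simp
  have 1: "S s f x - S t f x = inn (\<lambda>y. ?k y - S (t - s) ?k y) f"
    unfolding Sk using s t by (simp add: S_def L2.diff_left p_L2 fL)
  have 2: "inn (\<lambda>y. ?k y - S (t - s) ?k y) ?k \<le> p (2 * s) x x"
    unfolding Sk using p_nonneg[of "t + s" x x] s t by (simp add: L2.diff_left p_L2 inner_p)
  have 3: "inn (\<lambda>y. f y - S (t - s) f y) f \<le> (t - s) * E f f"
    using defect_le[OF f r] L2.diff_left[OF fL S_L2[OF less_imp_le[OF r] fL] fL] by simp
  show ?thesis unfolding 1 using Q.Cauchy_Schwarz[OF k fL] mult_mono[OF 2 3] Q.nonneg[OF fL] p_nonneg[of "2 * s" x x] s by simp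
qed

text \<open>Convergence in \<open>L2\<close> provides points arbitrarily close to \<open>x\<close> at which \<open>S t f\<close> and \<open>f\<close> nearly agree, as
  open sets have positive measure. The functions \<open>S t f\<close> have energy at most \<open>E f f\<close>, so they are
  equicontinuous and the near agreement carries over to \<open>x\<close>.\<close>

lemma S_tendsto_pointwise:
  assumes f: "f \<in> F"
  shows "((\<lambda>t. S t f x) \<longlongrightarrow> f x) (at_right 0)"
proof (rule tendstoI)
  fix e :: real assume e: "0 < e"
  have fL: "f \<in> L2 \<mu>" by (rule F_L2[OF f])
  define d where "d = (e/4)\<^sup>2 / (4 * (E f f + 1))"
  have E0: "0 \<le> E f f" by (rule nonneg[OF f])
  have d: "0 < d" using e E0 by (simp add: d_def)
  define U where "U = {y. R x y < d}"
  have oU: "open U" unfolding U_def by (rule open_R_ball)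
  have xU: "x \<in> U" using d by (simp add: U_def)
  have U: "U \<in> sets \<mu>" using oU by (simp add: sets_\<mu>)
  have osc: "\<bar>g x - g y\<bar> \<le> e/4" if g: "g \<in> F" "E g g \<le> E f f" and y: "y \<in> U" for g y
  proof -
    have "(g x - g y)\<^sup>2 \<le> 4 * R x y * E g g" by (rule res_dist_estimate[OF g(1)])
    also have "\<dots> \<le> 4 * d * (E f f + 1)" using y g(2) nonneg[OF g(1)] d by (intro mult_mono) (auto simp: U_def)
    also have "\<dots> = (e/4)\<^sup>2" using E0 by (simp add: d_def field_simps)
    finally show ?thesis using e by (metis abs_le_square_iff abs_of_pos divide_pos_pos zero_less_numeral)
  qed
  obtain \<eta> where \<eta>: "0 < \<eta>" "ennreal \<eta> < emeasure \<mu> U"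
  proof -
    have "0 < emeasure \<mu> U" by (rule open_pos[OF oU]) (use xU in auto)
    then obtain z where "0 < z" "z < emeasure \<mu> U" using dense by blast
    then show ?thesis using that by (cases z) auto
  qed
  have "\<forall>\<^sub>F t in at_right 0. inn (\<lambda>y. S t f y - f y) (\<lambda>y. S t f y - f y) < (e/4)\<^sup>2 * \<eta>"
    by (rule order_tendstoD(2)[OF S_strongly_continuous[OF fL]]) (use e \<eta> in simp)
  then show "\<forall>\<^sub>F t in at_right 0. dist (S t f x) (f x) < e"
    using eventually_at_right_less[of "0::real"]
  proof eventually_elim
    case (elim t)
    define g where "g = (\<lambda>y. S t f y - f y)"
    have gL: "g \<in> L2 \<mu>" unfolding g_def using S_L2[of t f] fL elim by (intro L2.diff_mem) auto
    have "\<exists>y\<in>U. \<bar>g y\<bar> < e/4"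
    proof (rule ccontr)
      assume "\<not> ?thesis"
      hence big: "(e/4)\<^sup>2 \<le> (g y)\<^sup>2" if "y \<in> U" for y using that e by (auto simp: abs_le_square_iff[symmetric] not_less)
      have "ennreal ((e/4)\<^sup>2 * \<eta>) = ennreal ((e/4)\<^sup>2) * ennreal \<eta>" using \<eta> by (simp add: ennreal_mult)
      also have "\<dots> \<le> ennreal ((e/4)\<^sup>2) * emeasure \<mu> U" using \<eta> by (intro mult_left_mono) auto
      also have "\<dots> = (\<integral>\<^sup>+ y. ennreal ((e/4)\<^sup>2) * indicator U y \<partial>\<mu>)" using U by (simp add: nn_integral_cmult_indicator)
      also have "\<dots> \<le> (\<integral>\<^sup>+ y. ennreal ((g y)\<^sup>2) \<partial>\<mu>)"
        by (rule nn_integral_mono) (use big in \<open>auto simp: indicator_def ennreal_leI\<close>)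
      also have "\<dots> = ennreal (inn g g)"
        using gL by (subst nn_integral_eq_integral) (auto simp: L2_def L2_inner_def power2_eq_square)
      finally have "(e/4)\<^sup>2 * \<eta> \<le> inn g g" using L2.nonneg[OF gL] by simp
      with elim show False by (simp add: g_def)
    qed
    then obtain y where y: "y \<in> U" "\<bar>S t f y - f y\<bar> < e/4" by (auto simp: g_def)
    have "\<bar>S t f x - S t f y\<bar> \<le> e/4"
      by (rule osc[OF S_in_F[OF fL elim(2)] energy_S_le[OF f elim(2)] y(1)])
    moreover have "\<bar>f x - f y\<bar> \<le> e/4" by (rule osc[OF f order_refl y(1)])
    ultimately show ?case using y(2) e unfolding dist_real_def by linarith
  qed
qed

end


section \<open>On-diagonal bounds for the heat kernel\<close>

lemma geometric_telescope:
  fixes a :: "nat \<Rightarrow> real"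
  assumes step: "\<And>m. M \<le> m \<Longrightarrow> \<bar>a m - a (Suc m)\<bar> \<le> c / 2 ^ Suc m" and lim: "a \<longlonglongrightarrow> L"
  shows "\<bar>a M - L\<bar> \<le> c / 2 ^ M"
proof -
  have c: "0 \<le> c / 2 ^ Suc M" using step[of M] by linarith
  have part: "\<bar>a M - a (M + k)\<bar> \<le> c / 2 ^ M - c / 2 ^ (M + k)" for k
  proof (induction k)
    case (Suc k)
    have "\<bar>a (M + k) - a (Suc (M + k))\<bar> \<le> c / 2 ^ Suc (M + k)" by (rule step) simp
    moreover have "c / 2 ^ (M + k) = c / 2 ^ Suc (M + k) + c / 2 ^ Suc (M + k)" by simp
    moreover have "\<bar>a M - a (Suc (M + k))\<bar> \<le> \<bar>a M - a (M + k)\<bar> + \<bar>a (M + k) - a (Suc (M + k))\<bar>" by linarith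
    ultimately show ?case using Suc by simp
  qed simp
  have "0 \<le> c" using c zero_less_power[of "2::real" M] by (auto simp: zero_le_divide_iff not_le[symmetric])
  hence "0 \<le> c / 2 ^ (M + k)" for k by simp
  hence le: "\<bar>a M - a (M + k)\<bar> \<le> c / 2 ^ M" for k using part[of k] by (smt (verit))
  have "(\<lambda>k. \<bar>a M - a (M + k)\<bar>) \<longlonglongrightarrow> \<bar>a M - L\<bar>"
    using LIMSEQ_ignore_initial_segment[OF lim, of M] by (intro tendsto_intros) (simp add: add.commute)
  then show ?thesis by (rule LIMSEQ_le_const2) (use le in blast)
qed

context heat_kernel_form
begin

lemma res_ball_less: "y \<in> res_ball E F x r \<Longrightarrow> R x y < r"
  unfolding res_ball_def using connected_component_subset by blast

text \<open>The mass of \<open>(p t x y)\<^sup>2\<close> on the ball is at most \<open>p t x x\<close>, so \<open>p t x\<close> is small at some \<open>y\<close> of the ball. Its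
  energy is at most \<open>p t x x / t\<close>, so its value at \<open>x\<close> cannot be much larger. The outcome is a quadratic
  inequality for \<open>q = p t x x\<close>.\<close>

lemma heat_kernel_upper:
  assumes m: "0 < m" and r: "0 < r" and t: "0 < t"
    and vol: "ennreal m \<le> emeasure \<mu> (res_ball E F x r)"
  shows "p t x x \<le> 4 / m + 8 * r / t"
proof (cases "p t x x = 0")
  case True
  then show ?thesis using m r t by simp
next
  case False
  define q where "q = p t x x"
  have q: "0 < q" using False p_nonneg[OF t, of x x] by (simp add: q_def)
  define B where "B = res_ball E F x r"
  \<comment> \<open>A connected component need not be a Borel set; here a non-measurable set would have measure \<open>0\<close>.\<close>
  have "emeasure \<mu> B \<noteq> 0" using vol m by (auto simp: B_def)
  hence B: "B \<in> sets \<mu>" using emeasure_notin_sets by blast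
  \<comment> \<open>The factor \<open>2\<close> makes the contradiction strict, with no case distinction on the size of the ball.\<close>
  have "\<exists>y\<in>B. (p t x y)\<^sup>2 \<le> 2 * q / m"
  proof (rule ccontr)
    assume "\<not> ?thesis"
    hence big: "2 * q / m \<le> (p t x y)\<^sup>2" if "y \<in> B" for y using that by force
    have "ennreal (2 * q) = ennreal (2 * q / m) * ennreal m" using m q by (simp add: ennreal_mult[symmetric])
    also have "\<dots> \<le> ennreal (2 * q / m) * emeasure \<mu> B" using vol by (intro mult_left_mono) (auto simp: B_def)
    also have "\<dots> = (\<integral>\<^sup>+ y. ennreal (2 * q / m) * indicator B y \<partial>\<mu>)" using B by (simp add: nn_integral_cmult_indicator)
    also have "\<dots> \<le> (\<integral>\<^sup>+ y. ennreal (p t x y * p t y x) \<partial>\<mu>)"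
    proof (rule nn_integral_mono)
      fix y
      have "p t x y * p t y x = (p t x y)\<^sup>2" using p_sym[OF t, of x y] by (simp add: power2_eq_square)
      then show "ennreal (2 * q / m) * indicator B y \<le> ennreal (p t x y * p t y x)"
        using big[of y] by (auto simp: indicator_def ennreal_leI)
    qed
    also have "\<dots> = ennreal (p (2 * t) x x)" using Chapman_Kolmogorov[OF t t, of x x] by simp
    finally have "2 * q \<le> p (2 * t) x x" using p_nonneg[of "2 * t" x x] t by simp
    also have "\<dots> \<le> q" unfolding q_def by (rule p_decreasing) (use t in auto)
    finally show False using q by simp
  qed
  then obtain y where y: "y \<in> B" "(p t x y)\<^sup>2 \<le> 2 * q / m" by blast
  have "(q - p t x y)\<^sup>2 \<le> 4 * R x y * E (p t x) (p t x)"
    unfolding q_def by (rule res_dist_estimate[OF p_in_F[OF t]])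
  also have "\<dots> \<le> 4 * r * (q / t)"
    using res_ball_less[of y x r] y(1) energy_p[OF t, of x] nonneg[OF p_in_F[OF t, of x]] r
    by (intro mult_mono) (auto simp: B_def q_def)
  finally have d: "(q - p t x y)\<^sup>2 \<le> 4 * r * (q / t)" .
  have "q\<^sup>2 \<le> 2 * (p t x y)\<^sup>2 + 2 * (q - p t x y)\<^sup>2"
  proof -
    have "2 * (p t x y)\<^sup>2 + 2 * (q - p t x y)\<^sup>2 - q\<^sup>2 = (2 * p t x y - q)\<^sup>2"
      by (simp add: power2_eq_square algebra_simps)
    then show ?thesis using zero_le_power2[of "2 * p t x y - q"] by linarith
  qed
  also have "\<dots> \<le> q * (4 / m + 8 * r / t)" 
  proof -
    have "q * (4 / m + 8 * r / t) = 2 * (2 * q / m) + 2 * (4 * r * (q / t))" by (simp add: algebra_simps)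
    then show ?thesis using y(2) d by linarith
  qed
  finally have "q * q \<le> q * (4 / m + 8 * r / t)" by (simp add: power2_eq_square)
  then show ?thesis using q unfolding q_def[symmetric] by (simp only: mult_le_cancel_left_pos)
qed

lemma test_function:
  assumes c: "0 < c" and res: "ennreal c \<le> resistance E F {x} (- B)"
  shows "\<exists>f\<in>F. f x = 1 \<and> (\<forall>y. y \<notin> B \<longrightarrow> f y = 0) \<and> (\<forall>y. 0 \<le> f y \<and> f y \<le> 1) \<and> E f f \<le> 2 / c"
proof -
  define I where "I = (INF f\<in>{f \<in> F. (\<forall>x\<in>{x}. f x = 1) \<and> (\<forall>x\<in>- B. f x = 0)}. ennreal (E f f))"
  have inv: "ennreal c \<le> inverse I" using res by (simp add: resistance_def I_def)
  have "I < ennreal (2 / c)"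
  proof (cases I)
    case (real s)
    show ?thesis
    proof (cases "s = 0")
      case True
      then show ?thesis using real c by simp
    next
      case False
      hence "c \<le> inverse s" using inv real by (simp add: inverse_ennreal)
      hence "s * c \<le> 1" using real False by (simp add: field_simps)
      then have "s < 2 / c" using c by (simp add: field_simps)
      then show ?thesis using real using c by (simp add: ennreal_less_iff)
    qed
  next
    case top
    then show ?thesis using inv c by simp
  qed
  then obtain f where f: "f \<in> F" "f x = 1" "\<And>y. y \<notin> B \<Longrightarrow> f y = 0" "ennreal (E f f) < ennreal (2 / c)"
    unfolding I_def by (auto simp: INF_less_iff)
  define g where "g = (\<lambda>z. min (max (f z) 0) 1)"
  have "E g g \<le> E f f" unfolding g_def by (rule clip_le[OF f(1)]) simp
  also have "\<dots> \<le> 2 / c" using f(4) nonneg[OF f(1)] by (simp add: ennreal_less_iff)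
  finally have "E g g \<le> 2 / c" .
  moreover have "g \<in> F" unfolding g_def by (rule clip_mem[OF f(1)]) simp
  ultimately show ?thesis using f by (intro bexI[of _ g]) (auto simp: g_def)
qed

text \<open>Along times decreasing by a factor \<open>D\<close>, the increments of \<open>S t f x\<close> are at most \<open>sqrt (D * \<kappa>) / 2 ^ Suc m\<close>; they
  sum to the stated bound because \<open>S t f x\<close> tends to \<open>f x\<close>.\<close>

lemma S_near_identity:
  assumes f: "f \<in> F" and T: "0 < T" and D: "1 < D"
    and small: "\<And>m. M \<le> m \<Longrightarrow> T / D ^ Suc m * p (T / D ^ Suc m) x x * E f f \<le> \<kappa> / 4 ^ Suc m"
  shows "\<bar>S (T / D ^ M) f x - f x\<bar> \<le> sqrt (D * \<kappa>) / 2 ^ M"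
proof -
  define t where "t m = T / D ^ m" for m
  have t: "0 < t m" for m using T D by (simp add: t_def)
  have tS: "t m = D * t (Suc m)" for m using D by (simp add: t_def)
  have E0: "0 \<le> E f f" by (rule nonneg[OF f])
  have "(\<lambda>m. S (t m) f x) \<longlonglongrightarrow> f x"
  proof (rule filterlim_compose[OF S_tendsto_pointwise[OF f]])
    have "(\<lambda>m. T * (1 / D) ^ m) \<longlonglongrightarrow> T * 0"
      by (intro tendsto_mult tendsto_const LIMSEQ_realpow_zero) (use D in auto)
    then have "t \<longlonglongrightarrow> 0" by (simp add: t_def[abs_def] power_divide)
    then show "filterlim t (at_right 0) sequentially" using t less_imp_neq[OF t, symmetric] by (simp add: filterlim_at)
  qed
  then have "\<bar>S (t M) f x - f x\<bar> \<le> sqrt (D * \<kappa>) / 2 ^ M"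
  proof (rule geometric_telescope[rotated])
    fix m assume m: "M \<le> m"
    have lt: "t (Suc m) < t m" unfolding tS[of m] using t[of "Suc m"] D by simp
    have "(S (t (Suc m)) f x - S (t m) f x)\<^sup>2 \<le> p (2 * t (Suc m)) x x * ((t m - t (Suc m)) * E f f)"
      by (rule S_increment[OF f t lt])
    also have "\<dots> \<le> p (t (Suc m)) x x * (D * t (Suc m) * E f f)"
    proof (rule mult_mono)
      show "p (2 * t (Suc m)) x x \<le> p (t (Suc m)) x x" by (rule p_decreasing[OF t]) (use t[of "Suc m"] in simp)
      show "(t m - t (Suc m)) * E f f \<le> D * t (Suc m) * E f f"
        by (rule mult_right_mono[OF _ E0]) (use tS[of m] t[of "Suc m"] in simp)
      show "0 \<le> p (t (Suc m)) x x" by (rule p_nonneg[OF t])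
      show "0 \<le> (t m - t (Suc m)) * E f f" using lt E0 by simp
    qed
    also have "\<dots> = D * (t (Suc m) * p (t (Suc m)) x x * E f f)" by simp
    also have "\<dots> \<le> D * (\<kappa> / 4 ^ Suc m)"
      by (rule mult_left_mono) (use small[OF m] D in \<open>simp_all add: t_def\<close>)
    finally have "(S (t (Suc m)) f x - S (t m) f x)\<^sup>2 \<le> D * \<kappa> / 4 ^ Suc m" by simp
    hence "\<bar>S (t (Suc m)) f x - S (t m) f x\<bar> \<le> sqrt (D * \<kappa> / 4 ^ Suc m)"
      by (intro real_le_rsqrt) simp
    also have "\<dots> = sqrt (D * \<kappa>) / 2 ^ Suc m"
    proof -
      have "sqrt (4 ^ Suc m) = (2::real) ^ Suc m" by (simp only: real_sqrt_power real_sqrt_four)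
      then show ?thesis by (simp only: real_sqrt_divide)
    qed
    finally show "\<bar>S (t m) f x - S (t (Suc m)) f x\<bar> \<le> sqrt (D * \<kappa>) / 2 ^ Suc m" by (simp only: abs_minus_commute)
  qed
  then show ?thesis by (simp add: t_def)
qed

lemma heat_kernel_lower:
  assumes f: "f \<in> F" "\<And>y. y \<notin> B \<Longrightarrow> f y = 0" "\<And>y. 0 \<le> f y" "\<And>y. f y \<le> 1"
    and B: "B \<in> sets \<mu>" "emeasure \<mu> B \<le> ennreal W" and W: "0 \<le> W" and t: "0 < t"
    and half: "1 / 2 \<le> S t f x"
  shows "1 / 4 \<le> p (2 * t) x x * W"
proof -
  have fL: "f \<in> L2 \<mu>" by (rule F_L2[OF f(1)])
  have "ennreal (inn f f) = (\<integral>\<^sup>+ y. ennreal ((f y)\<^sup>2) \<partial>\<mu>)"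
    using fL by (subst nn_integral_eq_integral) (auto simp: L2_def L2_inner_def power2_eq_square)
  also have "\<dots> \<le> (\<integral>\<^sup>+ y. indicator B y \<partial>\<mu>)"
  proof (rule nn_integral_mono)
    fix y
    have "(f y)\<^sup>2 \<le> 1" using f(3,4)[of y] by (simp add: power_le_one)
    then show "ennreal ((f y)\<^sup>2) \<le> indicator B y"
      using f(2)[of y] by (cases "y \<in> B") (auto simp: ennreal_le_1)
  qed
  also have "\<dots> \<le> ennreal W" using B by simp
  finally have "inn f f \<le> W" using W by (simp add: ennreal_le_iff)
  hence "p (2 * t) x x * inn f f \<le> p (2 * t) x x * W"
    by (rule mult_left_mono) (use p_nonneg[of "2 * t"] t in simp)
  moreover have "(1 / 2)\<^sup>2 \<le> (S t f x)\<^sup>2" using half by (intro power_mono) auto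
  ultimately show ?thesis using S_bound[OF t fL, of x] by (simp add: power2_eq_square)
qed

end


section \<open>Volume functions and their inverses\<close>

text \<open>A nonnegative concave function \<open>g\<close> on \<open>{0..r0}\<close> satisfies \<open>g s \<ge> (s / r) * g r\<close>. Thus \<open>f s\<close> is at least
  \<open>(s / r) powr b * f r\<close>, and the exponent \<open>1 / 2\<close> is what the applications need.\<close>

lemma concave_powr_scaling:
  fixes f :: "real \<Rightarrow> real"
  assumes conc: "concave_on {0..r0} (\<lambda>r. f r powr (1 / b))" and b: "0 < b" "b \<le> 1 / 2"
    and f: "\<And>r. 0 \<le> f r" and s: "0 < s" "s \<le> r" "r \<le> r0"
  shows "sqrt (s / r) * f r \<le> f s"
proof -
  define \<theta> where "\<theta> = s / r"
  have r: "0 < r" using s by simp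
  have \<theta>: "0 < \<theta>" "\<theta> \<le> 1" using s r by (auto simp: \<theta>_def)
  have "(1 - \<theta>) * f 0 powr (1/b) + \<theta> * f r powr (1/b) \<le> f ((1 - \<theta>) *\<^sub>R 0 + \<theta> *\<^sub>R r) powr (1/b)"
    by (rule concave_onD[OF conc]) (use \<theta> s in auto)
  moreover have "(1 - \<theta>) *\<^sub>R 0 + \<theta> *\<^sub>R r = s" using r by (simp add: \<theta>_def)
  moreover have "0 \<le> (1 - \<theta>) * f 0 powr (1/b)" using \<theta> by simp
  ultimately have "\<theta> * f r powr (1/b) \<le> f s powr (1/b)" by simp
  hence "(\<theta> * f r powr (1/b)) powr b \<le> (f s powr (1/b)) powr b"
    by (intro powr_mono2) (use b \<theta> in auto)
  hence "\<theta> powr b * f r \<le> f s" using b f \<theta> by (simp add: powr_mult powr_powr)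
  moreover have "sqrt \<theta> \<le> \<theta> powr b"
    using powr_mono'[of b "1/2" \<theta>] b \<theta> by (simp add: powr_half_sqrt)
  ultimately show ?thesis using mult_right_mono[of "sqrt \<theta>" "\<theta> powr b" "f r"] f unfolding \<theta>_def by fastforce
qed

locale volume_functions =
  fixes RX :: ennreal and V :: "real \<Rightarrow> real" and Cu :: real and fl fu :: "real \<Rightarrow> ennreal"
  assumes V_strict: "strict_mono_on {0..} V" and V_0: "V 0 = 0"
    and doubling: "\<And>r. 0 \<le> r \<Longrightarrow> V (2 * r) \<le> Cu * V r"
    and fluctuation: "fluctuation_functions RX (ln Cu / ln 2) fl fu"
begin

lemma V_less: "0 \<le> s \<Longrightarrow> s < r \<Longrightarrow> V s < V r"
  using V_strict by (auto simp: strict_mono_on_def)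

lemma V_pos: "0 < r \<Longrightarrow> 0 < V r"
  using V_less[of 0 r] V_0 by simp

lemma V_mono: "0 \<le> s \<Longrightarrow> s \<le> r \<Longrightarrow> V s \<le> V r"
  using V_less[of s r] by (cases "s = r") auto

lemma Cu_gt_1: "1 < Cu"
proof -
  have "1 * V 1 < Cu * V 1" using doubling[of 1] V_less[of 1 2] by simp
  then show ?thesis using V_pos[of 1] by (simp only: mult_less_cancel_right_pos zero_less_one)
qed

lemma Cu_ge_1: "1 \<le> Cu"
  using Cu_gt_1 by simp

lemma radii_closed_below: "r \<in> radii RX \<Longrightarrow> 0 \<le> s \<Longrightarrow> s \<le> r \<Longrightarrow> s \<in> radii RX"
  unfolding radii_def using order_le_less_trans ennreal_leI by blast

lemma radius_exists:
  "\<exists>r0>0. r0 \<in> radii RX \<and>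
    (\<forall>s r. 0 < s \<and> s \<le> r \<and> r \<le> r0 \<longrightarrow> sqrt (s / r) * enn2real (fl r) \<le> enn2real (fl s)) \<and>
    (\<forall>s r. 0 < s \<and> s \<le> r \<and> r \<le> r0 \<longrightarrow> sqrt (s / r) * enn2real (inverse (fu r)) \<le> enn2real (inverse (fu s)))"
proof -
  obtain \<epsilon> b r0 where b: "0 < b" "0 < r0" "r0 \<in> radii RX" "b < 1 / (4 * (2 + ln Cu / ln 2))"
     and c: "concave_on {0..r0} (\<lambda>r. enn2real (fl r) powr (1 / b))"
        "concave_on {0..r0} (\<lambda>r. enn2real (inverse (fu r)) powr (1 / b))"
    using fluctuation unfolding fluctuation_functions_def by blast
  have "0 < ln Cu / ln 2" using Cu_gt_1 by simp
  hence "1 / (4 * (2 + ln Cu / ln 2)) \<le> 1 / 2" by (intro divide_left_mono) auto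
  hence b2: "b \<le> 1 / 2" using b by simp
  show ?thesis
    using concave_powr_scaling[OF c(1) b(1) b2] concave_powr_scaling[OF c(2) b(1) b2] b by auto
qed

text \<open>A radius below which both fluctuation functions scale at worst like a square root, and up to which they
  are defined.\<close>

definition r0 where "r0 = (SOME r0. r0 > 0 \<and> r0 \<in> radii RX \<and>
    (\<forall>s r. 0 < s \<and> s \<le> r \<and> r \<le> r0 \<longrightarrow> sqrt (s / r) * enn2real (fl r) \<le> enn2real (fl s)) \<and>
    (\<forall>s r. 0 < s \<and> s \<le> r \<and> r \<le> r0 \<longrightarrow> sqrt (s / r) * enn2real (inverse (fu r)) \<le> enn2real (inverse (fu s))))"

lemma r0_pos: "0 < r0" and r0_radii: "r0 \<in> radii RX"
  and fl_scaling: "\<And>s r. 0 < s \<Longrightarrow> s \<le> r \<Longrightarrow> r \<le> r0 \<Longrightarrow> sqrt (s / r) * enn2real (fl r) \<le> enn2real (fl s)"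
  and fu_scaling: "\<And>s r. 0 < s \<Longrightarrow> s \<le> r \<Longrightarrow> r \<le> r0 \<Longrightarrow> sqrt (s / r) * enn2real (inverse (fu r)) \<le> enn2real (inverse (fu s))"
  using someI_ex[OF radius_exists, folded r0_def] by blast+

lemma fl_le_1: "r \<in> radii RX \<Longrightarrow> fl r \<le> 1" and fu_ge_1: "r \<in> radii RX \<Longrightarrow> 1 \<le> fu r"
  using fluctuation unfolding fluctuation_functions_def by auto

lemma fl_pos: assumes r: "r \<in> radii RX" "0 < r" shows "0 < fl r"
proof -
  obtain \<epsilon> C where "\<forall>\<^sub>F r in at_right 0. inverse (fl r) \<le> ennreal (C * r powr (- \<epsilon>))"
    using fluctuation unfolding fluctuation_functions_def by blast
  then obtain d where d: "0 < d" "\<And>y. 0 < y \<Longrightarrow> y < d \<Longrightarrow> inverse (fl y) \<le> ennreal (C * y powr (- \<epsilon>))"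
    by (auto simp: eventually_at_right_field)
  define s where "s = min r (d/2)"
  have s: "0 < s" "s < d" "s \<le> r" using d(1) r by (auto simp: s_def)
  have "inverse (fl s) < top" using d(2)[OF s(1,2)] ennreal_less_top order_le_less_trans by blast
  hence "fl s \<noteq> 0" by auto
  hence "0 < fl s" by (simp add: zero_less_iff_neq_zero)
  also have "fl s \<le> fl r"
    using fluctuation r s radii_closed_below[OF r(1), of s] unfolding fluctuation_functions_def mono_on_def by auto
  finally show ?thesis .
qed

lemma fu_finite: assumes r: "r \<in> radii RX" "0 < r" shows "fu r < top"
proof -
  obtain \<epsilon> C where "\<forall>\<^sub>F r in at_right 0. fu r \<le> ennreal (C * r powr (- \<epsilon>))"
    using fluctuation unfolding fluctuation_functions_def by blast
  then obtain d where d: "0 < d" "\<And>y. 0 < y \<Longrightarrow> y < d \<Longrightarrow> fu y \<le> ennreal (C * y powr (- \<epsilon>))"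
    by (auto simp: eventually_at_right_field)
  define s where "s = min r (d/2)"
  have s: "0 < s" "s < d" "s \<le> r" using d(1) r by (auto simp: s_def)
  have "fu r \<le> fu s"
    using fluctuation r s radii_closed_below[OF r(1), of s] unfolding fluctuation_functions_def monotone_on_def by auto
  also have "fu s < top" using d(2)[OF s(1,2)] ennreal_less_top order_le_less_trans by blast
  finally show ?thesis .
qed

text \<open>Real-valued versions of \<open>Vtilde\<close> and \<open>htilde\<close>; the two agree at positive radii in the domain.\<close>

definition Vl where "Vl r = enn2real (fl r) * V r"
definition Hl where "Hl r = r * Vl r"
definition Vu where "Vu r = enn2real (fu r) * V r"
definition Hu where "Hu r = r * Vu r"

lemma fl_real: "r \<in> radii RX \<Longrightarrow> fl r = ennreal (enn2real (fl r))"
  using fl_le_1[of r] by (simp add: ennreal_enn2real_if) (metis ennreal_one_less_top leD)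

lemma fu_real: "r \<in> radii RX \<Longrightarrow> 0 < r \<Longrightarrow> fu r = ennreal (enn2real (fu r))"
  using fu_finite[of r] by simp

lemma V_nonneg: "0 \<le> r \<Longrightarrow> 0 \<le> V r" using V_mono[of 0 r] V_0 by simp

lemma Vtilde_l: "r \<in> radii RX \<Longrightarrow> Vtilde fl V r = ennreal (Vl r)"
  unfolding Vtilde_def Vl_def using V_nonneg[of r] by (subst fl_real) (auto simp: ennreal_mult radii_def)

lemma Vtilde_u: "r \<in> radii RX \<Longrightarrow> 0 < r \<Longrightarrow> Vtilde fu V r = ennreal (Vu r)"
  unfolding Vtilde_def Vu_def using V_nonneg[of r] by (subst fu_real) (auto simp: ennreal_mult radii_def)

lemma Vl_pos: "r \<in> radii RX \<Longrightarrow> 0 < r \<Longrightarrow> 0 < Vl r"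
  unfolding Vl_def using fl_pos[of r] fl_le_1[of r] V_pos[of r]
  by (intro mult_pos_pos) (auto simp: enn2real_positive_iff intro: order_le_less_trans)

lemma Vu_pos: "r \<in> radii RX \<Longrightarrow> 0 < r \<Longrightarrow> 0 < Vu r"
  unfolding Vu_def using fu_finite[of r] fu_ge_1[of r] V_pos[of r]
  by (intro mult_pos_pos) (auto simp: enn2real_positive_iff intro: less_le_trans[OF zero_less_one])

lemma htilde_l: "r \<in> radii RX \<Longrightarrow> htilde fl V r = ennreal (Hl r)"
  unfolding htilde_def Hl_def using V_nonneg[of r]
  by (subst Vtilde_l) (auto simp: ennreal_mult radii_def Vl_def)

lemma htilde_u: "r \<in> radii RX \<Longrightarrow> 0 < r \<Longrightarrow> htilde fu V r = ennreal (Hu r)"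
  unfolding htilde_def Hu_def using V_nonneg[of r]
  by (subst Vtilde_u) (auto simp: ennreal_mult radii_def Vu_def)

lemma Hl_pos: "r \<in> radii RX \<Longrightarrow> 0 < r \<Longrightarrow> 0 < Hl r"
  unfolding Hl_def using Vl_pos by simp

lemma Hu_pos: "r \<in> radii RX \<Longrightarrow> 0 < r \<Longrightarrow> 0 < Hu r"
  unfolding Hu_def using Vu_pos by simp

lemma small_radii: "0 \<le> r \<Longrightarrow> r \<le> r0 \<Longrightarrow> r \<in> radii RX"
  by (rule radii_closed_below[OF r0_radii])

lemma fl_real_le_1: "r \<in> radii RX \<Longrightarrow> enn2real (fl r) \<le> 1"
  using enn2real_mono[OF fl_le_1, of r] by simp

lemma Hl_mono:
  assumes "s \<in> radii RX" "r \<in> radii RX" "s \<le> r"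
  shows "Hl s \<le> Hl r"
proof -
  have s: "0 \<le> s" using assms by (simp add: radii_def)
  have "fl s \<le> fl r" using fluctuation assms unfolding fluctuation_functions_def mono_on_def by auto
  hence "enn2real (fl s) \<le> enn2real (fl r)"
    by (rule enn2real_mono) (use fl_le_1[OF assms(2)] ennreal_one_less_top order_le_less_trans in blast)
  then show ?thesis unfolding Hl_def Vl_def
    using V_mono[OF s assms(3)] V_nonneg[OF s] s assms(3) by (intro mult_mono) auto
qed

lemma Hl_le: "0 \<le> r \<Longrightarrow> r \<le> r0 \<Longrightarrow> Hl r \<le> r * V r0"
  unfolding Hl_def Vl_def
  using fl_real_le_1[OF small_radii, of r] V_mono[of r r0] V_nonneg[of r] mult_mono[of "enn2real (fl r)" 1 "V r" "V r0"]
  by (intro mult_left_mono) auto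

abbreviation \<rho>l where "\<rho>l \<equiv> radial_inverse RX (htilde fl V)"
abbreviation \<rho>u where "\<rho>u \<equiv> radial_inverse RX (htilde fu V)"

lemma bdd_inverse: "bdd_below {r \<in> radii RX. ennreal s \<le> \<phi> r}"
  by (rule bdd_belowI[of _ 0]) (simp add: radii_def)

lemma inverse_l_le: "s \<in> radii RX \<Longrightarrow> t \<le> Hl s \<Longrightarrow> \<rho>l t \<le> s"
  unfolding radial_inverse_def by (rule cInf_lower[OF _ bdd_inverse]) (simp add: htilde_l ennreal_leI)

lemma inverse_l_less:
  assumes "0 < t" "t \<le> Hl r0" "\<rho>l t < s" "s \<le> r0"
  shows "t \<le> Hl s"
proof -
  have "r0 \<in> {r \<in> radii RX. ennreal t \<le> htilde fl V r}"
    using assms r0_radii by (simp add: htilde_l ennreal_leI)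
  then obtain r where r: "r \<in> radii RX" "ennreal t \<le> htilde fl V r" "r < s"
    using assms(3) unfolding radial_inverse_def by (subst (asm) cInf_less_iff[OF _ bdd_inverse]) auto
  have r0': "0 \<le> r" using r by (simp add: radii_def)
  have sr: "s \<in> radii RX" using small_radii[of s] r(3) r0' assms by simp
  have "ennreal t \<le> ennreal (Hl s)"
    using r Hl_mono[OF r(1) sr] by (auto simp: htilde_l intro: order_trans ennreal_leI)
  then show ?thesis using assms(1) by (cases "0 \<le> Hl s") (auto simp: ennreal_neg ennreal_le_iff)
qed

lemma inverse_l_pos:
  assumes "0 < t" "t \<le> Hl r0"
  shows "0 < \<rho>l t"
proof (rule ccontr)
  assume "\<not> 0 < \<rho>l t"
  define s where "s = min r0 (t / (2 * V r0))"
  have v: "0 < V r0" by (rule V_pos[OF r0_pos])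
  have s: "0 < s" "s \<le> r0" using r0_pos v assms by (auto simp: s_def)
  have "t \<le> Hl s" by (rule inverse_l_less[OF assms]) (use \<open>\<not> 0 < \<rho>l t\<close> s in auto)
  also have "\<dots> \<le> s * V r0" by (rule Hl_le) (use s in auto)
  also have "\<dots> \<le> t / (2 * V r0) * V r0" using v by (intro mult_right_mono) (auto simp: s_def)
  also have "\<dots> = t / 2" using v by simp
  finally show False using assms by simp
qed

text \<open>Doubling of \<open>V\<close> twice gives \<open>Cu\<^sup>2\<close>, the factor \<open>r\<close> gives \<open>4\<close>, and the square-root scaling of \<open>fl\<close> gives \<open>2\<close>.\<close>

definition D where "D = 8 * Cu\<^sup>2"

lemma D_ge: "8 \<le> D"
  unfolding D_def using Cu_ge_1 by (simp add: one_le_power)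

lemma Hl_quarter:
  assumes r: "0 < r" "r \<le> r0"
  shows "Hl r / D \<le> Hl (r / 4)"
proof -
  have "V r \<le> Cu * V (r / 2)" using doubling[of "r/2"] r by simp
  also have "\<dots> \<le> Cu * (Cu * V (r / 4))" using doubling[of "r/4"] r Cu_ge_1 by (intro mult_left_mono) auto
  finally have V: "V r \<le> Cu\<^sup>2 * V (r / 4)" by (simp add: power2_eq_square)
  have "sqrt ((r / 4) / r) * enn2real (fl r) \<le> enn2real (fl (r / 4))"
    by (rule fl_scaling) (use r in auto)
  moreover have "sqrt ((r / 4) / r) = 1 / 2" using r by (simp add: real_sqrt_divide)
  ultimately have "1 / 2 * enn2real (fl r) \<le> enn2real (fl (r / 4))" by (simp only:)
  hence l: "enn2real (fl r) \<le> 2 * enn2real (fl (r / 4))" by simp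
  have "Hl r = r * (enn2real (fl r) * V r)" by (simp add: Hl_def Vl_def)
  also have "\<dots> \<le> r * ((2 * enn2real (fl (r / 4))) * (Cu\<^sup>2 * V (r / 4)))"
    using r V l V_nonneg[of r] by (intro mult_left_mono mult_mono) auto
  also have "\<dots> = D * Hl (r / 4)" by (simp add: Hl_def Vl_def D_def)
  finally show ?thesis using D_ge by (simp add: field_simps)
qed

lemma divide_power_le:
  assumes "0 < r" "r \<le> r0"
  shows "r / 4 ^ m \<le> r0"
proof -
  have "r / 4 ^ m \<le> r / 1" by (rule divide_left_mono) (use assms in auto)
  then show ?thesis using assms by simp
qed

lemma Hl_scaled:
  assumes r: "0 < r" "r \<le> r0"
  shows "Hl r / D ^ m \<le> Hl (r / 4 ^ m)"
proof (induction m)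
  case (Suc m)
  have "Hl r / D ^ Suc m = (Hl r / D ^ m) / D" by simp
  also have "\<dots> \<le> Hl (r / 4 ^ m) / D" using Suc D_ge by (intro divide_right_mono) auto
  also have "\<dots> \<le> Hl (r / 4 ^ m / 4)" by (rule Hl_quarter) (use r divide_power_le[OF r] in auto)
  finally show ?case by (simp add: mult.commute)
qed simp

text \<open>The inverse of \<open>Hl\<close> gains a factor \<open>4\<close> when the time drops by \<open>D\<close>, which makes the increments of \<open>S t f x\<close>
  in \<open>S_near_identity\<close> geometric with ratio \<open>1 / 2\<close>.\<close>

lemma inverse_l_scaled:
  assumes r: "0 < r" "r \<le> r0"
  shows "\<rho>l (Hl r / D ^ m) \<le> r / 4 ^ m"
  by (rule inverse_l_le[OF small_radii Hl_scaled[OF r]]) (use r divide_power_le[OF r] in auto)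

text \<open>Although \<open>fu\<close> decreases, it does so more slowly than the factor \<open>r\<close> increases. Therefore \<open>Hu\<close> is strictly
  increasing near \<open>0\<close>, which identifies its generalised inverse.\<close>

lemma Hu_scaling:
  assumes s: "0 < s" "s \<le> r" "r \<le> r0"
  shows "Hu s \<le> sqrt (s / r) * (r * (enn2real (fu r) * V s))"
proof -
  have rad: "s \<in> radii RX" "r \<in> radii RX" using small_radii s by auto
  have r: "0 < r" using s by simp
  define a where "a = enn2real (fu s)"
  define c where "c = enn2real (fu r)"
  have a: "0 < a" and c: "0 < c" unfolding a_def c_def
    using fu_finite[OF rad(1) s(1)] fu_ge_1[OF rad(1)] fu_finite[OF rad(2) r] fu_ge_1[OF rad(2)]
    by (auto simp: enn2real_positive_iff intro: less_le_trans[OF zero_less_one])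
  have ia: "enn2real (inverse (fu s)) = 1 / a"
    by (subst fu_real[OF rad(1) s(1)]) (use a in \<open>simp add: a_def[symmetric] inverse_ennreal divide_inverse\<close>)
  have ic: "enn2real (inverse (fu r)) = 1 / c"
    by (subst fu_real[OF rad(2) r]) (use c in \<open>simp add: c_def[symmetric] inverse_ennreal divide_inverse\<close>)
  define \<theta> where "\<theta> = sqrt (s / r)"
  have \<theta>: "0 < \<theta>" using s r by (simp add: \<theta>_def)
  have "\<theta> * (1 / c) \<le> 1 / a"
    using fu_scaling[OF s] unfolding ia ic \<theta>_def .
  hence "\<theta> * a \<le> c" using a c by (simp add: field_simps)
  moreover have "s = \<theta> * \<theta> * r" using s r by (simp add: \<theta>_def)
  ultimately have "s * a \<le> \<theta> * (r * c)"
    using mult_left_mono[of "\<theta> * a" c "\<theta> * r"] \<theta> r by (simp add: mult_ac)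
  then have "s * a * V s \<le> \<theta> * (r * c) * V s" using V_nonneg[of s] s by (intro mult_right_mono) auto
  then show ?thesis by (simp add: Hu_def Vu_def a_def c_def \<theta>_def mult_ac)
qed

lemma Hu_less:
  assumes s: "0 < s" "s < r" "r \<le> r0"
  shows "Hu s < Hu r"
proof -
  have rad: "r \<in> radii RX" using small_radii s by auto
  have r: "0 < r" using s by simp
  have c: "0 < enn2real (fu r)"
    using fu_finite[OF rad r] fu_ge_1[OF rad] by (auto simp: enn2real_positive_iff intro: less_le_trans[OF zero_less_one])
  have "Hu s \<le> sqrt (s / r) * (r * (enn2real (fu r) * V s))" by (rule Hu_scaling) (use s in auto)
  also have "\<dots> \<le> 1 * (r * (enn2real (fu r) * V s))"
    using s r c V_nonneg[of s] by (intro mult_right_mono) auto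
  also have "\<dots> < Hu r" using V_less[of s r] s r c by (simp add: Hu_def Vu_def)
  finally show ?thesis .
qed

lemma inverse_u_ge:
  assumes r: "0 < r" "r \<le> r0"
  shows "r \<le> \<rho>u (Hu r)"
  unfolding radial_inverse_def
proof (rule cInf_greatest)
  have rad: "r \<in> radii RX" using small_radii r by auto
  then show "{s \<in> radii RX. ennreal (Hu r) \<le> htilde fu V s} \<noteq> {}" using htilde_u[OF rad r(1)] by auto
  fix s assume s: "s \<in> {s \<in> radii RX. ennreal (Hu r) \<le> htilde fu V s}"
  have Hr: "0 < Hu r" by (rule Hu_pos[OF rad r(1)])
  have s0: "0 \<le> s" using s by (simp add: radii_def)
  show "r \<le> s"
  proof (rule ccontr)
    assume "\<not> r \<le> s"
    show False
    proof (cases "s = 0")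
      case True
      then show ?thesis using s Hr by (simp add: htilde_def)
    next
      case False
      hence "Hu s < Hu r" using Hu_less[of s r] s0 r \<open>\<not> r \<le> s\<close> by simp
      then show ?thesis using s False s0 htilde_u[of s] Hr by (simp add: ennreal_le_iff2)
    qed
  qed
qed

lemma filterlim_Hl:
  assumes "0 < c"
  shows "filterlim (\<lambda>r. c * Hl r) (at_right 0) (at_right 0)"
proof -
  have ev: "\<forall>\<^sub>F r in at_right 0. 0 < r \<and> r < r0"
    using r0_pos by (auto simp: eventually_at_right_field)
  have "((\<lambda>r. c * (r * V r0)) \<longlongrightarrow> c * (0 * V r0)) (at_right 0)" by (intro tendsto_intros)
  then have lim: "((\<lambda>r. c * (r * V r0)) \<longlongrightarrow> 0) (at_right 0)" by simp
  have "((\<lambda>r. c * Hl r) \<longlongrightarrow> 0) (at_right 0)"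
  proof (rule tendsto_sandwich[OF _ _ tendsto_const lim])
    show "\<forall>\<^sub>F r in at_right 0. 0 \<le> c * Hl r"
      using ev by eventually_elim (use Hl_pos small_radii assms in \<open>auto intro!: mult_nonneg_nonneg less_imp_le\<close>)
    show "\<forall>\<^sub>F r in at_right 0. c * Hl r \<le> c * (r * V r0)"
      using ev by eventually_elim (use Hl_le assms in \<open>auto intro!: mult_left_mono\<close>)
  qed
  moreover have "\<forall>\<^sub>F r in at_right 0. c * Hl r \<in> {0<..} \<and> c * Hl r \<noteq> 0"
    using ev by eventually_elim (use Hl_pos small_radii assms in \<open>auto simp: less_imp_neq[symmetric]\<close>)
  ultimately show ?thesis by (simp add: filterlim_at)
qed

lemma filterlim_Hu: "filterlim Hu (at_right 0) (at_right 0)"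
proof -
  have ev: "\<forall>\<^sub>F r in at_right 0. 0 < r \<and> r < r0"
    using r0_pos by (auto simp: eventually_at_right_field)
  have "((\<lambda>r. sqrt (r / r0) * Hu r0) \<longlongrightarrow> sqrt (0 / r0) * Hu r0) (at_right 0)" using r0_pos by (intro tendsto_intros) auto
  then have lim: "((\<lambda>r. sqrt (r / r0) * Hu r0) \<longlongrightarrow> 0) (at_right 0)" by simp
  have "(Hu \<longlongrightarrow> 0) (at_right 0)"
  proof (rule tendsto_sandwich[OF _ _ tendsto_const lim])
    show "\<forall>\<^sub>F r in at_right 0. 0 \<le> Hu r"
      using ev by eventually_elim (use Hu_pos small_radii in \<open>auto intro!: less_imp_le\<close>)
    show "\<forall>\<^sub>F r in at_right 0. Hu r \<le> sqrt (r / r0) * Hu r0"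
      using ev
    proof eventually_elim
      case (elim r)
      have "Hu r \<le> sqrt (r / r0) * (r0 * (enn2real (fu r0) * V r))" by (rule Hu_scaling) (use elim in auto)
      also have "\<dots> \<le> sqrt (r / r0) * Hu r0"
        unfolding Hu_def Vu_def using V_mono[of r r0] elim by (intro mult_left_mono) auto
      finally show ?case .
    qed
  qed
  moreover have "\<forall>\<^sub>F r in at_right 0. Hu r \<in> {0<..} \<and> Hu r \<noteq> 0"
    using ev by eventually_elim (use Hu_pos small_radii in \<open>auto simp: less_imp_neq[symmetric]\<close>)
  ultimately show ?thesis by (simp add: filterlim_at)
qed

end


section \<open>Fluctuations at a point\<close>

lemma less_divide_ennrealD:
  assumes "ennreal c < X / ennreal v" "0 < v" "0 \<le> c"
  shows "ennreal (c * v) \<le> X"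
proof (cases X)
  case (real x)
  then have "c < x / v" using assms by (simp add: divide_ennreal ennreal_less_iff)
  then show ?thesis using real assms by (simp add: field_simps ennreal_leI)
qed simp

lemma divide_ennreal_lessD:
  assumes "X / ennreal v < ennreal c" "0 < v"
  shows "X \<le> ennreal (c * v)"
proof (cases X)
  case (real x)
  then have "x / v < c" using assms by (simp add: divide_ennreal ennreal_less_iff)
  then show ?thesis using real assms by (simp add: field_simps ennreal_leI)
next
  case top
  then show ?thesis using assms by (simp add: ennreal_top_divide)
qed

lemma Liminf_less_frequently:
  fixes f :: "'a \<Rightarrow> 'b::complete_linorder"
  shows "Liminf F f < c \<Longrightarrow> \<exists>\<^sub>F x in F. f x < c"
  unfolding frequently_def using Liminf_bounded[of c f F] by (auto simp: not_less)

lemma less_Limsup_frequently: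
  fixes f :: "'a \<Rightarrow> 'b::complete_linorder"
  shows "c < Limsup F f \<Longrightarrow> \<exists>\<^sub>F x in F. c < f x"
  unfolding frequently_def using Limsup_bounded[of f c F] by (auto simp: not_less)

lemma ennreal_pos_between:
  assumes "0 < (L::ennreal)" obtains c where "0 < c" "ennreal c < L"
proof -
  obtain z where z: "0 < z" "z < L" using dense[OF assms] by blast
  then show thesis using that by (cases z) auto
qed

lemma frequently_filterlim:
  "filterlim g G F \<Longrightarrow> \<exists>\<^sub>F x in F. Q (g x) \<Longrightarrow> \<exists>\<^sub>F y in G. Q y"
  unfolding frequently_def filterlim_iff by blast

locale heat_kernel_volume = heat_kernel_form E F \<mu> P p + volume_functions "res_diameter E F" V Cu fl fu
  for E :: "('a::metric_space \<Rightarrow> real) \<Rightarrow> ('a \<Rightarrow> real) \<Rightarrow> real" and F \<mu> P p V Cu fl fu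
begin

lemma eventually_radius: "\<forall>\<^sub>F r in at_right 0. 0 < r \<and> r < r0"
  using r0_pos by (auto simp: eventually_at_right_field)

text \<open>Apply \<open>heat_kernel_upper\<close> at the radius \<open>s = 2 * \<rho>l t\<close>. The factor \<open>2\<close> moves \<open>s\<close> strictly beyond the infimum
  defining \<open>\<rho>l t\<close>, so that \<open>t \<le> Hl s\<close> holds even if \<open>Hl\<close> jumps.\<close>

lemma upper_estimate:
  assumes "0 < Liminf (at_right 0) (\<lambda>r. emeasure \<mu> (res_ball E F x r) / Vtilde fl V r)"
  shows "\<exists>K>0. \<forall>\<^sub>F t in at_right 0. t * p t x x \<le> K * \<rho>l t"
proof -
  obtain c where c: "0 < c" "ennreal c < Liminf (at_right 0) (\<lambda>r. emeasure \<mu> (res_ball E F x r) / Vtilde fl V r)"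
    by (rule ennreal_pos_between[OF assms])
  have "\<forall>\<^sub>F r in at_right 0. ennreal c < emeasure \<mu> (res_ball E F x r) / Vtilde fl V r"
    by (rule less_LiminfD[OF c(2)])
  then obtain d where d: "0 < d" "\<And>r. 0 < r \<Longrightarrow> r < d \<Longrightarrow> ennreal c < emeasure \<mu> (res_ball E F x r) / Vtilde fl V r"
    by (auto simp: eventually_at_right_field)
  define e where "e = min (d / 4) (r0 / 4)"
  have e: "0 < e" "e \<le> r0" "2 * e < d" "2 * e < r0" using d r0_pos by (auto simp: e_def)
  have He: "0 < Hl e" by (rule Hl_pos) (use e small_radii in auto)
  have "t * p t x x \<le> (8 / c + 16) * \<rho>l t" if t: "0 < t" "t < Hl e" for t
  proof -
    have tr: "t \<le> Hl r0" using Hl_mono[of e r0] small_radii[of e] r0_radii e t by simp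
    have le: "\<rho>l t \<le> e" by (rule inverse_l_le) (use e t small_radii in auto)
    have pos: "0 < \<rho>l t" by (rule inverse_l_pos[OF t(1) tr])
    define s where "s = 2 * \<rho>l t"
    have s: "0 < s" "s < d" "s < r0" using le pos e by (auto simp: s_def)
    have sr: "s \<in> radii (res_diameter E F)" using small_radii s by simp
    have "t \<le> Hl s" by (rule inverse_l_less[OF t(1) tr]) (use pos s in \<open>auto simp: s_def\<close>)
    hence "t / s \<le> Vl s" using s by (simp add: Hl_def field_simps)
    hence "ennreal (c * (t / s)) \<le> ennreal (c * Vl s)" using c by (intro ennreal_leI mult_left_mono) auto
    also have "\<dots> \<le> emeasure \<mu> (res_ball E F x s)"
      by (rule less_divide_ennrealD) (use d(2)[OF s(1,2)] Vtilde_l[OF sr] Vl_pos[OF sr s(1)] c in auto)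
    finally have "p t x x \<le> 4 / (c * (t / s)) + 8 * s / t"
      by (rule heat_kernel_upper[rotated 3]) (use c t s in auto)
    also have "\<dots> = (4 / c + 8) * s / t" using c t s by (simp add: field_simps)
    finally have "t * p t x x \<le> (4 / c + 8) * s" using t by (simp add: field_simps)
    then show ?thesis by (simp add: s_def algebra_simps)
  qed
  then have "\<forall>\<^sub>F t in at_right 0. t * p t x x \<le> (8 / c + 16) * \<rho>l t"
    using He by (auto simp: eventually_at_right_field)
  moreover have "0 < 8 / c + 16" using c by (simp add: add_pos_pos)
  ultimately show ?thesis by blast
qed

lemma Limsup_upper:
  assumes "0 < Liminf (at_right 0) (\<lambda>r. emeasure \<mu> (res_ball E F x r) / Vtilde fl V r)"
  shows "Limsup (at_right 0) (\<lambda>t. ereal (t * p t x x / \<rho>l t)) < \<infinity>"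
proof -
  obtain K where K: "0 < K" "\<forall>\<^sub>F t in at_right 0. t * p t x x \<le> K * \<rho>l t"
    using upper_estimate[OF assms] by blast
  have "0 < Hl r0" by (rule Hl_pos[OF r0_radii r0_pos])
  then have "\<forall>\<^sub>F t in at_right 0. 0 < t \<and> t < Hl r0" by (auto simp: eventually_at_right_field)
  with K(2) have "\<forall>\<^sub>F t in at_right 0. ereal (t * p t x x / \<rho>l t) \<le> ereal K"
  proof eventually_elim
    case (elim t)
    then show ?case using inverse_l_pos[of t] by (simp add: pos_divide_le_eq)
  qed
  then have "Limsup (at_right 0) (\<lambda>t. ereal (t * p t x x / \<rho>l t)) \<le> ereal K" by (rule Limsup_bounded)
  then show ?thesis by (rule order_le_less_trans) simp
qed

text \<open>At a radius \<open>r\<close> with volume at least \<open>c * Vu r\<close>, apply \<open>heat_kernel_upper\<close> at time \<open>Hu r = r * Vu r\<close>, for which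
  the two terms of that bound are both of order \<open>r / Hu r\<close>.\<close>

lemma Liminf_upper:
  assumes "0 < Limsup (at_right 0) (\<lambda>r. emeasure \<mu> (res_ball E F x r) / Vtilde fu V r)"
  shows "Liminf (at_right 0) (\<lambda>t. ereal (t * p t x x / \<rho>u t)) < \<infinity>"
proof -
  obtain c where c: "0 < c" "ennreal c < Limsup (at_right 0) (\<lambda>r. emeasure \<mu> (res_ball E F x r) / Vtilde fu V r)"
    by (rule ennreal_pos_between[OF assms])
  have "\<exists>\<^sub>F r in at_right 0. ennreal c < emeasure \<mu> (res_ball E F x r) / Vtilde fu V r"
    by (rule less_Limsup_frequently[OF c(2)])
  then have "\<exists>\<^sub>F r in at_right 0. (0 < r \<and> r < r0) \<and> ennreal c < emeasure \<mu> (res_ball E F x r) / Vtilde fu V r"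
    using eventually_radius by (rule frequently_eventually_conj)
  then have "\<exists>\<^sub>F r in at_right 0. Hu r * p (Hu r) x x / \<rho>u (Hu r) \<le> 4 / c + 8"
  proof (rule frequently_elim1)
    fix r assume r: "(0 < r \<and> r < r0) \<and> ennreal c < emeasure \<mu> (res_ball E F x r) / Vtilde fu V r"
    hence rr: "r \<in> radii (res_diameter E F)" using small_radii by auto
    have Vp: "0 < Vu r" using Vu_pos[OF rr] r by simp
    have Hp: "0 < Hu r" using Hu_pos[OF rr] r by simp
    have "ennreal (c * Vu r) \<le> emeasure \<mu> (res_ball E F x r)"
      by (rule less_divide_ennrealD) (use r Vtilde_u[OF rr] Vp c in auto)
    then have "p (Hu r) x x \<le> 4 / (c * Vu r) + 8 * r / Hu r"
      by (rule heat_kernel_upper[rotated 3]) (use c Vp Hp r in auto)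
    hence "Hu r * p (Hu r) x x \<le> Hu r * (4 / (c * Vu r) + 8 * r / Hu r)"
      by (rule mult_left_mono) (use Hp in simp)
    also have "\<dots> = (4 / c + 8) * r" using c Vp r by (simp add: Hu_def field_simps)
    also have "\<dots> \<le> (4 / c + 8) * \<rho>u (Hu r)"
      by (rule mult_left_mono[OF inverse_u_ge]) (use c r in auto)
    finally have "Hu r * p (Hu r) x x \<le> (4 / c + 8) * \<rho>u (Hu r)" .
    moreover have "0 < \<rho>u (Hu r)" using inverse_u_ge[of r] r by simp
    ultimately show "Hu r * p (Hu r) x x / \<rho>u (Hu r) \<le> 4 / c + 8" by (simp add: pos_divide_le_eq)
  qed
  then have freq: "\<exists>\<^sub>F t in at_right 0. t * p t x x / \<rho>u t \<le> 4 / c + 8"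
    by (rule frequently_filterlim[OF filterlim_Hu])
  show ?thesis
  proof (rule ccontr)
    assume "\<not> ?thesis"
    hence "ereal (4 / c + 8) < Liminf (at_right 0) (\<lambda>t. ereal (t * p t x x / \<rho>u t))" by simp
    from less_LiminfD[OF this] freq show False by (simp add: frequently_def not_le)
  qed
qed

text \<open>The radii are those at which the volume is at most \<open>A * Vl r\<close>, and the time is \<open>\<theta> * Hl r\<close> with \<open>\<theta>\<close>
  independent of \<open>r\<close>. The upper estimate enters in order to bound the increments of \<open>S t f x\<close> below that
  time.\<close>

lemma Limsup_lower:
  assumes lower: "0 < Liminf (at_right 0) (\<lambda>r. emeasure \<mu> (res_ball E F x r) / Vtilde fl V r)"
    and upper: "Liminf (at_right 0) (\<lambda>r. emeasure \<mu> (res_ball E F x r) / Vtilde fl V r) < \<infinity>"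
    and res: "0 < Liminf (at_right 0) (\<lambda>r. resistance E F {x} (- res_ball E F x r) / ennreal r)"
  shows "0 < Limsup (at_right 0) (\<lambda>t. ereal (t * p t x x / \<rho>l t))"
proof -
  let ?B = "res_ball E F x"
  obtain K where K: "0 < K" "\<forall>\<^sub>F t in at_right 0. t * p t x x \<le> K * \<rho>l t"
    using upper_estimate[OF lower] by blast
  obtain \<tau> where \<tau>: "0 < \<tau>" "\<And>t. 0 < t \<Longrightarrow> t < \<tau> \<Longrightarrow> t * p t x x \<le> K * \<rho>l t"
    using K(2) by (auto simp: eventually_at_right_field)
  obtain c where c: "0 < c" "ennreal c < Liminf (at_right 0) (\<lambda>r. resistance E F {x} (- ?B r) / ennreal r)"
    by (rule ennreal_pos_between[OF res])
  obtain a where a: "0 < a" "ennreal a < Liminf (at_right 0) (\<lambda>r. emeasure \<mu> (?B r) / Vtilde fl V r)"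
    by (rule ennreal_pos_between[OF lower])
  obtain A where A: "0 < A" "Liminf (at_right 0) (\<lambda>r. emeasure \<mu> (?B r) / Vtilde fl V r) < ennreal A"
  proof -
    obtain y where y: "Liminf (at_right 0) (\<lambda>r. emeasure \<mu> (?B r) / Vtilde fl V r) < y" "y < \<infinity>"
      using dense[OF upper] by blast
    moreover have "0 < y" using lower y(1) by (rule less_trans)
    ultimately show ?thesis using that by (cases y) auto
  qed
  define \<kappa> where "\<kappa> = K * (2 / c)"
  have \<kappa>: "0 < \<kappa>" using K c by (simp add: \<kappa>_def)
  have D: "8 \<le> D" by (rule D_ge)
  \<comment> \<open>The first condition keeps \<open>S t f x\<close> within \<open>1 / 2\<close> of \<open>f x = 1\<close>; \<open>1 \<le> M\<close> ensures \<open>\<theta> \<le> 1\<close>.\<close>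
  obtain M where M: "sqrt (D * \<kappa>) / 2 ^ M \<le> 1 / 2" "1 \<le> M"
  proof -
    obtain n where "2 * sqrt (D * \<kappa>) < 2 ^ n" using real_arch_pow[of 2 "2 * sqrt (D * \<kappa>)"] by auto
    also have "(2::real) ^ n \<le> 2 ^ Suc n" by simp
    finally have "sqrt (D * \<kappa>) / 2 ^ Suc n \<le> 1 / 2" by (simp add: field_simps)
    then show ?thesis using that[of "Suc n"] by simp
  qed
  have DM: "2 \<le> D ^ M"
  proof -
    have "D ^ 1 \<le> D ^ M" using M(2) D by (intro power_increasing) auto
    then show ?thesis using D by simp
  qed
  define \<theta> where "\<theta> = 2 / D ^ M"
  have \<theta>: "0 < \<theta>" "\<theta> \<le> 1" using DM by (auto simp: \<theta>_def)
  have "\<exists>\<^sub>F r in at_right 0. emeasure \<mu> (?B r) / Vtilde fl V r < ennreal A"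
    by (rule Liminf_less_frequently[OF A(2)])
  moreover have "\<forall>\<^sub>F r in at_right 0. (0 < r \<and> r < r0) \<and> 1 * Hl r < \<tau> \<and>
      ennreal a < emeasure \<mu> (?B r) / Vtilde fl V r \<and>
      ennreal c < resistance E F {x} (- ?B r) / ennreal r"
  proof (rule eventually_conj[OF eventually_radius], intro eventually_conj less_LiminfD[OF a(2)] less_LiminfD[OF c(2)])
    have "\<forall>\<^sub>F t in at_right 0. t < \<tau>" using \<tau>(1) by (auto simp: eventually_at_right_field)
    then show "\<forall>\<^sub>F r in at_right 0. 1 * Hl r < \<tau>"
      by (rule eventually_compose_filterlim[OF _ filterlim_Hl]) simp
  qed
  ultimately have "\<exists>\<^sub>F r in at_right 0. emeasure \<mu> (?B r) / Vtilde fl V r < ennreal A \<and>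
      (0 < r \<and> r < r0) \<and> 1 * Hl r < \<tau> \<and>
      ennreal a < emeasure \<mu> (?B r) / Vtilde fl V r \<and>
      ennreal c < resistance E F {x} (- ?B r) / ennreal r"
    by (rule frequently_eventually_frequently)
  then have "\<exists>\<^sub>F r in at_right 0. \<theta> / (4 * A) \<le> (\<theta> * Hl r) * p (\<theta> * Hl r) x x / \<rho>l (\<theta> * Hl r)"
  proof (rule frequently_elim1, elim conjE)
    fix r assume vol: "emeasure \<mu> (?B r) / Vtilde fl V r < ennreal A"
      and r: "0 < r" "r < r0" and T\<tau>: "1 * Hl r < \<tau>"
      and vol': "ennreal a < emeasure \<mu> (?B r) / Vtilde fl V r"
      and res: "ennreal c < resistance E F {x} (- ?B r) / ennreal r"
    define T where "T = Hl r"
    have rr: "r \<in> radii (res_diameter E F)" using small_radii r by auto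
    have T: "0 < T" "T < \<tau>" using Hl_pos[OF rr r(1)] T\<tau> by (auto simp: T_def)
    have Vp: "0 < Vl r" by (rule Vl_pos[OF rr r(1)])
    have Vl: "Vl r = T / r" using r by (simp add: T_def Hl_def)
    have meas: "emeasure \<mu> (?B r) \<le> ennreal (A * Vl r)"
      by (rule divide_ennreal_lessD) (use vol Vtilde_l[OF rr] Vp in auto)
    have "ennreal (a * Vl r) \<le> emeasure \<mu> (?B r)"
      by (rule less_divide_ennrealD) (use vol' Vtilde_l[OF rr] Vp a in auto)
    then have "emeasure \<mu> (?B r) \<noteq> 0" using mult_pos_pos[OF a(1) Vp] by auto
    hence B: "?B r \<in> sets \<mu>" using emeasure_notin_sets by blast
    have "ennreal (c * r) \<le> resistance E F {x} (- ?B r)"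
      by (rule less_divide_ennrealD[OF res r(1)]) (use c in simp)
    then obtain f where f: "f \<in> F" "f x = 1" "\<And>y. y \<notin> ?B r \<Longrightarrow> f y = 0" "\<And>y. 0 \<le> f y" "\<And>y. f y \<le> 1"
       "E f f \<le> 2 / (c * r)"
      using test_function[of "c * r" x "?B r"] c r by auto
    have small: "T / D ^ Suc m * p (T / D ^ Suc m) x x * E f f \<le> \<kappa> / 4 ^ Suc m" for m
    proof -
      have t: "0 < T / D ^ Suc m" using T D by simp
      have "T / D ^ Suc m \<le> T / 1" by (rule divide_left_mono) (use T D in \<open>auto intro!: one_le_power simp del: power_Suc\<close>)
      hence "T / D ^ Suc m < \<tau>" using T by simp
      from \<tau>(2)[OF t this] have "T / D ^ Suc m * p (T / D ^ Suc m) x x \<le> K * \<rho>l (T / D ^ Suc m)" .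
      also have "\<dots> \<le> K * (r / 4 ^ Suc m)"
        unfolding T_def by (intro mult_left_mono inverse_l_scaled) (use r K in auto)
      finally have "T / D ^ Suc m * p (T / D ^ Suc m) x x * E f f \<le> K * (r / 4 ^ Suc m) * (2 / (c * r))"
        by (rule mult_mono[OF _ f(6)]) (use K r nonneg[OF f(1)] in auto)
      also have "\<dots> = \<kappa> / 4 ^ Suc m" using r by (simp add: \<kappa>_def)
      finally show ?thesis .
    qed
    have "\<bar>S (T / D ^ M) f x - f x\<bar> \<le> sqrt (D * \<kappa>) / 2 ^ M"
      by (rule S_near_identity[OF f(1) T(1) _ small]) (use D in auto)
    hence half: "1 / 2 \<le> S (T / D ^ M) f x" using M(1) f(2) by linarith
    have "1 / 4 \<le> p (2 * (T / D ^ M)) x x * (A * Vl r)"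
      by (rule heat_kernel_lower[OF f(1,3,4,5) B meas _ _ half]) (use A Vp T D in auto)
    hence "r \<le> 4 * A * T * p (\<theta> * T) x x" using r by (simp add: Vl \<theta>_def field_simps)
    hence low: "\<theta> / (4 * A) * r \<le> \<theta> * T * p (\<theta> * T) x x"
      using mult_left_mono[of r "4 * A * T * p (\<theta> * T) x x" "\<theta> / (4 * A)"] A \<theta> by (simp add: field_simps)
    have \<theta>T: "0 < \<theta> * T" "\<theta> * T \<le> T" using \<theta> T by (auto simp: mult_le_cancel_right1)
    have "\<rho>l (\<theta> * T) \<le> r" by (rule inverse_l_le[OF rr]) (use \<theta>T in \<open>simp add: T_def\<close>)
    hence "\<theta> / (4 * A) * \<rho>l (\<theta> * T) \<le> \<theta> * T * p (\<theta> * T) x x"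
      using mult_left_mono[of "\<rho>l (\<theta> * T)" r "\<theta> / (4 * A)"] low A \<theta> by simp
    moreover have "0 < \<rho>l (\<theta> * T)"
      by (rule inverse_l_pos[OF \<theta>T(1)]) (use \<theta>T Hl_mono[OF rr r0_radii] r in \<open>simp add: T_def\<close>)
    ultimately show "\<theta> / (4 * A) \<le> (\<theta> * Hl r) * p (\<theta> * Hl r) x x / \<rho>l (\<theta> * Hl r)"
      by (simp add: T_def pos_le_divide_eq)
  qed
  then have freq: "\<exists>\<^sub>F t in at_right 0. \<theta> / (4 * A) \<le> t * p t x x / \<rho>l t"
    by (rule frequently_filterlim[OF filterlim_Hl[OF \<theta>(1)]])
  have "ereal (\<theta> / (4 * A)) \<le> Limsup (at_right 0) (\<lambda>t. ereal (t * p t x x / \<rho>l t))"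
  proof (rule ccontr)
    assume "\<not> ?thesis"
    hence "Limsup (at_right 0) (\<lambda>t. ereal (t * p t x x / \<rho>l t)) < ereal (\<theta> / (4 * A))" by simp
    from Limsup_lessD[OF this] freq show False by (simp add: frequently_def not_le)
  qed
  moreover have "0 < ereal (\<theta> / (4 * A))" using \<theta> A by simp
  ultimately show ?thesis by (rule less_le_trans[rotated])
qed

end

theorem theorem20:
  fixes \<mu> :: "'a::metric_space measure"
    and E :: "('a \<Rightarrow> real) \<Rightarrow> ('a \<Rightarrow> real) \<Rightarrow> real"
    and F F' :: "('a \<Rightarrow> real) set"
    and P :: "real \<Rightarrow> ('a \<Rightarrow> real) \<Rightarrow> 'a \<Rightarrow> real"
    and p :: "real \<Rightarrow> 'a \<Rightarrow> 'a \<Rightarrow> real"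
    and V :: "real \<Rightarrow> real"
    and Cu :: real
    and fl fu :: "real \<Rightarrow> ennreal"
  assumes "locally_compact_space (euclidean :: 'a topology)"
    and "separable_space (euclidean :: 'a topology)"
    and "connected (UNIV :: 'a set)"
    and "sets \<mu> = sets borel"
    and "\<And>K. compact K \<Longrightarrow> emeasure \<mu> K < \<infinity>"
    and "\<And>U. open U \<Longrightarrow> U \<noteq> {} \<Longrightarrow> 0 < emeasure \<mu> U"
    and "dirichlet_form \<mu> E F"
    and "regular_form \<mu> E F"
    and "local_form \<mu> E F"
    and "F \<subseteq> F'"
    and "resistance_form E F'"
    and "Metric_space UNIV (res_dist E F)"
    and "Metric_space.mtopology UNIV (res_dist E F) = euclidean"
    and "0 < res_diameter E F"
    and "form_semigroup \<mu> E F P"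
    and "transition_density \<mu> P p"
    and "strict_mono_on {0..} V"
    and "V 0 = 0"
    and "\<And>r. 0 \<le> r \<Longrightarrow> V (2 * r) \<le> Cu * V r"
    and "fluctuation_functions (res_diameter E F) (ln Cu / ln 2) fl fu"
    and "AE x in \<mu>.
           0 < Liminf (at_right 0) (\<lambda>r. emeasure \<mu> (res_ball E F x r) / Vtilde fl V r) \<and>
           Liminf (at_right 0) (\<lambda>r. emeasure \<mu> (res_ball E F x r) / Vtilde fl V r) < \<infinity> \<and>
           0 < Limsup (at_right 0) (\<lambda>r. emeasure \<mu> (res_ball E F x r) / Vtilde fu V r) \<and>
           0 < Liminf (at_right 0) (\<lambda>r. resistance E F {x} (- res_ball E F x r) / ennreal r)"
  shows "AE x in \<mu>.
           Liminf (at_right 0) (\<lambda>t. ereal (t * p t x x /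
             radial_inverse (res_diameter E F) (htilde fu V) t)) < \<infinity> \<and>
           0 < Limsup (at_right 0) (\<lambda>t. ereal (t * p t x x /
             radial_inverse (res_diameter E F) (htilde fl V) t)) \<and>
           Limsup (at_right 0) (\<lambda>t. ereal (t * p t x x /
             radial_inverse (res_diameter E F) (htilde fl V) t)) < \<infinity>"
proof -
  have form: "nonneg_symmetric_form E F" "markovian E F"
    using assms(7) by (simp_all add: dirichlet_form_def)
  interpret R: Metric_space UNIV "res_dist E F" by (rule assms(12))
  interpret heat_kernel_volume E F \<mu> P p V Cu fl fu
    by unfold_locales (fact form assms)+
  show ?thesis
    using assms(21)
    by eventually_elim (use Liminf_upper Limsup_lower Limsup_upper in blast)
qed

end
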